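(* Let $N^4$ be an oriented Riemannian four-manifold, $X$ an oriented surface, $f\colon X^2\to N^4$ an isometric immersion with normal bundle $\nu$ and second fundamental form $\mathrm{I\!I}$, and let $\varphi_\pm\colon X\to Z_\pm(N)$ be its twistor lifts. Then $$|d\varphi_-^{\mathcal V}|^2+|d\varphi_+^{\mathcal V}|^2=\tfrac12|\mathrm{I\!I}|^2 .$$ Furthermore, if $f$ is minimal, then $|d\varphi_-^{\mathcal V}|=|d\varphi_+^{\mathcal V}|$ if and only if $\mathrm{I\!I}$ takes values in a real line bundle contained in $\nu$ (i.e. at every point $x$ the values of $\mathrm{I\!I}_x$ lie in a real line in $\nu_x$).
   Context: $Z_\pm(N)\to N$ is the twistor bundle whose fibre over $x$ consists of the orthogonal endomorphisms $J_x$ of $T_xN$ with $J_x^2=-1$ which preserve ($+$) or reverse ($-$) orientation, i.e. are compatible with the given orientation or its opposite. The Levi-Civita connection splits $TZ_\pm(N)=\mathcal H\oplus\mathcal V$ into horizontal and vertical parts. The twistor lift $\varphi_\pm(x)$ is the unique element of $Z_\pm(N)$ over $f(x)$ which maps $df(T_xX)$ to itself and restricts there to the rotation by $+90^\circ$ given by the orientation of $X$. $d\varphi_\pm^{\mathcal V}$ is the vertical part of $d\varphi_\pm$. Normalisation: locally let $\{e_1,e_2,e_3,e_4\}$ be an oriented orthonormal frame of $f^*TN$ with $\{e_1,e_2\}$ an oriented frame of $TX$, $\omega_{ij}(v)=g(\nabla_ve_i,e_j)$ and $\omega_{ijk}=\omega_{ij}(e_k)$. The vertical spaces carry the metric for which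 the fibres of $Z_\pm(N)$ are round spheres of radius $\frac12$, so that for suitable orthonormal bases $\{y_5,y_6\}$ of the vertical spaces $$(d\varphi_-)^{\mathcal V}=\tfrac{\omega_{13}+\omega_{24}}2y_5+\tfrac{\omega_{14}-\omega_{23}}2y_6,\qquad (d\varphi_+)^{\mathcal V}=\tfrac{\omega_{14}+\omega_{23}}2y_5+\tfrac{\omega_{13}-\omega_{24}}2y_6 .$$ $|\mathrm{I\!I}|^2=\sum_{i,k\in\{1,2\},\,j\in\{3,4\}}\omega_{ijk}^2$ and $|d\varphi_\pm^{\mathcal V}|^2=\sum_{k=1,2}|d\varphi_\pm^{\mathcal V}(e_k)|^2$. *)

theory Defs
  imports "HOL-Analysis.Analysis" "HOL-Library.Function_Algebras"
begin

instantiation "fun" :: (type, real_vector) real_vector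
begin

definition scaleR_fun :: "real \<Rightarrow> ('a \<Rightarrow> 'b) \<Rightarrow> 'a \<Rightarrow> 'b"
  where "scaleR_fun r u = (\<lambda>c. r *\<^sub>R u c)"

instance
  by standard (simp_all add: scaleR_fun_def fun_eq_iff scaleR_add_right scaleR_add_left)

end

text \<open>Only meant for open \<open>S\<close>.\<close>

primrec Ck_on :: "nat \<Rightarrow> ('a::euclidean_space \<Rightarrow> 'b::real_normed_vector) \<Rightarrow> 'a set \<Rightarrow> bool"
  where
    "Ck_on 0 F S \<longleftrightarrow> continuous_on S F"
  | "Ck_on (Suc k) F S \<longleftrightarrow> (\<forall>y\<in>S. F differentiable (at y)) \<and>
       (\<forall>w. Ck_on k (\<lambda>y. frechet_derivative F (at y) w) S)"

definition smooth_on :: "('a::euclidean_space \<Rightarrow> 'b::real_normed_vector) \<Rightarrow> 'a set \<Rightarrow> bool"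
  where "smooth_on F S \<longleftrightarrow> (\<forall>k. Ck_on k F S)"

datatype ('a, 'k::finite) chart = Chart (cdom: "'a set") (cmap: "'a \<Rightarrow> real ^ 'k")

text \<open>
  A tangent vector is the family of its component vectors in the charts; see
  \<open>tangent_space\<close> below for the transformation rule it has to satisfy.
\<close>

type_synonym ('a, 'k) tvec = "('a, 'k) chart \<Rightarrow> real ^ 'k"

record ('a, 'k) manifold =
  atlas :: "('a, 'k::finite) chart set"
  metric :: "'a \<Rightarrow> ('a, 'k) tvec \<Rightarrow> ('a, 'k) tvec \<Rightarrow> real"

definition carrier :: "('a, 'k::finite) manifold \<Rightarrow> 'a set"
  where "carrier M = (\<Union>c\<in>atlas M. cdom c)"

definition charts_at :: "('a, 'k::finite) manifold \<Rightarrow> 'a \<Rightarrow> ('a, 'k) chart set"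
  where "charts_at M p = {c \<in> atlas M. p \<in> cdom c}"

definition chart_inv :: "('a, 'k::finite) chart \<Rightarrow> real ^ 'k \<Rightarrow> 'a"
  where "chart_inv c = inv_into (cdom c) (cmap c)"

definition transition_deriv ::
  "('a, 'k::finite) chart \<Rightarrow> ('a, 'k) chart \<Rightarrow> 'a \<Rightarrow> real ^ 'k \<Rightarrow> real ^ 'k"
  where "transition_deriv c d p = frechet_derivative (cmap d \<circ> chart_inv c) (at (cmap c p))"

text \<open>The orientation is the one for which all charts of the atlas are positive.\<close>

definition oriented_smooth_atlas :: "('a::topological_space, 'k::finite) manifold \<Rightarrow> bool"
  where "oriented_smooth_atlas M \<longleftrightarrow>
    (\<forall>c\<in>atlas M. open (cdom c) \<and> open (cmap c ` cdom c) \<and>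
       homeomorphism (cdom c) (cmap c ` cdom c) (cmap c) (chart_inv c)) \<and>
    (\<forall>c\<in>atlas M. \<forall>d\<in>atlas M.
       smooth_on (cmap d \<circ> chart_inv c) (cmap c ` (cdom c \<inter> cdom d)) \<and>
       (\<forall>p\<in>cdom c \<inter> cdom d. det (matrix (transition_deriv c d p)) > 0))"

definition tangent_space :: "('a, 'k::finite) manifold \<Rightarrow> 'a \<Rightarrow> ('a, 'k) tvec set"
  where "tangent_space M p =
    {v. (\<forall>c\<in>charts_at M p. \<forall>d\<in>charts_at M p. v d = transition_deriv c d p (v c)) \<and>
        (\<forall>c. c \<notin> charts_at M p \<longrightarrow> v c = 0)}"

text \<open>The tangent vector at \<open>p\<close> with components \<open>w\<close> in the chart \<open>c\<close>.\<close>

definition tvec_of :: "('a, 'k::finite) manifold \<Rightarrow> 'a \<Rightarrow> ('a, 'k) chart \<Rightarrow> real ^ 'k \<Rightarrow> ('a, 'k) tvec"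
  where "tvec_of M p c w = (\<lambda>d. if d \<in> charts_at M p then transition_deriv c d p w else 0)"

text \<open>
  Some notions below are evaluated in a chart around the point. They do not depend on
  the chart (by the chain rule and the transformation rule of the Christoffel symbols),
  so an arbitrary one is used.
\<close>

definition chart_at :: "('a, 'k::finite) manifold \<Rightarrow> 'a \<Rightarrow> ('a, 'k) chart"
  where "chart_at M p = (SOME c. c \<in> charts_at M p)"

definition gram :: "('a, 'k::finite) manifold \<Rightarrow> ('a, 'k) chart \<Rightarrow> real ^ 'k \<Rightarrow> real ^ 'k ^ 'k"
  where "gram M c y = (\<chi> i j. metric M (chart_inv c y)
    (tvec_of M (chart_inv c y) c (axis i 1)) (tvec_of M (chart_inv c y) c (axis j 1)))"

definition riemannian :: "('a, 'k::finite) manifold \<Rightarrow> bool"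
  where "riemannian M \<longleftrightarrow>
    (\<forall>p\<in>carrier M. \<forall>u\<in>tangent_space M p. \<forall>v\<in>tangent_space M p.
       metric M p u v = metric M p v u \<and>
       (u \<noteq> 0 \<longrightarrow> metric M p u u > 0) \<and>
       (\<forall>w\<in>tangent_space M p. \<forall>r.
          metric M p (r *\<^sub>R u + v) w = r * metric M p u w + metric M p v w)) \<and>
    (\<forall>c\<in>atlas M. smooth_on (gram M c) (cmap c ` cdom c))"

definition oriented_riemannian_manifold ::
  "('a::{t2_space, second_countable_topology}, 'k::finite) manifold \<Rightarrow> bool"
  where "oriented_riemannian_manifold M \<longleftrightarrow> oriented_smooth_atlas M \<and> riemannian M"

definition pos_oriented :: "('a, 'k::finite) manifold \<Rightarrow> 'a \<Rightarrow> ('k \<Rightarrow> ('a, 'k) tvec) \<Rightarrow> bool"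
  where "pos_oriented M p b \<longleftrightarrow> (\<forall>c\<in>charts_at M p. det (\<chi> i. b i c) > 0)"

definition neg_oriented :: "('a, 'k::finite) manifold \<Rightarrow> 'a \<Rightarrow> ('k \<Rightarrow> ('a, 'k) tvec) \<Rightarrow> bool"
  where "neg_oriented M p b \<longleftrightarrow> (\<forall>c\<in>charts_at M p. det (\<chi> i. b i c) < 0)"

definition tangent_basis :: "('a, 'k::finite) manifold \<Rightarrow> 'a \<Rightarrow> ('k \<Rightarrow> ('a, 'k) tvec) \<Rightarrow> bool"
  where "tangent_basis M p b \<longleftrightarrow>
    range b \<subseteq> tangent_space M p \<and> inj b \<and> independent (range b)"

definition orthonormal_basis :: "('a, 'k::finite) manifold \<Rightarrow> 'a \<Rightarrow> ('k \<Rightarrow> ('a, 'k) tvec) \<Rightarrow> bool"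
  where "orthonormal_basis M p b \<longleftrightarrow> range b \<subseteq> tangent_space M p \<and>
    (\<forall>i j. metric M p (b i) (b j) = (if i = j then 1 else 0))"

definition onb_at :: "('a, 'k::finite) manifold \<Rightarrow> 'a \<Rightarrow> 'k \<Rightarrow> ('a, 'k) tvec"
  where "onb_at M p = (SOME b. orthonormal_basis M p b)"

definition dir_deriv ::
  "('a, 'k::finite) manifold \<Rightarrow> 'a \<Rightarrow> ('a, 'k) tvec \<Rightarrow> ('a \<Rightarrow> 'b::real_normed_vector) \<Rightarrow> 'b"
  where "dir_deriv M p v F =
    (let c = chart_at M p in frechet_derivative (F \<circ> chart_inv c) (at (cmap c p)) (v c))"

definition differential ::
  "('x, 'j::finite) manifold \<Rightarrow> ('n, 'k::finite) manifold \<Rightarrow> ('x \<Rightarrow> 'n) \<Rightarrow> 'x \<Rightarrow>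
    ('x, 'j) tvec \<Rightarrow> ('n, 'k) tvec"
  where "differential X N f x v =
    (\<lambda>d. if d \<in> charts_at N (f x) then dir_deriv X x v (cmap d \<circ> f) else 0)"

definition smooth_map ::
  "('x::topological_space, 'j::finite) manifold \<Rightarrow> ('n::topological_space, 'k::finite) manifold \<Rightarrow>
    ('x \<Rightarrow> 'n) \<Rightarrow> bool"
  where "smooth_map X N f \<longleftrightarrow> f ` carrier X \<subseteq> carrier N \<and> continuous_on (carrier X) f \<and>
    (\<forall>c\<in>atlas X. \<forall>d\<in>atlas N.
       smooth_on (cmap d \<circ> f \<circ> chart_inv c) (cmap c ` {x \<in> cdom c. f x \<in> cdom d}))"

definition isometric_immersion ::
  "('x::topological_space, 'j::finite) manifold \<Rightarrow> ('n::topological_space, 'k::finite) manifold \<Rightarrow>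
    ('x \<Rightarrow> 'n) \<Rightarrow> bool"
  where "isometric_immersion X N f \<longleftrightarrow> smooth_map X N f \<and>
    (\<forall>x\<in>carrier X. inj_on (differential X N f x) (tangent_space X x)) \<and>
    (\<forall>x\<in>carrier X. \<forall>u\<in>tangent_space X x. \<forall>v\<in>tangent_space X x.
       metric N (f x) (differential X N f x u) (differential X N f x v) = metric X x u v)"

text \<open>
  \<open>christoffel G y u v\<close> is \<open>\<Gamma>\<close> at \<open>y\<close> applied to \<open>u\<close> and \<open>v\<close>, for the metric with
  Gram matrix \<open>G\<close>, i.e. the vector with components
  \<open>(1/2) G^{kl} (\<partial>_i G_{jl} + \<partial>_j G_{il} - \<partial>_l G_{ij}) u^i v^j\<close>.
\<close>

definition christoffel ::
  "(real ^ 'k \<Rightarrow> real ^ 'k ^ 'k) \<Rightarrow> real ^ 'k \<Rightarrow> real ^ 'k \<Rightarrow> real ^ 'k \<Rightarrow> real ^ ('k::finite)"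
  where "christoffel G y u v =
    (let dG = (\<lambda>w a b. a \<bullet> (frechet_derivative G (at y) w *v b)) in
     matrix_inv (G y) *v
       (\<chi> l. (dG u v (axis l 1) + dG v u (axis l 1) - dG (axis l 1) u v) / 2))"

text \<open>The Levi-Civita derivative at \<open>x\<close>, in direction \<open>v\<close>, of a section \<open>s\<close> of \<open>f^*TN\<close>.\<close>

definition cov_deriv ::
  "('x, 'j::finite) manifold \<Rightarrow> ('n, 'k::finite) manifold \<Rightarrow> ('x \<Rightarrow> 'n) \<Rightarrow> 'x \<Rightarrow>
    ('x, 'j) tvec \<Rightarrow> ('x \<Rightarrow> ('n, 'k) tvec) \<Rightarrow> ('n, 'k) tvec"
  where "cov_deriv X N f x v s =
    (let d = chart_at N (f x) in
     tvec_of N (f x) d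
       (dir_deriv X x v (\<lambda>x'. s x' d) +
        christoffel (gram N d) (cmap d (f x)) (differential X N f x v d) (s x d)))"

definition normal_fibre ::
  "('x, 'j::finite) manifold \<Rightarrow> ('n, 'k::finite) manifold \<Rightarrow> ('x \<Rightarrow> 'n) \<Rightarrow> 'x \<Rightarrow> ('n, 'k) tvec set"
  where "normal_fibre X N f x = {n \<in> tangent_space N (f x).
    \<forall>v\<in>tangent_space X x. metric N (f x) (differential X N f x v) n = 0}"

definition normal_part ::
  "('x, 'j::finite) manifold \<Rightarrow> ('n, 'k::finite) manifold \<Rightarrow> ('x \<Rightarrow> 'n) \<Rightarrow> 'x \<Rightarrow>
    ('n, 'k) tvec \<Rightarrow> ('n, 'k) tvec"
  where "normal_part X N f x w = (THE n. n \<in> normal_fibre X N f x \<and>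
    w - n \<in> differential X N f x ` tangent_space X x)"

text \<open>
  \<open>II(u,v)\<close> is the normal part of \<open>\<nabla>_u (df V)\<close> for a local extension \<open>V\<close> of \<open>v\<close>; as it does
  not depend on the extension, the one with constant components in a chart is used.
\<close>

definition second_fundamental_form ::
  "('x, 'j::finite) manifold \<Rightarrow> ('n, 'k::finite) manifold \<Rightarrow> ('x \<Rightarrow> 'n) \<Rightarrow> 'x \<Rightarrow>
    ('x, 'j) tvec \<Rightarrow> ('x, 'j) tvec \<Rightarrow> ('n, 'k) tvec"
  where "second_fundamental_form X N f x u v =
    (let c = chart_at X x; V = (\<lambda>x'. tvec_of X x' c (v c)) in
     normal_part X N f x (cov_deriv X N f x u (\<lambda>x'. differential X N f x' (V x'))))"

text \<open>
  For an adapted oriented orthonormal frame \<open>e\<close> the normal components of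
  \<open>II(e_k,e_i)\<close> are the \<open>\<omega>_{ijk}\<close>, so this is the square root of the sum of the
  \<open>\<omega>_{ijk}^2\<close>.
\<close>

definition II_norm ::
  "('x, 'j::finite) manifold \<Rightarrow> ('n, 'k::finite) manifold \<Rightarrow> ('x \<Rightarrow> 'n) \<Rightarrow> 'x \<Rightarrow> real"
  where "II_norm X N f x =
    (let e = onb_at X x; II = second_fundamental_form X N f x in
     sqrt (\<Sum>i\<in>UNIV. \<Sum>k\<in>UNIV. metric N (f x) (II (e k) (e i)) (II (e k) (e i))))"

definition mean_curvature ::
  "('x, 'j::finite) manifold \<Rightarrow> ('n, 'k::finite) manifold \<Rightarrow> ('x \<Rightarrow> 'n) \<Rightarrow> 'x \<Rightarrow> ('n, 'k) tvec"
  where "mean_curvature X N f x = (1 / real CARD('j)) *\<^sub>R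
    (\<Sum>i\<in>UNIV. second_fundamental_form X N f x (onb_at X x i) (onb_at X x i))"

definition minimal ::
  "('x, 'j::finite) manifold \<Rightarrow> ('n, 'k::finite) manifold \<Rightarrow> ('x \<Rightarrow> 'n) \<Rightarrow> bool"
  where "minimal X N f \<longleftrightarrow> (\<forall>x\<in>carrier X. mean_curvature X N f x = 0)"

datatype twistor_sign = Plus | Minus

text \<open>
  Endomorphisms of \<open>T_pN\<close> are extended by \<open>0\<close> off \<open>T_pN\<close>, so that
  equality of endomorphisms is equality of functions.
\<close>

definition tangent_endo ::
  "('n, 'k::finite) manifold \<Rightarrow> 'n \<Rightarrow> (('n, 'k) tvec \<Rightarrow> ('n, 'k) tvec) \<Rightarrow> bool"
  where "tangent_endo N p J \<longleftrightarrow>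
    (\<forall>u\<in>tangent_space N p. J u \<in> tangent_space N p) \<and>
    (\<forall>u\<in>tangent_space N p. \<forall>v\<in>tangent_space N p. \<forall>r. J (r *\<^sub>R u + v) = r *\<^sub>R J u + J v) \<and>
    (\<forall>u. u \<notin> tangent_space N p \<longrightarrow> J u = 0)"

text \<open>\<open>J\<close> is compatible with the orientation for which the bases \<open>(u, Ju, v, Jv)\<close> are positive.\<close>

definition twistor_space ::
  "twistor_sign \<Rightarrow> ('n, 4) manifold \<Rightarrow> ('n \<times> (('n, 4) tvec \<Rightarrow> ('n, 4) tvec)) set"
  where "twistor_space \<epsilon> N = {(p, J). p \<in> carrier N \<and> tangent_endo N p J \<and>
    (\<forall>u\<in>tangent_space N p. \<forall>v\<in>tangent_space N p. metric N p (J u) (J v) = metric N p u v) \<and>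
    (\<forall>u\<in>tangent_space N p. J (J u) = - u) \<and>
    (\<forall>b. tangent_basis N p b \<and> b 2 = J (b 1) \<and> b 4 = J (b 3) \<longrightarrow>
       (case \<epsilon> of Plus \<Rightarrow> pos_oriented N p b | Minus \<Rightarrow> neg_oriented N p b))}"

definition twistor_lift ::
  "twistor_sign \<Rightarrow> ('x, 2) manifold \<Rightarrow> ('n, 4) manifold \<Rightarrow> ('x \<Rightarrow> 'n) \<Rightarrow>
    'x \<Rightarrow> 'n \<times> (('n, 4) tvec \<Rightarrow> ('n, 4) tvec)"
  where "twistor_lift \<epsilon> X N f x = (THE z. z \<in> twistor_space \<epsilon> N \<and> fst z = f x \<and>
    snd z ` differential X N f x ` tangent_space X x = differential X N f x ` tangent_space X x \<and>
    (\<forall>e. orthonormal_basis X x e \<and> pos_oriented X x e \<longrightarrow>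
       snd z (differential X N f x (e 1)) = differential X N f x (e 2) \<and>
       snd z (differential X N f x (e 2)) = - differential X N f x (e 1)))"

text \<open>
  A chart \<open>d\<close> of \<open>N\<close> turns \<open>End(TN)\<close>, and hence \<open>Z(N)\<close>, into pairs of a point and a
  matrix, and tangent vectors to \<open>Z(N)\<close> into pairs of a vector and a matrix.
\<close>

definition twistor_coords ::
  "('n, 'k::finite) manifold \<Rightarrow> ('n, 'k) chart \<Rightarrow> 'n \<times> (('n, 'k) tvec \<Rightarrow> ('n, 'k) tvec) \<Rightarrow>
    (real ^ 'k) \<times> (real ^ 'k ^ 'k)"
  where "twistor_coords N d z =
    (cmap d (fst z), matrix (\<lambda>w. snd z (tvec_of N (fst z) d w) d))"

text \<open>
  A curve \<open>J\<close> of endomorphisms along a curve \<open>\<gamma>\<close> is parallel iff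
  \<open>J' + [\<Gamma>(\<gamma>'), J] = 0\<close>; the velocities of these curves form the horizontal space.
\<close>

definition horizontal_lift ::
  "(real ^ 'k \<Rightarrow> real ^ 'k ^ 'k) \<Rightarrow> (real ^ 'k) \<times> (real ^ 'k ^ 'k) \<Rightarrow> real ^ 'k \<Rightarrow>
    (real ^ 'k) \<times> (real ^ ('k::finite) ^ 'k)"
  where "horizontal_lift G z w =
    (let \<Gamma> = matrix (christoffel G (fst z) w) in (w, snd z ** \<Gamma> - \<Gamma> ** snd z))"

text \<open>The component in the vertical space (the pairs with vanishing first entry).\<close>

definition vertical_part ::
  "(real ^ 'k \<Rightarrow> real ^ 'k ^ 'k) \<Rightarrow> (real ^ 'k) \<times> (real ^ 'k ^ 'k) \<Rightarrow>
    (real ^ 'k) \<times> (real ^ 'k ^ 'k) \<Rightarrow> (real ^ 'k) \<times> (real ^ ('k::finite) ^ 'k)"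
  where "vertical_part G z \<xi> = \<xi> - horizontal_lift G z (fst \<xi>)"

text \<open>\<open>d\<phi>^V(v)\<close>, as an element of the vertical space inside \<open>End(T_{f(x)}N)\<close>.\<close>

definition lift_deriv_vert ::
  "twistor_sign \<Rightarrow> ('x, 2) manifold \<Rightarrow> ('n, 4) manifold \<Rightarrow> ('x \<Rightarrow> 'n) \<Rightarrow> 'x \<Rightarrow>
    ('x, 2) tvec \<Rightarrow> ('n, 4) tvec \<Rightarrow> ('n, 4) tvec"
  where "lift_deriv_vert \<epsilon> X N f x v =
    (let d = chart_at N (f x);
         z = (\<lambda>x'. twistor_coords N d (twistor_lift \<epsilon> X N f x'));
         B = snd (vertical_part (gram N d) (z x) (dir_deriv X x v z))
     in (\<lambda>u. if u \<in> tangent_space N (f x) then tvec_of N (f x) d (B *v u d) else 0))"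

text \<open>
  The elements \<open>J\<close> of a fibre satisfy \<open>tr (J\<^sup>T J) = 4\<close>; scaling the trace metric
  by \<open>1/16\<close> makes the fibre a round sphere of radius \<open>1/2\<close>.
\<close>

definition vertical_norm ::
  "('n, 4) manifold \<Rightarrow> 'n \<Rightarrow> (('n, 4) tvec \<Rightarrow> ('n, 4) tvec) \<Rightarrow> real"
  where "vertical_norm N p B =
    sqrt ((1 / 16) * (\<Sum>i\<in>UNIV. metric N p (B (onb_at N p i)) (B (onb_at N p i))))"

definition lift_deriv_vert_norm ::
  "twistor_sign \<Rightarrow> ('x, 2) manifold \<Rightarrow> ('n, 4) manifold \<Rightarrow> ('x \<Rightarrow> 'n) \<Rightarrow> 'x \<Rightarrow> real"
  where "lift_deriv_vert_norm \<epsilon> X N f x =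
    sqrt (\<Sum>k\<in>UNIV. (vertical_norm N (f x) (lift_deriv_vert \<epsilon> X N f x (onb_at X x k)))\<^sup>2)"

end

theory Submission
  imports Defs
begin

text \<open>
  Near a point choose an orthonormal frame \<open>E\<close> of \<open>f^*TN\<close> whose first two vectors span \<open>df(TX)\<close>. In this frame
  both twistor lifts have constant matrices \<open>K\<close>, so the covariant derivative of \<open>\<phi>\<close>, which is its
  vertical part, has the matrix \<open>[\<Omega>, K]\<close> with \<open>\<Omega>\<close> the skew connection matrix of the frame. The entries
  \<open>\<Omega>\<^sub>j\<^sub>i\<close> with \<open>i \<le> 2 < j\<close> are the components of the second fundamental form, which gives
  \<open>|d\<phi>\<^sub>\<plusminus>\<^sup>V|\<^sup>2\<close> as quadratic expressions in them. Their sum is half of \<open>|II|\<^sup>2\<close>, and, for a trace-free \<open>II\<close>, their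
  difference is a multiple of the determinant of \<open>II(e\<^sub>1, e\<^sub>1)\<close> and \<open>II(e\<^sub>1, e\<^sub>2)\<close>.
\<close>

section \<open>Determinants and derivatives\<close>

text \<open>The definitions rest on choices: \<open>chart_at\<close>, \<open>onb_at\<close>, and the
  \<open>THE\<close> in \<open>twistor_lift\<close>. The lift can be differentiated only if it is
  known on a neighbourhood, so the frame must exist there; it is made by Gram-Schmidt with its value
  at the point prescribed, and differentiability at that one point suffices. Its first two vectors
  are images of a moving frame of the surface, which is how the Hessian of the immersion enters.
  Since \<open>onb_at\<close> may be negatively oriented, a sign \<sigma> is carried along; it
  occurs only multiplied by the sign t of the twistor space.

  In 2x2 blocks \<open>K\<close> is diagonal with entries j and t j, where j is the rotation by a
  right angle. The diagonal blocks of \<Omega> are multiples of j and commute with \<open>K\<close>,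
  so only the normal components survive in the commutator. The cross terms of the resulting squares
  carry the factor t: they cancel in the sum and make up the difference. That difference is, up to
  sign, the off-diagonal entry of the commutator of the two shape operators, the extrinsic part of
  the normal curvature; for trace-free forms it is twice the determinant.\<close>

lemma det_4:
  fixes A :: "'a::comm_ring_1 ^ 4 ^ 4"
  shows "det A =
    A$1$1 * (A$2$2 * (A$3$3 * A$4$4 - A$3$4 * A$4$3) - A$2$3 * (A$3$2 * A$4$4 - A$3$4 * A$4$2) + A$2$4 * (A$3$2 * A$4$3 - A$3$3 * A$4$2))
    - A$1$2 * (A$2$1 * (A$3$3 * A$4$4 - A$3$4 * A$4$3) - A$2$3 * (A$3$1 * A$4$4 - A$3$4 * A$4$1) + A$2$4 * (A$3$1 * A$4$3 - A$3$3 * A$4$1))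
    + A$1$3 * (A$2$1 * (A$3$2 * A$4$4 - A$3$4 * A$4$2) - A$2$2 * (A$3$1 * A$4$4 - A$3$4 * A$4$1) + A$2$4 * (A$3$1 * A$4$2 - A$3$2 * A$4$1))
    - A$1$4 * (A$2$1 * (A$3$2 * A$4$3 - A$3$3 * A$4$2) - A$2$2 * (A$3$1 * A$4$3 - A$3$3 * A$4$1) + A$2$3 * (A$3$1 * A$4$2 - A$3$2 * A$4$1))"
proof -
  have f1: "finite {2::4, 3, 4}" "1 \<notin> {2::4, 3, 4}" by auto
  have f2: "finite {3::4, 4}" "2 \<notin> {3::4, 4}" by auto
  have f3: "finite {4::4}" "3 \<notin> {4::4}" by auto
  show ?thesis
    unfolding det_def UNIV_4
    unfolding sum_over_permutations_insert[OF f1]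
    unfolding sum_over_permutations_insert[OF f2]
    unfolding sum_over_permutations_insert[OF f3]
    unfolding permutes_sing
    by (simp add: sign_swap_id permutation_swap_id sign_compose sign_id permutation_compose
        swap_id_eq Transposition.transpose_def algebra_simps)
qed

section \<open>Product rules for matrix-valued maps\<close>

lemma has_derivative_matrix_vector_mult [derivative_intros]:
  fixes A :: "'a::real_normed_vector \<Rightarrow> real ^ 'n ^ 'm"
  assumes "(A has_derivative A') (at y within S)" "(u has_derivative u') (at y within S)"
  shows "((\<lambda>y. A y *v u y) has_derivative (\<lambda>h. A y *v u' h + A' h *v u y)) (at y within S)"
proof -
  have "bounded_bilinear (\<lambda>(A :: real ^ 'n ^ 'm) u. A *v u)"
    unfolding bilinear_conv_bounded_bilinear[symmetric]
    by (auto simp: bilinear_def intro!: linearI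
        simp: matrix_vector_right_distrib matrix_vector_mult_add_rdistrib scaleR_matrix_vector_assoc
          matrix_vector_mult_scaleR)
  from bounded_bilinear.FDERIV[OF this assms] show ?thesis .
qed

lemma has_derivative_matrix_matrix_mult [derivative_intros]:
  fixes A :: "'a::real_normed_vector \<Rightarrow> real ^ 'n ^ 'm" and B :: "'a \<Rightarrow> real ^ 'k ^ 'n"
  assumes "(A has_derivative A') (at y within S)" "(B has_derivative B') (at y within S)"
  shows "((\<lambda>y. A y ** B y) has_derivative (\<lambda>h. A y ** B' h + A' h ** B y)) (at y within S)"
proof -
  have "bounded_bilinear (\<lambda>(A :: real ^ 'n ^ 'm) (B :: real ^ 'k ^ 'n). A ** B)"
    unfolding bilinear_conv_bounded_bilinear[symmetric]
    by (auto simp: bilinear_def intro!: linearI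
        simp: vec_eq_iff matrix_matrix_mult_def sum_distrib_left sum.distrib algebra_simps)
  from bounded_bilinear.FDERIV[OF this assms] show ?thesis .
qed

lemma has_derivative_matrix_transpose [derivative_intros]:
  fixes A :: "'a::real_normed_vector \<Rightarrow> real ^ 'n ^ 'm"
  assumes "(A has_derivative A') (at y within S)"
  shows "((\<lambda>y. transpose (A y)) has_derivative (\<lambda>h. transpose (A' h))) (at y within S)"
proof -
  have "linear (transpose :: real ^ 'n ^ 'm \<Rightarrow> _)"
    by (intro linearI) (auto simp: transpose_def vec_eq_iff)
  then have "bounded_linear (transpose :: real ^ 'n ^ 'm \<Rightarrow> _)"
    by (simp add: linear_conv_bounded_linear)
  from bounded_linear.has_derivative[OF this assms] show ?thesis .
qed

text \<open>The second difference of F over the parallelogram spanned by t u and t v is symmetric in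
  u and v. Two mean value theorems write it as \<open>t * t * DD p u v\<close> and, in the other
  order, as \<open>t * t * DD q v u\<close>, with p and q tending to y as t shrinks; continuity of
  \<open>DD\<close> does the rest.\<close>

lemma second_derivative_commute_real:
  fixes F :: "'a::euclidean_space \<Rightarrow> real"
  assumes S: "open S" "y \<in> S"
    and F: "\<And>z. z \<in> S \<Longrightarrow> (F has_derivative D z) (at z)"
    and D: "\<And>z w. z \<in> S \<Longrightarrow> ((\<lambda>z. D z w) has_derivative DD z w) (at z)"
    and cont: "\<And>w w'. continuous_on S (\<lambda>z. DD z w w')"
  shows "DD y u v = DD y v u"
proof -
  have key: "\<exists>p q. norm (p - y) \<le> t * (norm u + norm v) \<and>
      F (y + t *\<^sub>R u + t *\<^sub>R v) - F (y + t *\<^sub>R u) - (F (y + t *\<^sub>R v) - F y) = t * t * DD p u v"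
    if t: "0 < t" and sub: "cball y (t * (norm u + norm v)) \<subseteq> S" for t u v
  proof -
    have inS: "y + a *\<^sub>R u + b *\<^sub>R v \<in> cball y (t * (norm u + norm v))"
      if "0 \<le> a" "a \<le> t" "0 \<le> b" "b \<le> t" for a b
    proof -
      have "norm (a *\<^sub>R u + b *\<^sub>R v) \<le> norm (a *\<^sub>R u) + norm (b *\<^sub>R v)" by (rule norm_triangle_ineq)
      also have "\<dots> \<le> t * norm u + t * norm v" using that by (auto intro!: add_mono mult_right_mono)
      finally show ?thesis by (simp add: dist_norm algebra_simps norm_minus_commute)
    qed
    define \<phi> where "\<phi> a = F (y + a *\<^sub>R u + t *\<^sub>R v) - F (y + a *\<^sub>R u)" for a :: real
    have d\<phi>: "(\<phi> has_real_derivative (D (y + a *\<^sub>R u + t *\<^sub>R v) u - D (y + a *\<^sub>R u) u)) (at a)"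
      if "0 \<le> a" "a \<le> t" for a
    proof -
      have 1: "y + a *\<^sub>R u + t *\<^sub>R v \<in> S" "y + a *\<^sub>R u \<in> S"
        using inS[of a t] inS[of a 0] that t sub by auto
      have l1: "D (y + a *\<^sub>R u + t *\<^sub>R v) (h *\<^sub>R u) = h * D (y + a *\<^sub>R u + t *\<^sub>R v) u"
        "D (y + a *\<^sub>R u) (h *\<^sub>R u) = h * D (y + a *\<^sub>R u) u" for h
        using linear_scale[OF has_derivative_linear[OF F[OF 1(1)]]]
          linear_scale[OF has_derivative_linear[OF F[OF 1(2)]]] by auto
      have "(\<phi> has_derivative (\<lambda>h. D (y + a *\<^sub>R u + t *\<^sub>R v) (h *\<^sub>R u) - D (y + a *\<^sub>R u) (h *\<^sub>R u))) (at a)"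
        unfolding \<phi>_def
        by (rule has_derivative_diff; rule has_derivative_compose[where g=F, rotated], rule F[OF 1(1)] F[OF 1(2)])
          (auto intro!: derivative_eq_intros)
      then show ?thesis unfolding has_field_derivative_def l1
        by (rule has_derivative_eq_rhs) (auto simp: algebra_simps)
    qed
    obtain a where a: "0 < a" "a < t"
      "\<phi> t - \<phi> 0 = (t - 0) * (D (y + a *\<^sub>R u + t *\<^sub>R v) u - D (y + a *\<^sub>R u) u)"
      using MVT2[OF t, of \<phi> "\<lambda>a. D (y + a *\<^sub>R u + t *\<^sub>R v) u - D (y + a *\<^sub>R u) u"] d\<phi> by auto
    define \<psi> where "\<psi> b = D (y + a *\<^sub>R u + b *\<^sub>R v) u" for b :: real
    have d\<psi>: "(\<psi> has_real_derivative DD (y + a *\<^sub>R u + b *\<^sub>R v) u v) (at b)"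
      if "0 \<le> b" "b \<le> t" for b
    proof -
      have 1: "y + a *\<^sub>R u + b *\<^sub>R v \<in> S"
        using inS[of a b] that a sub by auto
      have l1: "DD (y + a *\<^sub>R u + b *\<^sub>R v) u (h *\<^sub>R v) = h * DD (y + a *\<^sub>R u + b *\<^sub>R v) u v" for h
        using linear_scale[OF has_derivative_linear[OF D[OF 1]]] by auto
      have "(\<psi> has_derivative (\<lambda>h. DD (y + a *\<^sub>R u + b *\<^sub>R v) u (h *\<^sub>R v))) (at b)"
        unfolding \<psi>_def
        by (rule has_derivative_compose[where g="\<lambda>z. D z u", rotated], rule D[OF 1])
          (auto intro!: derivative_eq_intros)
      then show ?thesis unfolding has_field_derivative_def l1
        by (rule has_derivative_eq_rhs) (auto simp: algebra_simps)
    qed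
    obtain b where b: "0 < b" "b < t" "\<psi> t - \<psi> 0 = (t - 0) * DD (y + a *\<^sub>R u + b *\<^sub>R v) u v"
      using MVT2[OF t, of \<psi> "\<lambda>b. DD (y + a *\<^sub>R u + b *\<^sub>R v) u v"] d\<psi> by auto
    have "norm (y + a *\<^sub>R u + b *\<^sub>R v - y) \<le> t * (norm u + norm v)"
      using inS[of a b] a b unfolding mem_cball dist_norm by (metis less_imp_le norm_minus_commute)
    moreover have "\<phi> t - \<phi> 0 = t * t * DD (y + a *\<^sub>R u + b *\<^sub>R v) u v"
      using a(3) b(3) by (simp add: \<psi>_def)
    ultimately show ?thesis unfolding \<phi>_def
      by (intro exI[of _ "y + a *\<^sub>R u + b *\<^sub>R v"]) auto
  qed
  obtain r where r: "0 < r" "cball y r \<subseteq> S" using S open_contains_cball by blast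
  show ?thesis
  proof (rule ccontr)
    assume ne: "DD y u v \<noteq> DD y v u"
    \<comment> \<open>Half the gap: a common value cannot be closer than e to both ends.\<close>
    define e where "e = \<bar>DD y u v - DD y v u\<bar> / 2"
    have e: "e > 0" using ne by (simp add: e_def)
    have "\<exists>\<delta>>0. \<forall>z\<in>S. dist z y < \<delta> \<longrightarrow> dist (DD z w w') (DD y w w') < e" for w w'
      using cont[of w w'] S(2) e unfolding continuous_on_iff by blast
    then obtain \<delta>1 \<delta>2 where \<delta>: "\<delta>1 > 0" "\<delta>2 > 0"
      "\<And>z. z \<in> S \<Longrightarrow> dist z y < \<delta>1 \<Longrightarrow> dist (DD z u v) (DD y u v) < e"
      "\<And>z. z \<in> S \<Longrightarrow> dist z y < \<delta>2 \<Longrightarrow> dist (DD z v u) (DD y v u) < e" by metis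
    define m where "m = min r (min \<delta>1 \<delta>2)"
    \<comment> \<open>The added 1 keeps the divisor positive when u and v vanish.\<close>
    define n where "n = norm u + norm v + 1"
    have n: "n > 0" by (simp add: n_def add_nonneg_pos)
    define t where "t = m / (2 * n)"
    have m: "m > 0" using \<delta> r by (simp add: m_def)
    have t: "t > 0" using m n by (simp add: t_def)
    have "t * (norm u + norm v) \<le> t * n" using t by (simp add: n_def)
    also have "\<dots> = m / 2" using n by (simp add: t_def)
    finally have tn: "t * (norm u + norm v) < m" using m by simp
    have sub: "cball y (t * (norm u + norm v)) \<subseteq> S"
      using tn r(2) unfolding m_def by (auto simp: subset_eq)
    obtain p where p: "norm (p - y) \<le> t * (norm u + norm v)"
      "F (y + t *\<^sub>R u + t *\<^sub>R v) - F (y + t *\<^sub>R u) - (F (y + t *\<^sub>R v) - F y) = t * t * DD p u v"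
      using key[OF t sub] by auto
    obtain q where q: "norm (q - y) \<le> t * (norm v + norm u)"
      "F (y + t *\<^sub>R v + t *\<^sub>R u) - F (y + t *\<^sub>R v) - (F (y + t *\<^sub>R u) - F y) = t * t * DD q v u"
      using key[OF t, of v u] sub by (auto simp: add.commute)
    have "F (y + t *\<^sub>R v + t *\<^sub>R u) = F (y + t *\<^sub>R u + t *\<^sub>R v)" by (simp add: add_ac)
    then have "t * t * DD p u v = t * t * DD q v u" using p(2) q(2) by linarith
    then have eq: "DD p u v = DD q v u" using t by simp
    have "p \<in> S" "q \<in> S" using p(1) q(1) sub by (auto simp: dist_norm norm_minus_commute subset_eq add.commute)
    moreover have "dist p y < \<delta>1" "dist q y < \<delta>2"
      using p(1) q(1) tn by (auto simp: dist_norm m_def add.commute)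
    ultimately have "dist (DD p u v) (DD y u v) < e" "dist (DD q v u) (DD y v u) < e" using \<delta> by auto
    then show False using eq unfolding e_def dist_real_def by (simp add: abs_if split: if_splits)
  qed
qed

lemma second_derivative_commute:
  fixes F :: "'a::euclidean_space \<Rightarrow> 'b::euclidean_space"
  assumes F: "Ck_on 2 F S" and S: "open S" "y \<in> S"
  shows "frechet_derivative (\<lambda>z. frechet_derivative F (at z) u) (at y) v =
    frechet_derivative (\<lambda>z. frechet_derivative F (at z) v) (at y) u"
proof (rule euclidean_eqI)
  fix b :: 'b assume "b \<in> Basis"
  define D where "D = (\<lambda>z w. frechet_derivative F (at z) w)"
  define DD where "DD = (\<lambda>z w w'. frechet_derivative (\<lambda>z. D z w) (at z) w')"
  have F2: "Ck_on (Suc (Suc 0)) F S" using F by (simp add: numeral_2_eq_2)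
  have 1: "(F has_derivative D z) (at z)" if "z \<in> S" for z
    using F2 that unfolding D_def by (auto simp: frechet_derivative_works)
  have 2: "((\<lambda>z. D z w) has_derivative DD z w) (at z)" if "z \<in> S" for z w
    using F2 that unfolding D_def DD_def by (auto simp: frechet_derivative_works)
  have 3: "continuous_on S (\<lambda>z. DD z w w')" for w w'
    using F2 unfolding D_def DD_def by auto
  have "DD y u v \<bullet> b = DD y v u \<bullet> b"
    by (rule second_derivative_commute_real[OF S, where F="\<lambda>z. F z \<bullet> b" and D="\<lambda>z w. D z w \<bullet> b"])
      (auto intro!: 1 2 3 has_derivative_inner_left continuous_on_inner continuous_on_const)
  then show "frechet_derivative (\<lambda>z. frechet_derivative F (at z) u) (at y) v \<bullet> b =
      frechet_derivative (\<lambda>z. frechet_derivative F (at z) v) (at y) u \<bullet> b"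
    unfolding DD_def D_def .
qed

section \<open>Charts, tangent spaces and metrics\<close>

lemma sum_fun_apply: "(\<Sum>i\<in>A. g i) c = (\<Sum>i\<in>A. g i c)"
  by (induction A rule: infinite_finite_induct) auto

lemma scaleR_fun_apply [simp]: "(r *\<^sub>R u) c = r *\<^sub>R u c"
  by (simp add: scaleR_fun_def)

lemma smooth_on_imp_differentiable:
  "smooth_on F S \<Longrightarrow> y \<in> S \<Longrightarrow> F differentiable (at y)"
  unfolding smooth_on_def by (metis Ck_on.simps(2))

lemma smooth_on_imp_has_derivative:
  "smooth_on F S \<Longrightarrow> y \<in> S \<Longrightarrow> (F has_derivative frechet_derivative F (at y)) (at y)"
  using smooth_on_imp_differentiable frechet_derivative_works by blast

lemma smooth_on_imp_frechet_has_derivative: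
  assumes "smooth_on F S" "y \<in> S"
  shows "((\<lambda>z. frechet_derivative F (at z) w) has_derivative
    frechet_derivative (\<lambda>z. frechet_derivative F (at z) w) (at y)) (at y)"
proof -
  have "Ck_on (Suc (Suc 0)) F S" using assms(1) by (simp add: smooth_on_def)
  then show ?thesis using assms(2) by (auto simp: frechet_derivative_works)
qed

section \<open>Tangent vectors and orientation in charts\<close>

context
  fixes M :: "('a::topological_space, 'k::finite) manifold"
  assumes M: "oriented_smooth_atlas M"
begin

lemma open_cdom: "c \<in> atlas M \<Longrightarrow> open (cdom c)"
  using M by (auto simp: oriented_smooth_atlas_def)

lemma chart_homeomorphism:
  "c \<in> atlas M \<Longrightarrow> homeomorphism (cdom c) (cmap c ` cdom c) (cmap c) (chart_inv c)"
  using M by (auto simp: oriented_smooth_atlas_def)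

lemma chart_inv_cmap: "c \<in> atlas M \<Longrightarrow> p \<in> cdom c \<Longrightarrow> chart_inv c (cmap c p) = p"
  using chart_homeomorphism by (simp add: homeomorphism_def)

lemma open_cmap_image:
  assumes "c \<in> atlas M" "open S" "S \<subseteq> cdom c"
  shows "open (cmap c ` S)"
proof -
  have "openin (top_of_set (cmap c ` cdom c)) (cmap c ` S)"
    by (rule homeomorphism_imp_open_map[OF chart_homeomorphism[OF assms(1)]])
      (use assms open_cdom in \<open>simp add: openin_open_eq\<close>)
  moreover have "open (cmap c ` cdom c)" using M assms(1) by (auto simp: oriented_smooth_atlas_def)
  ultimately show ?thesis using openin_open_trans by blast
qed

lemma charts_atD: "c \<in> charts_at M p \<Longrightarrow> c \<in> atlas M" "c \<in> charts_at M p \<Longrightarrow> p \<in> cdom c"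
  by (auto simp: charts_at_def)

lemma chart_at_in: "p \<in> carrier M \<Longrightarrow> chart_at M p \<in> charts_at M p"
  unfolding chart_at_def by (rule someI_ex) (auto simp: carrier_def charts_at_def)

lemma charts_at_imp_carrier: "c \<in> charts_at M p \<Longrightarrow> p \<in> carrier M"
  by (auto simp: charts_at_def carrier_def)

lemma transition_has_derivative:
  assumes "c \<in> charts_at M p" "d \<in> charts_at M p"
  shows "(cmap d \<circ> chart_inv c has_derivative transition_deriv c d p) (at (cmap c p))"
  unfolding transition_deriv_def
  by (rule smooth_on_imp_has_derivative[where S="cmap c ` (cdom c \<inter> cdom d)"])
    (use M assms in \<open>auto simp: oriented_smooth_atlas_def charts_at_def\<close>)

lemma transition_linear:
  "c \<in> charts_at M p \<Longrightarrow> d \<in> charts_at M p \<Longrightarrow> linear (transition_deriv c d p)"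
  using transition_has_derivative has_derivative_linear by blast

lemma transition_compose:
  assumes c: "c \<in> charts_at M p" and d: "d \<in> charts_at M p" and e: "e \<in> charts_at M p"
  shows "transition_deriv d e p (transition_deriv c d p w) = transition_deriv c e p w"
proof -
  define S where "S = cmap c ` (cdom c \<inter> cdom d)"
  have S: "open S" "cmap c p \<in> S"
    unfolding S_def using c d by (auto simp: charts_at_def intro!: open_cmap_image open_Int open_cdom)
  have p: "(cmap d \<circ> chart_inv c) (cmap c p) = cmap d p"
    using c by (simp add: chart_inv_cmap charts_atD)
  have "(cmap e \<circ> chart_inv d \<circ> (cmap d \<circ> chart_inv c) has_derivative
      transition_deriv d e p \<circ> transition_deriv c d p) (at (cmap c p))"
    by (rule diff_chain_at[OF transition_has_derivative[OF c d]])
      (use transition_has_derivative[OF d e] in \<open>simp only: p\<close>)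
  then have "(cmap e \<circ> chart_inv c has_derivative
      transition_deriv d e p \<circ> transition_deriv c d p) (at (cmap c p))"
    by (rule has_derivative_transform_within_open[OF _ S])
      (use c d in \<open>auto simp: charts_at_def S_def chart_inv_cmap\<close>)
  from has_derivative_unique[OF this transition_has_derivative[OF c e]] show ?thesis
    by (metis comp_apply)
qed

lemma transition_self:
  assumes c: "c \<in> charts_at M p"
  shows "transition_deriv c c p w = w"
proof -
  have "open (cmap c ` cdom c)" "cmap c p \<in> cmap c ` cdom c"
    using c by (auto simp: charts_at_def intro!: open_cmap_image open_cdom)
  then have "(cmap c \<circ> chart_inv c has_derivative (\<lambda>h. h)) (at (cmap c p))"
    by (rule has_derivative_transform_within_open[OF has_derivative_ident])
      (use c in \<open>auto simp: charts_at_def chart_inv_cmap\<close>)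
  from has_derivative_unique[OF this transition_has_derivative[OF c c]] show ?thesis by metis
qed

lemma tvec_of_in_tangent_space: "c \<in> charts_at M p \<Longrightarrow> tvec_of M p c w \<in> tangent_space M p"
  by (auto simp: tangent_space_def tvec_of_def transition_compose)

lemma tvec_of_self: "c \<in> charts_at M p \<Longrightarrow> tvec_of M p c w c = w"
  by (simp add: tvec_of_def transition_self)

lemma tvec_of_component:
  "c \<in> charts_at M p \<Longrightarrow> v \<in> tangent_space M p \<Longrightarrow> tvec_of M p c (v c) = v"
  unfolding tangent_space_def tvec_of_def fun_eq_iff mem_Collect_eq by metis

lemma tangent_space_eqI:
  "c \<in> charts_at M p \<Longrightarrow> u \<in> tangent_space M p \<Longrightarrow> v \<in> tangent_space M p \<Longrightarrow> u c = v c \<Longrightarrow> u = v"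
  by (metis tvec_of_component)

lemma linear_tvec_of: "c \<in> charts_at M p \<Longrightarrow> linear (tvec_of M p c)"
  using transition_linear
  by (intro linearI) (auto simp: tvec_of_def fun_eq_iff linear_add linear_scale)

lemma subspace_tangent_space:
  assumes "p \<in> carrier M"
  shows "subspace (tangent_space M p)"
proof -
  have "tangent_space M p = range (tvec_of M p (chart_at M p))"
    using tvec_of_in_tangent_space[OF chart_at_in[OF assms]]
      tvec_of_component[OF chart_at_in[OF assms], symmetric] by blast
  then show ?thesis
    using linear_subspace_image[OF linear_tvec_of[OF chart_at_in[OF assms]] subspace_UNIV] by simp
qed

text \<open>This makes orientation testable in a single chart: between charts the determinant in
  \<open>pos_oriented\<close> and \<open>neg_oriented\<close> changes by a positive Jacobian
  factor.\<close>

lemma det_chart_change: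
  assumes c: "c \<in> charts_at M p" and d: "d \<in> charts_at M p" and b: "range b \<subseteq> tangent_space M p"
  shows "det (\<chi> i. b i d) = det (matrix (transition_deriv c d p)) * det (\<chi> i. b i c)"
    and "det (matrix (transition_deriv c d p)) > 0"
proof -
  have "b i d = matrix (transition_deriv c d p) *v b i c" for i
    using b c d unfolding fun_cong[OF matrix_vector_mul(2)[OF transition_linear[OF c d]]] tangent_space_def
    by blast
  then have "(\<chi> i. b i d) = (\<chi> i. b i c) ** transpose (matrix (transition_deriv c d p))"
    by (simp add: vec_eq_iff matrix_matrix_mult_def transpose_def matrix_vector_mult_def mult.commute)
  then show "det (\<chi> i. b i d) = det (matrix (transition_deriv c d p)) * det (\<chi> i. b i c)"
    by (simp add: det_mul det_transpose)
  show "det (matrix (transition_deriv c d p)) > 0"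
    using M c d by (auto simp: oriented_smooth_atlas_def charts_at_def)
qed

lemma pos_oriented_iff:
  assumes c: "c \<in> charts_at M p" and b: "range b \<subseteq> tangent_space M p"
  shows "pos_oriented M p b \<longleftrightarrow> det (\<chi> i. b i c) > 0"
proof -
  have "det (\<chi> i. b i d) > 0 \<longleftrightarrow> det (\<chi> i. b i c) > 0" if "d \<in> charts_at M p" for d
    using det_chart_change[OF c that b] by (simp add: zero_less_mult_iff)
  then show ?thesis using c unfolding pos_oriented_def by blast
qed

lemma neg_oriented_iff:
  assumes c: "c \<in> charts_at M p" and b: "range b \<subseteq> tangent_space M p"
  shows "neg_oriented M p b \<longleftrightarrow> det (\<chi> i. b i c) < 0"
proof -
  have "det (\<chi> i. b i d) < 0 \<longleftrightarrow> det (\<chi> i. b i c) < 0" if "d \<in> charts_at M p" for d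
    using det_chart_change[OF c that b] by (simp add: mult_less_0_iff)
  then show ?thesis using c unfolding neg_oriented_def by blast
qed

end

section \<open>The metric in a chart\<close>

context
  fixes M :: "('a::topological_space, 'k::finite) manifold"
  assumes M: "oriented_smooth_atlas M" and R: "riemannian M"
begin

lemma metric_sym:
  "p \<in> carrier M \<Longrightarrow> u \<in> tangent_space M p \<Longrightarrow> v \<in> tangent_space M p \<Longrightarrow> metric M p u v = metric M p v u"
  using R by (auto simp: riemannian_def)

lemma metric_pos:
  "p \<in> carrier M \<Longrightarrow> u \<in> tangent_space M p \<Longrightarrow> u \<noteq> 0 \<Longrightarrow> metric M p u u > 0"
  using R by (auto simp: riemannian_def)

lemma metric_lin:
  "p \<in> carrier M \<Longrightarrow> u \<in> tangent_space M p \<Longrightarrow> v \<in> tangent_space M p \<Longrightarrow> w \<in> tangent_space M p \<Longrightarrow>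
    metric M p (r *\<^sub>R u + v) w = r * metric M p u w + metric M p v w"
  using R by (auto simp: riemannian_def)

text \<open>\<open>metric\<close> is constrained on tangent vectors only. Pulled back along the
  linear map \<open>tvec_of\<close> it becomes a bilinear form on the whole coordinate space,
  determined by its values on the standard basis, and can be handled by matrix algebra.\<close>

lemma metric_tvec_of:
  assumes c: "c \<in> charts_at M p"
  shows "metric M p (tvec_of M p c a) (tvec_of M p c b) = a \<bullet> (gram M c (cmap c p) *v b)"
proof -
  note pc = charts_at_imp_carrier[OF M c] and T = tvec_of_in_tangent_space[OF M c]
    and lt = linear_tvec_of[OF M c]
  define h where "h a b = metric M p (tvec_of M p c a) (tvec_of M p c b)" for a b
  have hl: "h (r *\<^sub>R a + a') b = r * h a b + h a' b" for r a a' b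
    unfolding h_def linear_add[OF lt] linear_scale[OF lt] by (rule metric_lin[OF pc T T T])
  have hs: "h a b = h b a" for a b unfolding h_def by (rule metric_sym[OF pc T T])
  have h0: "h 0 b = 0" for b using hl[of 1 0 0 b] by simp
  have lin: "linear (\<lambda>a. h a b)" for b
    using hl[of 1 _ _ b] hl[of _ _ 0 b] h0 by (intro linearI) auto
  have lin2: "linear (h a)" for a using lin[of a] unfolding hs[of _ a] .
  have "h a b = h (\<Sum>i\<in>UNIV. a $ i *\<^sub>R axis i 1) (\<Sum>i\<in>UNIV. b $ i *\<^sub>R axis i 1)"
    using basis_expansion[of a] basis_expansion[of b] by (simp add: scalar_mult_eq_scaleR)
  also have "\<dots> = (\<Sum>i\<in>UNIV. \<Sum>j\<in>UNIV. a $ i * (b $ j * h (axis i 1) (axis j 1)))"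
    by (simp add: linear_sum[OF lin] linear_scale[OF lin] linear_sum[OF lin2] linear_scale[OF lin2] sum_distrib_left mult.left_commute)
      (rule sum.swap)?
  also have "\<dots> = a \<bullet> (gram M c (cmap c p) *v b)"
    unfolding h_def gram_def inner_vec_def matrix_vector_mult_def chart_inv_cmap[OF M charts_atD[OF M c]]
    by (simp add: sum_distrib_left mult_ac)
  finally show ?thesis unfolding h_def .
qed

lemma metric_eq_gram:
  assumes "c \<in> charts_at M p" "u \<in> tangent_space M p" "v \<in> tangent_space M p"
  shows "metric M p u v = u c \<bullet> (gram M c (cmap c p) *v v c)"
  using metric_tvec_of[OF assms(1), of "u c" "v c"] tvec_of_component[OF M assms(1)] assms by simp

lemma transpose_gram:
  assumes c: "c \<in> charts_at M p"
  shows "transpose (gram M c (cmap c p)) = gram M c (cmap c p)"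
  unfolding gram_def chart_inv_cmap[OF M charts_atD[OF M c]]
  by (simp add: transpose_def vec_eq_iff tvec_of_in_tangent_space[OF M c]
      metric_sym[OF charts_at_imp_carrier[OF M c]])

lemma gram_pos:
  assumes c: "c \<in> charts_at M p" and "a \<noteq> 0"
  shows "a \<bullet> (gram M c (cmap c p) *v a) > 0"
proof -
  have "tvec_of M p c a \<noteq> 0" using tvec_of_self[OF M c, of a] assms(2) by auto
  from metric_pos[OF charts_at_imp_carrier[OF M c] tvec_of_in_tangent_space[OF M c] this]
  show ?thesis by (simp add: metric_tvec_of[OF c])
qed

lemma gram_has_derivative:
  "c \<in> charts_at M p \<Longrightarrow>
    (gram M c has_derivative frechet_derivative (gram M c) (at (cmap c p))) (at (cmap c p))"
  using R charts_atD[OF M] by (intro smooth_on_imp_has_derivative) (auto simp: riemannian_def)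

end

section \<open>Orthonormal frames and complex structures in dimension four\<close>

lemma matrix_mult_add_rdistrib: "(A + B) ** C = A ** C + B ** (C :: 'a::semiring_1 ^ 'n ^ 'm)"
  by (simp add: vec_eq_iff matrix_matrix_mult_def sum.distrib algebra_simps)

lemma matrix_mult_minus_left: "(- A) ** B = - (A ** (B :: 'a::ring_1 ^ 'n ^ 'm))"
  by (simp add: vec_eq_iff matrix_matrix_mult_def sum_negf)

lemma matrix_vector_mult_minus_left: "(- A) *v x = - (A *v (x :: 'a::ring_1 ^ 'n))"
  by (simp add: vec_eq_iff matrix_vector_mult_def sum_negf)

lemma matrix_mult_minus_right: "A ** (- B) = - (A ** (B :: 'a::ring_1 ^ 'n ^ 'm))"
  by (simp add: vec_eq_iff matrix_matrix_mult_def sum_negf)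

lemma matrix_mult_diff_rdistrib: "(A - B) ** C = A ** C - B ** (C :: 'a::ring_1 ^ 'n ^ 'm)"
  using matrix_mult_add_rdistrib[of A "- B" C] by (simp add: matrix_mult_minus_left)

lemma matrix_mult_diff_ldistrib: "C ** (A - B) = C ** A - C ** (B :: 'a::ring_1 ^ 'n ^ 'm)"
  using matrix_add_ldistrib[of C A "- B"] by (simp add: matrix_mult_minus_right)

lemma transpose_add: "transpose (A + B) = transpose A + transpose B"
  by (simp add: vec_eq_iff transpose_def)

text \<open>A frame is stored as a matrix \<open>E\<close> whose columns are the chart components of
  its vectors; it maps frame coordinates to chart coordinates. Orthonormality for \<open>G\<close>
  reads \<open>transpose E ** G ** E = mat 1\<close>, and for square \<open>E\<close> this makes
  \<open>transpose E ** G\<close> the inverse of \<open>E\<close>.\<close>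

lemma frame_entry:
  fixes E :: "real ^ 'm ^ 'k"
  shows "(transpose E ** G ** E) $ i $ j = column i E \<bullet> (G *v column j E)"
  unfolding matrix_mul_assoc[symmetric]
  by (simp add: matrix_matrix_mult_def matrix_vector_mult_def transpose_def column_def inner_vec_def)

lemma frame_iff:
  fixes E :: "real ^ 'm ^ 'k"
  shows "transpose E ** G ** E = mat 1 \<longleftrightarrow>
    (\<forall>i j. column i E \<bullet> (G *v column j E) = (if i = j then 1 else 0))"
  by (simp add: vec_eq_iff frame_entry mat_def)

lemma symmetric_inner_swap:
  "transpose G = G \<Longrightarrow> x \<bullet> (G *v y) = y \<bullet> (G *v (x :: real ^ 'k))"
  by (metis dot_lmul_matrix inner_commute transpose_matrix_vector)

lemma frame_inner:
  fixes E :: "real ^ 'm ^ 'k"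
  assumes "transpose E ** G ** E = mat 1"
  shows "(E *v a) \<bullet> (G *v (E *v b)) = a \<bullet> b"
proof -
  have "(E *v a) \<bullet> (G *v (E *v b)) = a \<bullet> (transpose E *v (G *v (E *v b)))"
    by (metis dot_lmul_matrix inner_commute transpose_matrix_vector)
  also have "transpose E *v (G *v (E *v b)) = b"
    by (metis assms matrix_vector_mul_assoc matrix_vector_mul_lid)
  finally show ?thesis .
qed

lemma frame_inverse:
  fixes E :: "real ^ 'k ^ 'k"
  assumes "transpose E ** G ** E = mat 1"
  shows "E ** (transpose E ** G) = mat 1"
  using assms matrix_left_right_inverse by blast

text \<open>Induction on the number of missing indices. Fewer vectors \<open>G *v e j\<close> than
  the dimension leave a nonzero vector that is Euclidean-orthogonal to all of them, hence orthogonal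
  to the family with respect to \<open>G\<close>; normalised, it joins the family.\<close>

lemma orthonormal_family_extend:
  fixes G :: "real ^ 'k ^ 'k" and S :: "'k set"
  assumes sym: "transpose G = G" and pos: "\<And>a. a \<noteq> 0 \<Longrightarrow> a \<bullet> (G *v a) > 0"
  assumes "\<And>i j. i \<in> S \<Longrightarrow> j \<in> S \<Longrightarrow> e i \<bullet> (G *v e j) = (if i = j then 1 else 0)"
  shows "\<exists>e'. (\<forall>i\<in>S. e' i = e i) \<and> (\<forall>i j. e' i \<bullet> (G *v e' j) = (if i = j then 1 else 0))"
  using assms(3)
proof (induction "card (- S)" arbitrary: S e)
  case 0
  then have "- S = {}" by (metis card_eq_0_iff finite_code)
  then have "S = UNIV" by auto
  with 0 show ?case by blast
next
  case (Suc n)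
  then have "- S \<noteq> {}" by (metis card.empty nat.distinct(1))
  then obtain k where k: "k \<notin> S" by auto
  have "dim ((\<lambda>j. G *v e j) ` S) \<le> card ((\<lambda>j. G *v e j) ` S)" by (rule dim_le_card') auto
  also have "\<dots> \<le> card S" by (rule card_image_le) auto
  also have "\<dots> < CARD('k)" using k by (intro psubset_card_mono) auto
  finally obtain v where v: "v \<noteq> 0" "\<And>w. w \<in> span ((\<lambda>j. G *v e j) ` S) \<Longrightarrow> orthogonal v w"
    using orthogonal_to_subspace_exists[of "(\<lambda>j. G *v e j) ` S"] by auto
  have v0: "v \<bullet> (G *v e j) = 0" "e j \<bullet> (G *v v) = 0" if "j \<in> S" for j
    using v(2)[OF span_base[OF imageI[OF that]]] symmetric_inner_swap[OF sym]
    by (auto simp: orthogonal_def)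
  define q where "q = v \<bullet> (G *v v)"
  have q: "q > 0" unfolding q_def by (rule pos[OF v(1)])
  define e1 where "e1 = e(k := (1 / sqrt q) *\<^sub>R v)"
  have "(1 / sqrt q) * ((1 / sqrt q) * q) = 1" using q by (simp add: field_simps)
  then have "e1 i \<bullet> (G *v e1 j) = (if i = j then 1 else 0)" if "i \<in> insert k S" "j \<in> insert k S" for i j
    using that v0 Suc.prems k unfolding e1_def
    by (auto simp: matrix_vector_mult_scaleR q_def[symmetric])
  moreover have "n = card (- insert k S)" 
  proof -
    have "- S = insert k (- insert k S)" using k by auto
    then have "card (- S) = Suc (card (- insert k S))" by (metis ComplD card_insert_disjoint finite_code insertI1)
    then show ?thesis using Suc.hyps(2) by simp
  qed
  ultimately obtain e' where e': "\<forall>i\<in>insert k S. e' i = e1 i"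
    "\<forall>i j. e' i \<bullet> (G *v e' j) = (if i = j then 1 else 0)"
    using Suc.hyps(1)[of "insert k S" e1] by blast
  have "\<forall>i\<in>S. e' i = e i" using e'(1) k by (auto simp: e1_def)
  with e'(2) show ?case by blast
qed

section \<open>Gram-Schmidt depending differentiably on a parameter\<close>

lemma differentiable_matrix_vector_mult [derivative_intros]:
  fixes A :: "'a::real_normed_vector \<Rightarrow> real ^ 'n ^ 'm"
  shows "A differentiable (at y within S) \<Longrightarrow> u differentiable (at y within S) \<Longrightarrow>
    (\<lambda>y. A y *v u y) differentiable (at y within S)"
  unfolding differentiable_def by (blast intro: has_derivative_matrix_vector_mult)

lemma differentiable_inner [derivative_intros]:
  "f differentiable (at y within S) \<Longrightarrow> g differentiable (at y within S) \<Longrightarrow>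
    (\<lambda>y. f y \<bullet> g y) differentiable (at y within S)"
  unfolding differentiable_def by (blast intro: has_derivative_inner)

lemma differentiable_sqrt:
  fixes q :: "'a::real_normed_vector \<Rightarrow> real"
  assumes "q differentiable (at y)" "q y > 0"
  shows "(\<lambda>y. sqrt (q y)) differentiable (at y)"
  using assms has_derivative_real_sqrt unfolding differentiable_def by blast

text \<open>The metric varies with y. The conditions on \<open>a\<close> at y0 make the correction
  vanish there, so the new field keeps the prescribed value \<open>a y0\<close>. Differentiability
  at y0 together with orthonormality near y0 is what \<open>frame_connection\<close> asks of a
  frame.\<close>

lemma gram_schmidt_step:
  fixes G :: "'a::real_normed_vector \<Rightarrow> real ^ 'k ^ 'k" and e :: "'i \<Rightarrow> 'a \<Rightarrow> real ^ 'k"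
  assumes "finite S" and G: "G differentiable (at y0)"
    and sym: "\<forall>\<^sub>F y in nhds y0. transpose (G y) = G y"
    and e: "\<And>j. j \<in> S \<Longrightarrow> e j differentiable (at y0)"
    and on: "\<And>i j. i \<in> S \<Longrightarrow> j \<in> S \<Longrightarrow> \<forall>\<^sub>F y in nhds y0. e i y \<bullet> (G y *v e j y) = (if i = j then 1 else 0)"
    and a: "a differentiable (at y0)" "a y0 \<bullet> (G y0 *v a y0) = 1"
      "\<And>j. j \<in> S \<Longrightarrow> e j y0 \<bullet> (G y0 *v a y0) = 0"
  obtains n where "n differentiable (at y0)" "n y0 = a y0"
    "\<forall>\<^sub>F y in nhds y0. n y \<bullet> (G y *v n y) = 1"
    "\<And>j. j \<in> S \<Longrightarrow> \<forall>\<^sub>F y in nhds y0. e j y \<bullet> (G y *v n y) = 0 \<and> n y \<bullet> (G y *v e j y) = 0"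
proof -
  define u where "u y = a y - (\<Sum>j\<in>S. (e j y \<bullet> (G y *v a y)) *\<^sub>R e j y)" for y
  define q where "q y = u y \<bullet> (G y *v u y)" for y
  define n where "n y = (1 / sqrt (q y)) *\<^sub>R u y" for y
  have u0: "u y0 = a y0" using a(3) by (simp add: u_def)
  have q0: "q y0 = 1" using a(2) by (simp add: q_def u0)
  have du: "u differentiable (at y0)"
    unfolding u_def using \<open>finite S\<close> e a G
    by (intro differentiable_diff differentiable_sum ballI differentiable_scaleR
        differentiable_inner differentiable_matrix_vector_mult) auto
  have dq: "q differentiable (at y0)"
    unfolding q_def by (intro differentiable_inner differentiable_matrix_vector_mult du G)
  have dn: "n differentiable (at y0)"
    unfolding n_def using q0
    by (intro differentiable_scaleR differentiable_divide differentiable_sqrt du dq) auto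
  have "(q \<longlongrightarrow> q y0) (nhds y0)"
    using differentiable_imp_continuous_within[OF dq] unfolding continuous_within tendsto_at_iff_tendsto_nhds .
  then have qpos: "\<forall>\<^sub>F y in nhds y0. q y > 0" using q0 order_tendstoD(1)[of q "q y0" _ 0] by simp
  have onall: "\<forall>\<^sub>F y in nhds y0. \<forall>i\<in>S. \<forall>j\<in>S. e i y \<bullet> (G y *v e j y) = (if i = j then 1 else 0)"
    by (intro eventually_ball_finite ballI \<open>finite S\<close> on)
  show thesis
  proof (rule that[OF dn])
    show "n y0 = a y0" by (simp add: n_def q0 u0)
    show "\<forall>\<^sub>F y in nhds y0. n y \<bullet> (G y *v n y) = 1"
      using qpos
    proof eventually_elim
      case (elim y)
      have "n y \<bullet> (G y *v n y) = (1 / sqrt (q y)) * ((1 / sqrt (q y)) * q y)"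
        unfolding n_def q_def by (simp add: matrix_vector_mult_scaleR)
      then show ?case using elim by (simp add: field_simps)
    qed
    show "\<forall>\<^sub>F y in nhds y0. e k y \<bullet> (G y *v n y) = 0 \<and> n y \<bullet> (G y *v e k y) = 0" if k: "k \<in> S" for k
      using onall sym
    proof eventually_elim
      case (elim y)
      have "e k y \<bullet> (G y *v u y) = e k y \<bullet> (G y *v a y) -
          (\<Sum>j\<in>S. (e j y \<bullet> (G y *v a y)) * (e k y \<bullet> (G y *v e j y)))"
        unfolding u_def
        by (simp add: matrix_vector_mult_diff_distrib inner_diff_right
            linear_sum[OF matrix_vector_mul_linear] inner_sum_right matrix_vector_mult_scaleR)
      also have "(\<Sum>j\<in>S. (e j y \<bullet> (G y *v a y)) * (e k y \<bullet> (G y *v e j y))) =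
          (\<Sum>j\<in>S. if j = k then e j y \<bullet> (G y *v a y) else 0)"
        using elim(1) k by (intro sum.cong) auto
      also have "\<dots> = e k y \<bullet> (G y *v a y)" using k \<open>finite S\<close> by simp
      finally have "e k y \<bullet> (G y *v n y) = 0" by (simp add: n_def matrix_vector_mult_scaleR)
      then show ?case using symmetric_inner_swap[OF elim(2)] by metis
    qed
  qed
qed

text \<open>The complex structure taking the first frame vector to the second and the third to t
  times the fourth. For t = 1 it is compatible with the standard orientation, for t = -1 with the
  opposite one.\<close>

definition twistor_matrix :: "real \<Rightarrow> real ^ 4 ^ 4"
  where "twistor_matrix t = (\<chi> i j.
    if i = 2 \<and> j = 1 then 1 else if i = 1 \<and> j = 2 then - 1
    else if i = 4 \<and> j = 3 then t else if i = 3 \<and> j = 4 then - t else 0)"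

text \<open>Orthogonality and square -1 make A skew. The image of the first basis vector determines
  that of the second, skewness clears the mixed blocks, and the remaining 2x2 skew block has square
  -1, which leaves one sign.\<close>

lemma twistor_matrix_unique:
  fixes A :: "real ^ 4 ^ 4"
  assumes orth: "transpose A ** A = mat 1" and sq: "A ** A = - mat 1" and A1: "A *v axis 1 1 = axis 2 1"
  shows "\<exists>t. (t = 1 \<or> t = - 1) \<and> A = twistor_matrix t"
proof -
  have "transpose A = - (transpose A ** (A ** A))" by (simp add: sq matrix_mult_minus_right)
  also have "\<dots> = - A" by (simp add: matrix_mul_assoc orth)
  finally have skew: "A $ i $ j = - A $ j $ i" for i j
    by (metis (no_types) transpose_def vec_lambda_beta vector_uminus_component)
  have "A *v axis 2 1 = (A ** A) *v axis 1 1" by (simp only: A1[symmetric] matrix_vector_mul_assoc)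
  also have "\<dots> = - axis 1 1" by (simp add: sq matrix_vector_mult_minus_left)
  finally have "A *v axis 2 1 = - axis 1 1" .
  moreover have "A *v axis i 1 = (\<chi> j. A $ j $ i)" for i
    by (simp add: matrix_vector_mult_basis column_def)
  ultimately have c1: "A $ 1 $ 1 = 0" "A $ 2 $ 1 = 1" "A $ 3 $ 1 = 0" "A $ 4 $ 1 = 0"
    and c2: "A $ 1 $ 2 = - 1" "A $ 2 $ 2 = 0" "A $ 3 $ 2 = 0" "A $ 4 $ 2 = 0"
    using A1 by (auto simp: vec_eq_iff forall_4 axis_def)
  have c3: "A $ 1 $ 3 = 0" "A $ 2 $ 3 = 0" "A $ 3 $ 3 = 0" "A $ 1 $ 4 = 0" "A $ 2 $ 4 = 0" "A $ 4 $ 4 = 0"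
    "A $ 3 $ 4 = - A $ 4 $ 3"
    using skew[of 1 3] skew[of 2 3] skew[of 3 3] skew[of 1 4] skew[of 2 4] skew[of 4 4] skew[of 3 4] c1 c2
    by auto
  have "(A ** A) $ 3 $ 3 = - 1" by (simp add: sq mat_def)
  then have "(A $ 4 $ 3)\<^sup>2 = 1" using c1 c2 c3 by (simp add: matrix_matrix_mult_def sum_4 power2_eq_square)
  then have "A $ 4 $ 3 = 1 \<or> A $ 4 $ 3 = - 1" by (simp add: power2_eq_1_iff)
  moreover have "A = twistor_matrix (A $ 4 $ 3)"
    using c1 c2 c3 by (simp add: vec_eq_iff forall_4 twistor_matrix_def)
  ultimately show ?thesis by blast
qed

lemma twistor_matrix_orthogonal:
  "t = 1 \<or> t = - 1 \<Longrightarrow> transpose (twistor_matrix t) ** twistor_matrix t = mat 1"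
  by (auto simp: vec_eq_iff forall_4 twistor_matrix_def matrix_matrix_mult_def sum_4 transpose_def mat_def)

lemma twistor_matrix_square:
  "t = 1 \<or> t = - 1 \<Longrightarrow> twistor_matrix t ** twistor_matrix t = - mat 1"
  by (auto simp: vec_eq_iff forall_4 twistor_matrix_def matrix_matrix_mult_def sum_4 mat_def)

lemma twistor_matrix_axis:
  "twistor_matrix t *v axis 1 1 = axis 2 1" "twistor_matrix t *v axis 2 1 = - axis 1 1"
  "twistor_matrix t *v axis 3 1 = t *\<^sub>R axis 4 1"
  by (simp_all add: matrix_vector_mult_def sum_4 vec_eq_iff forall_4 twistor_matrix_def axis_def)

text \<open>
  With respect to the complex structure \<open>twistor_matrix t\<close>, the sum of squares is the squared
  modulus of the complex determinant of the rows 1 and 3.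
\<close>

lemma det_complex_rows:
  fixes B :: "real ^ 4 ^ 4"
  assumes t: "t = 1 \<or> t = - 1" and B: "B $ 2 = twistor_matrix t *v B $ 1" "B $ 4 = twistor_matrix t *v B $ 3"
  shows "det B = t *
    ((B$1$1 * B$3$3 - t * B$1$2 * B$3$4 - B$3$1 * B$1$3 + t * B$3$2 * B$1$4)\<^sup>2 +
     (t * B$1$1 * B$3$4 + B$1$2 * B$3$3 - t * B$3$1 * B$1$4 - B$3$2 * B$1$3)\<^sup>2)"
proof -
  have b: "B$2$1 = - B$1$2" "B$2$2 = B$1$1" "B$2$3 = - t * B$1$4" "B$2$4 = t * B$1$3"
    "B$4$1 = - B$3$2" "B$4$2 = B$3$1" "B$4$3 = - t * B$3$4" "B$4$4 = t * B$3$3"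
    unfolding B by (simp_all add: twistor_matrix_def matrix_vector_mult_def sum_4)
  show ?thesis unfolding det_4 b using t by (elim disjE) (simp_all add: power2_eq_square algebra_simps)
qed

text \<open>The diagonal 2x2 blocks of a skew \<Omega> commute with the twistor matrix. The
  commutator is again skew, and each of the two combinations on the right occurs, up to sign, twice
  in either off-diagonal block; this is the factor 4.\<close>

lemma commutator_frobenius:
  fixes \<Omega> :: "real ^ 4 ^ 4"
  assumes t: "t = 1 \<or> t = - 1" and skew: "transpose \<Omega> = - \<Omega>"
  shows "(\<Sum>i\<in>UNIV. \<Sum>j\<in>UNIV. ((\<Omega> ** twistor_matrix t - twistor_matrix t ** \<Omega>) $ i $ j)\<^sup>2) =
    4 * ((\<Omega>$4$1 + t * \<Omega>$3$2)\<^sup>2 + (\<Omega>$3$1 - t * \<Omega>$4$2)\<^sup>2)"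
proof -
  have "transpose \<Omega> $ i $ j = - \<Omega> $ i $ j" for i j by (simp add: skew)
  then have neg: "\<Omega> $ j $ i = - \<Omega> $ i $ j" for i j
    unfolding transpose_def vec_lambda_beta .
  have diag: "\<Omega> $ i $ i = 0" for i using neg[of i i] by simp
  have sk: "\<Omega>$1$1 = 0" "\<Omega>$2$2 = 0" "\<Omega>$3$3 = 0" "\<Omega>$4$4 = 0" "\<Omega>$1$2 = - \<Omega>$2$1" "\<Omega>$1$3 = - \<Omega>$3$1"
    "\<Omega>$1$4 = - \<Omega>$4$1" "\<Omega>$2$3 = - \<Omega>$3$2" "\<Omega>$2$4 = - \<Omega>$4$2" "\<Omega>$3$4 = - \<Omega>$4$3"
    by (rule diag neg)+
  show ?thesis using t
    by (elim disjE)
      (simp_all add: sum_4 matrix_matrix_mult_def twistor_matrix_def sk power2_eq_square algebra_simps)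
qed

text \<open>An orthogonal Q preserves the length of every row of M. This frees
  \<open>vertical_norm\<close> from the unspecified basis \<open>onb_at\<close>.\<close>

lemma frobenius_orthogonal_invariant:
  fixes M :: "real ^ 'k ^ 'm" and Q :: "real ^ 'k ^ 'k"
  assumes "transpose Q ** Q = mat 1"
  shows "(\<Sum>i\<in>UNIV. (M *v column i Q) \<bullet> (M *v column i Q)) = (\<Sum>i\<in>UNIV. \<Sum>j\<in>UNIV. (M $ i $ j)\<^sup>2)"
proof -
  have QQ: "Q ** transpose Q = mat 1" using assms matrix_left_right_inverse by blast
  have "(\<Sum>i\<in>UNIV. (M *v column i Q) \<bullet> (M *v column i Q)) =
      (\<Sum>i\<in>UNIV. \<Sum>j\<in>UNIV. ((M $ j v* Q) $ i)\<^sup>2)"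
    by (simp add: inner_vec_def matrix_vector_mult_def vector_matrix_mult_def column_def power2_eq_square)
  also have "\<dots> = (\<Sum>j\<in>UNIV. (M $ j v* Q) \<bullet> (M $ j v* Q))"
    by (subst sum.swap) (simp add: inner_vec_def power2_eq_square)
  also have "\<dots> = (\<Sum>j\<in>UNIV. M $ j \<bullet> M $ j)"
  proof (rule sum.cong)
    fix j
    have "(M $ j v* Q) \<bullet> (M $ j v* Q) = M $ j \<bullet> (Q *v (transpose Q *v M $ j))"
      by (simp add: dot_lmul_matrix)
    then show "(M $ j v* Q) \<bullet> (M $ j v* Q) = M $ j \<bullet> M $ j"
      unfolding matrix_vector_mul_assoc QQ by simp
  qed simp
  also have "\<dots> = (\<Sum>i\<in>UNIV. \<Sum>j\<in>UNIV. (M $ i $ j)\<^sup>2)" by (simp add: inner_vec_def power2_eq_square)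
  finally show ?thesis .
qed

section \<open>The Levi-Civita connection in a frame\<close>

lemma posdef_invertible:
  fixes G :: "real ^ 'k ^ 'k"
  assumes "\<And>a. a \<noteq> 0 \<Longrightarrow> a \<bullet> (G *v a) > 0"
  shows "G ** matrix_inv G = mat 1"
proof -
  have "inj ((*v) G)"
  proof (rule injI)
    fix x y assume "G *v x = G *v y"
    then have "(x - y) \<bullet> (G *v (x - y)) = 0" by (simp add: matrix_vector_mult_diff_distrib)
    then show "x = y" using assms[of "x - y"] by fastforce
  qed
  then have "invertible G" by (simp add: invertible_left_inverse matrix_left_invertible_injective)
  then show ?thesis unfolding invertible_def matrix_inv_def by (rule someI2_ex) simp
qed

context
  fixes G :: "real ^ 'k \<Rightarrow> real ^ 'k ^ 'k" and p :: "real ^ 'k"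
  assumes G: "G differentiable (at p)"
    and sym: "\<forall>\<^sub>F y in nhds p. transpose (G y) = G y"
    and pos: "\<And>a. a \<noteq> 0 \<Longrightarrow> a \<bullet> (G p *v a) > 0"
begin

lemma transpose_gram_derivative: "transpose (frechet_derivative G (at p) w) = frechet_derivative G (at p) w"
proof -
  have d: "(G has_derivative frechet_derivative G (at p)) (at p)" using G frechet_derivative_works by blast
  have "(G has_derivative (\<lambda>h. transpose (frechet_derivative G (at p) h))) (at p)"
    by (rule has_derivative_transform_eventually[OF has_derivative_matrix_transpose[OF d]])
      (use sym in \<open>auto simp: eventually_nhds_conv_at\<close>)
  from has_derivative_unique[OF this d] show ?thesis by metis
qed

text \<open>Pairing with \<open>G p\<close> cancels the inverse matrix in \<open>christoffel\<close>
  and leaves the Koszul expression, which is linear in a and so determined by its values on the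
  standard basis.\<close>

lemma inner_christoffel:
  defines "dG \<equiv> \<lambda>w a b. a \<bullet> (frechet_derivative G (at p) w *v b)"
  shows "a \<bullet> (G p *v christoffel G p u v) = (dG u v a + dG v u a - dG a u v) / 2"
proof -
  have lin: "linear (frechet_derivative G (at p))" using G by (simp add: linear_frechet_derivative)
  have inv: "G p ** matrix_inv (G p) = mat 1" by (rule posdef_invertible) (rule pos)
  define L where "L a = (dG u v a + dG v u a - dG a u v) / 2" for a
  have "linear L" unfolding L_def dG_def
    by (intro linearI) (simp_all add: linear_add[OF lin] linear_scale[OF lin] matrix_vector_right_distrib
        matrix_vector_mult_add_rdistrib inner_add_right scaleR_matrix_vector_assoc[symmetric]
        matrix_vector_mult_scaleR field_simps)
  have "a \<bullet> (G p *v christoffel G p u v) = a \<bullet> (\<chi> l. L (axis l 1))"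
    unfolding christoffel_def Let_def L_def dG_def matrix_vector_mul_assoc inv matrix_vector_mul_lid ..
  also have "\<dots> = L (\<Sum>l\<in>UNIV. a $ l *\<^sub>R axis l 1)"
    by (simp add: linear_sum[OF \<open>linear L\<close>] linear_scale[OF \<open>linear L\<close>] inner_vec_def)
  also have "\<dots> = L a" using basis_expansion[of a] by (simp add: scalar_mult_eq_scaleR)
  finally show ?thesis unfolding L_def .
qed

text \<open>The torsion vanishes because the derivative of the Gram matrix is symmetric.\<close>

lemma christoffel_commute: "christoffel G p u v = christoffel G p v u"
proof -
  have "v \<bullet> (frechet_derivative G (at p) w *v u) = u \<bullet> (frechet_derivative G (at p) w *v v)" for w
    using symmetric_inner_swap[OF transpose_gram_derivative] by blast
  then show ?thesis by (simp add: christoffel_def Let_def add.commute)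
qed

lemma linear_christoffel: "linear (christoffel G p u)"
proof -
  have lin: "linear (frechet_derivative G (at p))" using G by (simp add: linear_frechet_derivative)
  have "linear (\<lambda>v. \<chi> l. (u \<bullet> 0 + v \<bullet> (frechet_derivative G (at p) u *v axis l 1) +
      u \<bullet> (frechet_derivative G (at p) v *v axis l 1) -
      u \<bullet> (frechet_derivative G (at p) (axis l 1) *v v)) / 2)"
    by (intro linearI) (simp_all add: vec_eq_iff linear_add[OF lin] linear_scale[OF lin] matrix_vector_right_distrib
        matrix_vector_mult_add_rdistrib inner_add_right inner_add_left scaleR_matrix_vector_assoc[symmetric]
        matrix_vector_mult_scaleR field_simps)
  from linear_compose[OF this matrix_vector_mul_linear[of "matrix_inv (G p)"]] show ?thesis
    unfolding christoffel_def Let_def o_def by simp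
qed

text \<open>Add the Koszul expressions for (a, b) and (b, a): the derivatives in the directions a
  and b cancel, and the two halves in the direction w combine.\<close>

lemma christoffel_metric_compatible:
  defines "\<Gamma> \<equiv> \<lambda>w. matrix (christoffel G p w)"
  shows "frechet_derivative G (at p) w = G p ** \<Gamma> w + transpose (\<Gamma> w) ** G p"
proof -
  have symp: "transpose (G p) = G p" using sym eventually_nhds_x_imp_x by blast
  let ?D = "frechet_derivative G (at p)"
  note dsym = symmetric_inner_swap[OF transpose_gram_derivative]
  have "a \<bullet> (?D w *v b) = a \<bullet> ((G p ** \<Gamma> w + transpose (\<Gamma> w) ** G p) *v b)" for a b
  proof -
    have g: "\<Gamma> w *v x = christoffel G p w x" for x
      unfolding \<Gamma>_def using matrix_vector_mul(2)[OF linear_christoffel] by metis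
    have "a \<bullet> ((G p ** \<Gamma> w + transpose (\<Gamma> w) ** G p) *v b) =
        a \<bullet> (G p *v christoffel G p w b) + b \<bullet> (G p *v christoffel G p w a)"
    proof -
      have "a \<bullet> (transpose (\<Gamma> w) *v (G p *v b)) = (\<Gamma> w *v a) \<bullet> (G p *v b)"
        by (metis dot_lmul_matrix inner_commute transpose_matrix_vector)
      also have "\<dots> = b \<bullet> (G p *v (\<Gamma> w *v a))" by (rule symmetric_inner_swap[OF symp])
      finally show ?thesis
        by (simp only: matrix_vector_mult_add_rdistrib matrix_vector_mul_assoc[symmetric] inner_add_right g)
    qed
    also have "\<dots> = a \<bullet> (?D w *v b)"
    proof -
      have "b \<bullet> (?D w *v a) = a \<bullet> (?D w *v b)" by (rule dsym)
      then show ?thesis unfolding inner_christoffel by (simp add: field_simps)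
    qed
    finally show ?thesis ..
  qed
  then have "?D w *v b = (G p ** \<Gamma> w + transpose (\<Gamma> w) ** G p) *v b" for b
    using vector_eq_ldot by blast
  then show ?thesis by (simp add: matrix_eq)
qed

end

text \<open>
  Here \<open>\<Gamma>\<close> is the Christoffel matrix in the direction \<open>v\<close>, so that \<open>\<Omega>\<close> is the connection matrix of the
  frame \<open>E\<close> and \<open>J' v - [J, \<Gamma>]\<close> is the covariant derivative of the endomorphism \<open>J\<close> which has the
  constant matrix \<open>K\<close> in this frame.
\<close>

lemma frame_connection:
  fixes E H :: "'a::real_normed_vector \<Rightarrow> real ^ 'k ^ 'k"
  assumes E: "(E has_derivative E') (at y)" and H: "(H has_derivative H') (at y)"
    and frame: "\<forall>\<^sub>F z in nhds y. transpose (E z) ** H z ** E z = mat 1"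
    and sym: "transpose (H y) = H y"
    and compat: "H' v = H y ** \<Gamma> + transpose \<Gamma> ** H y"
  defines "\<Omega> \<equiv> transpose (E y) ** H y ** (E' v + \<Gamma> ** E y)"
  shows "transpose \<Omega> = - \<Omega>"
    and "\<exists>J'. ((\<lambda>z. E z ** K ** (transpose (E z) ** H z)) has_derivative J') (at y) \<and>
      J' v - (E y ** K ** (transpose (E y) ** H y) ** \<Gamma> - \<Gamma> ** (E y ** K ** (transpose (E y) ** H y))) =
      E y ** (\<Omega> ** K - K ** \<Omega>) ** (transpose (E y) ** H y)"
proof -
  define P where "P z = transpose (E z) ** H z" for z
  define P' where "P' h = transpose (E y) ** H' h + transpose (E' h) ** H y" for h
  have dP: "(P has_derivative P') (at y)"
    unfolding P_def P'_def
    by (rule has_derivative_matrix_matrix_mult[OF has_derivative_matrix_transpose[OF E] H])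
  have PE: "P y ** E y = mat 1" using eventually_nhds_x_imp_x[OF frame] by (simp add: P_def)
  have EP: "E y ** P y = mat 1" using PE matrix_left_right_inverse by blast
  have d1: "((\<lambda>z. P z ** E z) has_derivative (\<lambda>h. P y ** E' h + P' h ** E y)) (at y)"
    by (rule has_derivative_matrix_matrix_mult[OF dP E])
  have d2: "((\<lambda>z. P z ** E z) has_derivative (\<lambda>h. 0)) (at y)"
    by (rule has_derivative_transform_eventually[OF has_derivative_const[of "mat 1"]])
      (use frame PE in \<open>auto simp: P_def eventually_nhds_conv_at elim!: eventually_mono\<close>)
  have zero: "P y ** E' v + P' v ** E y = 0"
    using fun_cong[OF has_derivative_unique[OF d1 d2], of v] .
  have \<Omega>: "\<Omega> = P y ** (E' v + \<Gamma> ** E y)" by (simp add: \<Omega>_def P_def)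
  have tP: "transpose (P y) = H y ** E y" by (simp add: P_def matrix_transpose_mul sym)
  \<comment> \<open>By metric compatibility this sum is the derivative of the constant
    \<open>P z ** E z\<close>.\<close>
  have "transpose \<Omega> + \<Omega> = (transpose (E' v) ** H y ** E y + transpose (E y) ** transpose \<Gamma> ** H y ** E y) +
      (P y ** E' v + P y ** \<Gamma> ** E y)"
    by (simp add: \<Omega> matrix_transpose_mul tP transpose_add matrix_add_ldistrib matrix_mult_add_rdistrib matrix_mul_assoc)
  also have "\<dots> = P y ** E' v + P' v ** E y"
    by (simp add: P'_def compat P_def matrix_add_ldistrib matrix_mult_add_rdistrib matrix_mul_assoc)
  finally show "transpose \<Omega> = - \<Omega>" using zero by (simp add: eq_neg_iff_add_eq_0)
  \<comment> \<open>\<open>P\<close> is the inverse of \<open>E\<close>; this is the rule for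
    differentiating an inverse.\<close>
  have "P' v = P' v ** E y ** P y" by (simp add: matrix_mul_assoc[symmetric] EP)
  also have "P' v ** E y = - (P y ** E' v)" using zero by (simp add: eq_neg_iff_add_eq_0 add.commute)
  finally have P'v: "P' v = - (P y ** E' v ** P y)" by (simp add: matrix_mult_minus_left)
  define J' where "J' h = E y ** K ** P' h + (E y ** 0 + E' h ** K) ** P y" for h
  have "((\<lambda>z. E z ** K ** P z) has_derivative J') (at y)"
    unfolding J'_def
    by (rule has_derivative_matrix_matrix_mult[OF has_derivative_matrix_matrix_mult[OF E has_derivative_const] dP])
  moreover have "J' v - (E y ** K ** P y ** \<Gamma> - \<Gamma> ** (E y ** K ** P y)) = E y ** (\<Omega> ** K - K ** \<Omega>) ** P y"
  proof -
    \<comment> \<open>The columns of \<Omega> are the covariant derivatives of the frame vectors, in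
      frame coordinates.\<close>
    have "E y ** \<Omega> = E' v + \<Gamma> ** E y" by (simp add: \<Omega> matrix_mul_assoc EP)
    then have "E y ** (\<Omega> ** K - K ** \<Omega>) ** P y =
        (E' v + \<Gamma> ** E y) ** K ** P y - E y ** K ** P y ** (E' v + \<Gamma> ** E y) ** P y"
      by (simp add: matrix_mult_diff_ldistrib matrix_mult_diff_rdistrib matrix_mul_assoc \<Omega>)
    also have "\<dots> = J' v - (E y ** K ** P y ** (\<Gamma> ** (E y ** P y)) - \<Gamma> ** (E y ** K ** P y))"
      by (simp add: J'_def P'v matrix_add_ldistrib matrix_mult_add_rdistrib matrix_mul_assoc matrix_mult_minus_right)
    finally show ?thesis by (simp add: EP)
  qed
  ultimately show "\<exists>J'. ((\<lambda>z. E z ** K ** (transpose (E z) ** H z)) has_derivative J') (at y) \<and>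
      J' v - (E y ** K ** (transpose (E y) ** H y) ** \<Gamma> - \<Gamma> ** (E y ** K ** (transpose (E y) ** H y))) =
      E y ** (\<Omega> ** K - K ** \<Omega>) ** (transpose (E y) ** H y)"
    unfolding P_def by blast
qed

section \<open>Immersions in charts\<close>

text \<open>\<open>dir_deriv\<close> uses the arbitrary chart \<open>chart_at\<close>. The chain
  rule moves the computation to any chart in which the derivative is known.\<close>

lemma dir_deriv_eq:
  assumes M: "oriented_smooth_atlas M" and c: "c \<in> charts_at M p" and v: "v \<in> tangent_space M p"
    and h: "(h \<circ> chart_inv c has_derivative D) (at (cmap c p))"
  shows "dir_deriv M p v h = D (v c)"
proof -
  define c' where "c' = chart_at M p"
  have c': "c' \<in> charts_at M p" unfolding c'_def by (rule chart_at_in[OF M charts_at_imp_carrier[OF M c]])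
  define S where "S = cmap c' ` (cdom c' \<inter> cdom c)"
  have S: "open S" "cmap c' p \<in> S"
    unfolding S_def using c c' by (auto simp: charts_at_def intro!: open_cmap_image[OF M] open_Int open_cdom[OF M])
  have p: "(cmap c \<circ> chart_inv c') (cmap c' p) = cmap c p"
    using c' by (simp add: chart_inv_cmap[OF M] charts_at_def)
  have "((h \<circ> chart_inv c) \<circ> (cmap c \<circ> chart_inv c') has_derivative D \<circ> transition_deriv c' c p) (at (cmap c' p))"
    by (rule diff_chain_at[OF transition_has_derivative[OF M c' c]]) (use h in \<open>simp only: p\<close>)
  then have "(h \<circ> chart_inv c' has_derivative D \<circ> transition_deriv c' c p) (at (cmap c' p))"
    by (rule has_derivative_transform_within_open[OF _ S])
      (use c c' in \<open>auto simp: charts_at_def S_def chart_inv_cmap[OF M]\<close>)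
  from frechet_derivative_at[OF this, symmetric] have "dir_deriv M p v h = D (transition_deriv c' c p (v c'))"
    by (simp add: dir_deriv_def Let_def c'_def)
  moreover have "transition_deriv c' c p (v c') = v c"
    using fun_cong[OF tvec_of_component[OF M c' v], of c] c by (simp add: tvec_of_def)
  ultimately show ?thesis by simp
qed

lemma det_rows_mult:
  fixes E :: "real ^ 'k ^ 'k"
  shows "det (\<chi> i. E *v \<beta> i) = det E * det (\<chi> i. \<beta> i)"
proof -
  have "(\<chi> i. E *v \<beta> i) = (\<chi> i. \<beta> i) ** transpose E"
    by (simp add: vec_eq_iff matrix_matrix_mult_def transpose_def matrix_vector_mult_def mult.commute)
  then show ?thesis by (simp add: det_mul det_transpose)
qed

text \<open>\<open>independent\<close> speaks of a set and would not notice a repeated vector;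
  injectivity excludes repetitions, whose trace in coefficients is the relation
  \<open>axis i 1 - axis j 1\<close>.\<close>

lemma independent_family_iff:
  fixes b :: "'i::finite \<Rightarrow> 'v::real_vector"
  shows "inj b \<and> independent (range b) \<longleftrightarrow> (\<forall>z :: real ^ 'i. (\<Sum>i\<in>UNIV. z $ i *\<^sub>R b i) = 0 \<longrightarrow> z = 0)"
proof (intro iffI allI impI conjI)
  fix z :: "real ^ 'i" assume b: "inj b \<and> independent (range b)" and z: "(\<Sum>i\<in>UNIV. z $ i *\<^sub>R b i) = 0"
  have "(\<Sum>v\<in>range b. z $ inv b v *\<^sub>R v) = 0" using b z by (simp add: sum.reindex)
  then have "z $ inv b (b i) = 0" for i
    using b independentD[of "range b" "range b" "\<lambda>v. z $ inv b v" "b i"] by auto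
  then show "z = 0" using b by (simp add: vec_eq_iff)
next
  assume z: "\<forall>z :: real ^ 'i. (\<Sum>i\<in>UNIV. z $ i *\<^sub>R b i) = 0 \<longrightarrow> z = 0"
  show inj: "inj b"
  proof (rule injI, rule ccontr)
    fix i j assume ij: "b i = b j" "i \<noteq> j"
    have "(axis l 1 :: real ^ 'i) $ k *\<^sub>R b k = (if k = l then b k else 0)" for k l by (simp add: axis_def)
    then have "(\<Sum>k\<in>UNIV. (axis i 1 - axis j 1 :: real ^ 'i) $ k *\<^sub>R b k) = b i - b j"
      by (simp add: scaleR_diff_left sum_subtractf)
    then have "axis i 1 - axis j 1 = (0 :: real ^ 'i)" using z ij by (metis right_minus_eq)
    then have "(axis i 1 - axis j 1 :: real ^ 'i) $ i = 0" by simp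
    then show False using ij by (simp add: axis_def)
  qed
  show "independent (range b)"
  proof (rule independent_if_scalars_zero)
    fix u v assume u: "(\<Sum>x\<in>range b. u x *\<^sub>R x) = 0" and "v \<in> range b"
    then obtain i where i: "v = b i" by blast
    have "(\<Sum>i\<in>UNIV. (\<chi> i. u (b i)) $ i *\<^sub>R b i) = 0" using u unfolding sum.reindex[OF inj] by (simp add: o_def)
    then have "(\<chi> i. u (b i)) = 0" using z by blast
    then show "u v = 0" unfolding i by (metis vec_lambda_beta zero_index)
  qed simp
qed

lemma tangent_basis_iff:
  fixes M :: "('a::topological_space, 'k::finite) manifold"
  assumes M: "oriented_smooth_atlas M" and c: "c \<in> charts_at M p" and b: "range b \<subseteq> tangent_space M p"
  shows "tangent_basis M p b \<longleftrightarrow> det (\<chi> i. b i c) \<noteq> 0"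
proof -
  note sub = subspace_tangent_space[OF M charts_at_imp_carrier[OF M c]]
  have "(\<Sum>i\<in>UNIV. z $ i *\<^sub>R b i) = 0 \<longleftrightarrow> transpose (\<chi> i. b i c) *v z = 0" for z :: "real ^ 'k"
  proof -
    have "(\<Sum>i\<in>UNIV. z $ i *\<^sub>R b i) \<in> tangent_space M p"
      using b by (intro subspace_sum[OF sub] subspace_scale[OF sub]) auto
    moreover have "0 \<in> tangent_space M p" by (rule subspace_0[OF sub])
    ultimately have "(\<Sum>i\<in>UNIV. z $ i *\<^sub>R b i) = 0 \<longleftrightarrow> (\<Sum>i\<in>UNIV. z $ i *\<^sub>R b i) c = 0"
      using tangent_space_eqI[OF M c] by fastforce
    also have "(\<Sum>i\<in>UNIV. z $ i *\<^sub>R b i) c = transpose (\<chi> i. b i c) *v z"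
      by (simp add: sum_fun_apply vec_eq_iff matrix_vector_mult_def transpose_def mult.commute
          del: transpose_matrix_vector)
    finally show ?thesis .
  qed
  then have "tangent_basis M p b \<longleftrightarrow> invertible (transpose (\<chi> i. b i c))"
    unfolding tangent_basis_def independent_family_iff invertible_left_inverse matrix_left_invertible_ker
    using b by simp
  then show ?thesis by (simp add: invertible_det_nz det_transpose)
qed

lemma tvec_of_orthonormal_basis:
  assumes M: "oriented_smooth_atlas M" "riemannian M" and c: "c \<in> charts_at M p"
    and E: "transpose E ** gram M c (cmap c p) ** E = mat 1"
  shows "orthonormal_basis M p (\<lambda>i. tvec_of M p c (column i E))"
  using E tvec_of_in_tangent_space[OF M(1) c] unfolding orthonormal_basis_def metric_tvec_of[OF M c] frame_iff
  by auto

lemma orthonormal_basis_frame: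
  assumes M: "oriented_smooth_atlas M" "riemannian M" and c: "c \<in> charts_at M p"
    and b: "orthonormal_basis M p b"
  shows "transpose (transpose (\<chi> i. b i c)) ** gram M c (cmap c p) ** transpose (\<chi> i. b i c) = mat 1"
proof -
  have "column i (transpose (\<chi> i. b i c)) = b i c" for i by (simp add: column_def transpose_def vec_eq_iff)
  moreover have "b i c \<bullet> (gram M c (cmap c p) *v b j c) = metric M p (b i) (b j)" for i j
    using b by (intro metric_eq_gram[OF M c, symmetric]) (auto simp: orthonormal_basis_def)
  ultimately show ?thesis
    using b unfolding frame_iff orthonormal_basis_def by simp
qed

lemma orthonormal_basis_exists:
  fixes M :: "('a::topological_space, 'k::finite) manifold"
  assumes M: "oriented_smooth_atlas M" "riemannian M" and p: "p \<in> carrier M"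
  shows "\<exists>b. orthonormal_basis M p b"
proof -
  obtain c where c: "c \<in> charts_at M p" using chart_at_in[OF M(1) p] by blast
  obtain e :: "'k \<Rightarrow> real ^ 'k" where e: "\<forall>i j. e i \<bullet> (gram M c (cmap c p) *v e j) = (if i = j then 1 else 0)"
    using orthonormal_family_extend[OF transpose_gram[OF M c] gram_pos[OF M c], of "{}"] by auto
  have "orthonormal_basis M p (\<lambda>i. tvec_of M p c (e i))"
    using e tvec_of_in_tangent_space[OF M(1) c] unfolding orthonormal_basis_def metric_tvec_of[OF M c] by auto
  then show ?thesis by blast
qed

lemma onb_at_orthonormal:
  assumes "oriented_smooth_atlas M" "riemannian M" "p \<in> carrier M"
  shows "orthonormal_basis M p (onb_at M p)"
  unfolding onb_at_def using orthonormal_basis_exists[OF assms] by (rule someI_ex)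

abbreviation local_rep where "local_rep c d f \<equiv> cmap d \<circ> f \<circ> chart_inv c"

section \<open>Coordinate representation of an isometric immersion\<close>

context
  fixes X :: "('x::topological_space, 'j::finite) manifold" and N :: "('n::topological_space, 'k::finite) manifold"
    and f :: "'x \<Rightarrow> 'n"
  assumes X: "oriented_smooth_atlas X" "riemannian X" and N: "oriented_smooth_atlas N" "riemannian N"
    and f: "isometric_immersion X N f"
begin

lemma overlap_open:
  assumes "c \<in> atlas X" "d \<in> atlas N"
  shows "open {x \<in> cdom c. f x \<in> cdom d}"
proof -
  have "continuous_on (cdom c) f"
    using f assms(1) unfolding isometric_immersion_def smooth_map_def carrier_def
    by (meson UN_upper continuous_on_subset)
  from continuous_open_preimage[OF this open_cdom[OF X(1) assms(1)] open_cdom[OF N(1) assms(2)]]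
  show ?thesis by (simp add: vimage_def Int_def)
qed

lemma overlap_image_open:
  "c \<in> atlas X \<Longrightarrow> d \<in> atlas N \<Longrightarrow> open (cmap c ` {x \<in> cdom c. f x \<in> cdom d})"
  by (rule open_cmap_image[OF X(1)]) (auto intro: overlap_open)

lemma local_rep_smooth:
  "c \<in> atlas X \<Longrightarrow> d \<in> atlas N \<Longrightarrow> smooth_on (local_rep c d f) (cmap c ` {x \<in> cdom c. f x \<in> cdom d})"
  using f by (simp add: isometric_immersion_def smooth_map_def)

lemma in_overlap_image:
  "c \<in> charts_at X x \<Longrightarrow> d \<in> charts_at N (f x) \<Longrightarrow> cmap c x \<in> cmap c ` {x \<in> cdom c. f x \<in> cdom d}"
  by (auto simp: charts_at_def)

lemma local_rep_has_derivative:
  "c \<in> charts_at X x \<Longrightarrow> d \<in> charts_at N (f x) \<Longrightarrow>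
    (local_rep c d f has_derivative frechet_derivative (local_rep c d f) (at (cmap c x))) (at (cmap c x))"
  by (rule smooth_on_imp_has_derivative[OF local_rep_smooth in_overlap_image]) (auto simp: charts_at_def)

lemma differential_component:
  assumes c: "c \<in> charts_at X x" and d: "d \<in> charts_at N (f x)" and v: "v \<in> tangent_space X x"
  shows "differential X N f x v d = frechet_derivative (local_rep c d f) (at (cmap c x)) (v c)"
  using dir_deriv_eq[OF X(1) c v, of "cmap d \<circ> f"] local_rep_has_derivative[OF c d] d
  by (simp add: differential_def)

text \<open>The components of \<open>differential\<close> are defined separately in each chart of N.
  By the chain rule they transform like those of a tangent vector, so one chart determines all of
  them.\<close>

lemma differential_eq:
  assumes c: "c \<in> charts_at X x" and d: "d \<in> charts_at N (f x)" and v: "v \<in> tangent_space X x"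
  shows "differential X N f x v = tvec_of N (f x) d (frechet_derivative (local_rep c d f) (at (cmap c x)) (v c))"
proof (rule ext)
  fix e
  show "differential X N f x v e = tvec_of N (f x) d (frechet_derivative (local_rep c d f) (at (cmap c x)) (v c)) e"
  proof (cases "e \<in> charts_at N (f x)")
    case False
    then show ?thesis by (simp add: differential_def tvec_of_def)
  next
    case e: True
    define S where "S = cmap c ` {x \<in> cdom c. f x \<in> cdom d}"
    have S: "open S" "cmap c x \<in> S"
      unfolding S_def using c d in_overlap_image[OF c d] by (auto simp: charts_at_def intro!: overlap_image_open)
    have p: "local_rep c d f (cmap c x) = cmap d (f x)"
      using c by (simp add: chart_inv_cmap[OF X(1)] charts_at_def)
    have "(cmap e \<circ> chart_inv d \<circ> local_rep c d f has_derivative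
        transition_deriv d e (f x) \<circ> frechet_derivative (local_rep c d f) (at (cmap c x))) (at (cmap c x))"
      by (rule diff_chain_at[OF local_rep_has_derivative[OF c d]])
        (use transition_has_derivative[OF N(1) d e] in \<open>simp only: p\<close>)
    then have "(local_rep c e f has_derivative
        transition_deriv d e (f x) \<circ> frechet_derivative (local_rep c d f) (at (cmap c x))) (at (cmap c x))"
      by (rule has_derivative_transform_within_open[OF _ S])
        (use c d in \<open>auto simp: charts_at_def S_def chart_inv_cmap[OF X(1)] chart_inv_cmap[OF N(1)]\<close>)
    from frechet_derivative_at[OF this, symmetric] show ?thesis
      unfolding differential_component[OF c e v] using e by (simp add: tvec_of_def)
  qed
qed

lemma differential_in_tangent_space:
  assumes "c \<in> charts_at X x" "d \<in> charts_at N (f x)" "v \<in> tangent_space X x"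
  shows "differential X N f x v \<in> tangent_space N (f x)"
  unfolding differential_eq[OF assms] by (rule tvec_of_in_tangent_space[OF N(1) assms(2)])

lemma local_rep_isometric:
  assumes c: "c \<in> charts_at X x" and d: "d \<in> charts_at N (f x)"
  defines "DF \<equiv> frechet_derivative (local_rep c d f) (at (cmap c x))"
  shows "DF a \<bullet> (gram N d (cmap d (f x)) *v DF b) = a \<bullet> (gram X c (cmap c x) *v b)"
proof -
  note T = tvec_of_in_tangent_space[OF X(1) c]
  have "metric N (f x) (differential X N f x (tvec_of X x c a)) (differential X N f x (tvec_of X x c b)) =
      metric X x (tvec_of X x c a) (tvec_of X x c b)"
    using f T charts_at_imp_carrier[OF X(1) c] unfolding isometric_immersion_def by blast
  then show ?thesis
    unfolding differential_eq[OF c d T] tvec_of_self[OF X(1) c] metric_tvec_of[OF X c] metric_tvec_of[OF N d] DF_def .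
qed

end

section \<open>The twistor lifts\<close>

definition twistor_sgn :: "twistor_sign \<Rightarrow> real"
  where "twistor_sgn \<epsilon> = (case \<epsilon> of Plus \<Rightarrow> 1 | Minus \<Rightarrow> - 1)"

lemma twistor_sgn_cases: "twistor_sgn \<epsilon> = 1 \<or> twistor_sgn \<epsilon> = - 1"
  by (cases \<epsilon>) (auto simp: twistor_sgn_def)

text \<open>As \<open>transpose E ** gram N d (cmap d p)\<close> inverts an orthonormal
  \<open>E\<close>, the matrix here is a conjugate: the endomorphism has the matrix
  \<open>twistor_matrix t\<close> in the frame \<open>E\<close>. The value 0 elsewhere follows the
  convention of \<open>tangent_endo\<close>.\<close>

definition frame_twistor ::
  "('n, 4) manifold \<Rightarrow> 'n \<Rightarrow> ('n, 4) chart \<Rightarrow> real ^ 4 ^ 4 \<Rightarrow> real \<Rightarrow> ('n, 4) tvec \<Rightarrow> ('n, 4) tvec"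
  where "frame_twistor N p d E t = (\<lambda>u. if u \<in> tangent_space N p
    then tvec_of N p d ((E ** twistor_matrix t ** (transpose E ** gram N d (cmap d p))) *v u d) else 0)"

lemma orthogonal_matrix_inner:
  fixes A :: "real ^ 'k ^ 'k"
  shows "transpose A ** A = mat 1 \<Longrightarrow> (A *v a) \<bullet> (A *v b) = a \<bullet> b"
  using frame_inner[of A "mat 1" a b] by simp

lemma orthogonal_matrixI:
  fixes A :: "real ^ 'k ^ 'k"
  assumes "\<And>a b. (A *v a) \<bullet> (A *v b) = a \<bullet> b"
  shows "transpose A ** A = mat 1"
proof -
  have "a \<bullet> ((transpose A ** A) *v b) = a \<bullet> b" for a b
    unfolding assms[of a b, symmetric] matrix_vector_mul_assoc[symmetric]
    by (metis dot_lmul_matrix inner_commute transpose_matrix_vector)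
  then have "(transpose A ** A) *v b = b" for b using vector_eq_ldot by blast
  then show ?thesis by (simp add: matrix_eq)
qed

lemma det_twistor_rows:
  "t = 1 \<or> t = - 1 \<Longrightarrow> det (\<chi> i. if i = 4 then t *\<^sub>R axis 4 1 else (axis i 1 :: real ^ 4)) = t"
  by (simp add: det_4 axis_def)

context
  fixes N :: "('n::topological_space, 4) manifold" and p d and E :: "real ^ 4 ^ 4"
  assumes N: "oriented_smooth_atlas N" "riemannian N" and d: "d \<in> charts_at N p"
    and E: "transpose E ** gram N d (cmap d p) ** E = mat 1" and detE: "det E > 0"
begin

lemma frame_expand: "E *v ((transpose E ** gram N d (cmap d p)) *v w) = w"
  by (simp only: matrix_vector_mul_assoc frame_inverse[OF E] matrix_vector_mul_lid)

lemma orientation_frame: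
  assumes b: "range b \<subseteq> tangent_space N p" and \<beta>: "\<And>i. b i d = E *v \<beta> i"
  shows "tangent_basis N p b \<longleftrightarrow> det (\<chi> i. \<beta> i) \<noteq> 0"
    and "pos_oriented N p b \<longleftrightarrow> det (\<chi> i. \<beta> i) > 0"
    and "neg_oriented N p b \<longleftrightarrow> det (\<chi> i. \<beta> i) < 0"
  unfolding tangent_basis_iff[OF N(1) d b] pos_oriented_iff[OF N(1) d b] neg_oriented_iff[OF N(1) d b] \<beta> det_rows_mult
  using detE by (auto simp: zero_less_mult_iff mult_less_0_iff)

text \<open>The existence half of the \<open>THE\<close> in \<open>twistor_lift\<close>. Conjugation
  by an orthonormal frame transports the algebraic properties of the matrix; the orientation clause
  needs the determinant formula \<open>det_complex_rows\<close>.\<close>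

lemma frame_twistor_in_twistor_space:
  "(p, frame_twistor N p d E (twistor_sgn \<epsilon>)) \<in> twistor_space \<epsilon> N"
proof -
  define P where "P = transpose E ** gram N d (cmap d p)"
  define t where "t = twistor_sgn \<epsilon>"
  define K where "K = twistor_matrix t"
  define J where "J = frame_twistor N p d E t"
  note T = tvec_of_in_tangent_space[OF N(1) d]
  have t: "t = 1 \<or> t = - 1" unfolding t_def by (rule twistor_sgn_cases)
  have PE: "P ** E = mat 1" using E by (simp add: P_def)
  have EP: "E *v (P *v w) = w" for w unfolding P_def by (rule frame_expand)
  have J: "J u = tvec_of N p d (E *v (K *v (P *v u d)))" if "u \<in> tangent_space N p" for u
    using that by (simp add: J_def frame_twistor_def K_def P_def matrix_vector_mul_assoc matrix_mul_assoc)
  have JT: "J u \<in> tangent_space N p" if "u \<in> tangent_space N p" for u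
    unfolding J[OF that] by (rule T)
  have Jd: "J u d = E *v (K *v (P *v u d))" if "u \<in> tangent_space N p" for u
    unfolding J[OF that] by (rule tvec_of_self[OF N(1) d])
  have PJ: "P *v J u d = K *v (P *v u d)" if "u \<in> tangent_space N p" for u
    unfolding Jd[OF that] matrix_vector_mul_assoc[of P E] PE by simp
  note sub = subspace_tangent_space[OF N(1) charts_at_imp_carrier[OF N(1) d]]
  note lt = linear_tvec_of[OF N(1) d]
  have J0: "J u = 0" if "u \<notin> tangent_space N p" for u
    using that unfolding J_def frame_twistor_def by simp
  have "tangent_endo N p J"
    unfolding tangent_endo_def
  proof (intro conjI ballI allI impI JT)
    fix u v r assume uv: "u \<in> tangent_space N p" "v \<in> tangent_space N p"
    then have "r *\<^sub>R u + v \<in> tangent_space N p" by (intro subspace_add[OF sub] subspace_scale[OF sub])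
    then show "J (r *\<^sub>R u + v) = r *\<^sub>R J u + J v"
      using uv by (simp add: J linear_add[OF lt] linear_scale[OF lt] matrix_vector_right_distrib matrix_vector_mult_scaleR)
  qed (simp_all add: J0)
  moreover have "metric N p (J u) (J v) = metric N p u v" if "u \<in> tangent_space N p" "v \<in> tangent_space N p" for u v
  proof -
    have "metric N p (J u) (J v) = (P *v u d) \<bullet> (P *v v d)"
      unfolding J[OF that(1)] J[OF that(2)] metric_tvec_of[OF N d] frame_inner[OF E] K_def
      by (rule orthogonal_matrix_inner[OF twistor_matrix_orthogonal[OF t]])
    also have "\<dots> = (E *v (P *v u d)) \<bullet> (gram N d (cmap d p) *v (E *v (P *v v d)))"
      by (rule frame_inner[OF E, symmetric])
    finally show ?thesis unfolding EP metric_eq_gram[OF N d that] .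
  qed
  moreover have "J (J u) = - u" if "u \<in> tangent_space N p" for u
  proof -
    have "J (J u) = tvec_of N p d (E *v ((K ** K) *v (P *v u d)))"
      unfolding J[OF JT[OF that]] PJ[OF that] by (simp only: matrix_vector_mul_assoc[symmetric])
    also have "\<dots> = tvec_of N p d (- (E *v (P *v u d)))"
      unfolding K_def twistor_matrix_square[OF t]
      by (simp add: matrix_vector_mult_minus_left linear_neg[OF matrix_vector_mul_linear])
    also have "\<dots> = - u" by (simp add: EP linear_neg[OF lt] tvec_of_component[OF N(1) d that])
    finally show ?thesis .
  qed
  moreover have "case \<epsilon> of Plus \<Rightarrow> pos_oriented N p b | Minus \<Rightarrow> neg_oriented N p b"
    if b: "tangent_basis N p b" "b 2 = J (b 1)" "b 4 = J (b 3)" for b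
  proof -
    have bT: "b i \<in> tangent_space N p" for i using b(1) by (auto simp: tangent_basis_def)
    then have bR: "range b \<subseteq> tangent_space N p" by auto
    define B where "B = (\<chi> i. P *v b i d)"
    have bB: "b i d = E *v B $ i" for i by (simp add: B_def EP)
    have BB: "(\<chi> i. B $ i) = B" by (simp add: vec_eq_iff)
    have "B $ 2 = K *v B $ 1" "B $ 4 = K *v B $ 3" unfolding B_def by (simp_all add: b(2,3) PJ[OF bT])
    \<comment> \<open>In frame coordinates the determinant of such a basis is t times a sum of
      squares, and it is nonzero, so it has the sign of t.\<close>
    from det_complex_rows[OF t this[unfolded K_def]] obtain q where "det B = t * q" "q \<ge> 0"
      by (metis sum_power2_ge_zero)
    moreover have "det B \<noteq> 0" using orientation_frame(1)[OF bR bB] b(1) BB by simp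
    ultimately have "t * det B > 0" using t by auto
    then show ?thesis
      using orientation_frame(2,3)[OF bR bB] BB by (cases \<epsilon>) (auto simp: t_def twistor_sgn_def)
  qed
  ultimately show ?thesis
    using charts_at_imp_carrier[OF N(1) d] unfolding twistor_space_def J_def t_def by blast
qed

text \<open>The uniqueness half. In frame coordinates J becomes an orthogonal matrix A of square -1
  with prescribed value on the first basis vector, which leaves only the sign t; the orientation
  clause, applied to one test basis, decides it.\<close>

lemma frame_twistor_unique:
  assumes J: "(p, J) \<in> twistor_space \<epsilon> N"
    and J1: "J (tvec_of N p d (column 1 E)) = tvec_of N p d (column 2 E)"
  shows "J = frame_twistor N p d E (twistor_sgn \<epsilon>)"
proof -
  define P where "P = transpose E ** gram N d (cmap d p)"
  define \<tau> where "\<tau> = tvec_of N p d"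
  have T: "\<tau> w \<in> tangent_space N p" for w unfolding \<tau>_def by (rule tvec_of_in_tangent_space[OF N(1) d])
  have \<tau>d: "\<tau> w d = w" for w unfolding \<tau>_def by (rule tvec_of_self[OF N(1) d])
  have d\<tau>: "\<tau> (u d) = u" if "u \<in> tangent_space N p" for u
    unfolding \<tau>_def by (rule tvec_of_component[OF N(1) d that])
  have lt: "linear \<tau>" unfolding \<tau>_def by (rule linear_tvec_of[OF N(1) d])
  have PE: "P ** E = mat 1" using E by (simp add: P_def)
  have EP: "E *v (P *v w) = w" for w unfolding P_def by (rule frame_expand)
  have JT: "J u \<in> tangent_space N p" if "u \<in> tangent_space N p" for u
    using J that by (auto simp: twistor_space_def tangent_endo_def)
  have J0: "J u = 0" if "u \<notin> tangent_space N p" for u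
    using J that by (auto simp: twistor_space_def tangent_endo_def)
  have Jlin: "J (r *\<^sub>R u + v) = r *\<^sub>R J u + J v" if "u \<in> tangent_space N p" "v \<in> tangent_space N p" for u v r
    using J that by (auto simp: twistor_space_def tangent_endo_def)
  have Jiso: "metric N p (J u) (J v) = metric N p u v" if "u \<in> tangent_space N p" "v \<in> tangent_space N p" for u v
    using J that by (auto simp: twistor_space_def)
  have Jsq: "J (J u) = - u" if "u \<in> tangent_space N p" for u
    using J that by (auto simp: twistor_space_def)
  define L where "L a = P *v J (\<tau> (E *v a)) d" for a
  have Ls: "L (r *\<^sub>R a + b) = r *\<^sub>R L a + L b" for r a b
    unfolding L_def matrix_vector_right_distrib matrix_vector_mult_scaleR linear_add[OF lt] linear_scale[OF lt] Jlin[OF T T]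
    by (simp add: matrix_vector_right_distrib matrix_vector_mult_scaleR)
  have "L 0 = 0" using Ls[of 1 0 0] by simp
  then have lL: "linear L" using Ls[of 1] Ls[of _ _ 0] by (intro linearI) auto
  define A where "A = matrix L"
  have A: "A *v a = P *v J (\<tau> (E *v a)) d" for a
    using fun_cong[OF matrix_vector_mul(2)[OF lL], of a] by (simp add: A_def L_def)
  have JA: "J (\<tau> (E *v a)) = \<tau> (E *v (A *v a))" for a
    by (simp add: A EP d\<tau> JT T)
  have "(A *v a) \<bullet> (A *v b) = a \<bullet> b" for a b
    using Jiso[OF T T, of "E *v a" "E *v b"] unfolding JA unfolding \<tau>_def metric_tvec_of[OF N d] frame_inner[OF E] .
  then have orth: "transpose A ** A = mat 1" by (rule orthogonal_matrixI)
  have "(A ** A) *v a = (- mat 1) *v a" for a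
  proof -
    have "\<tau> (E *v (A *v (A *v a))) = - \<tau> (E *v a)" using Jsq[OF T, of "E *v a"] by (simp add: JA)
    also have "\<dots> = \<tau> (E *v (- a))" by (simp add: linear_neg[OF lt] linear_neg[OF matrix_vector_mul_linear])
    finally have "E *v (A *v (A *v a)) = E *v (- a)" by (metis \<tau>d)
    then have "P *v (E *v (A *v (A *v a))) = P *v (E *v (- a))" by simp
    then show ?thesis
      unfolding matrix_vector_mul_assoc[of P E] PE
      by (simp add: matrix_vector_mul_assoc matrix_vector_mult_minus_left)
  qed
  then have sq: "A ** A = - mat 1" by (simp add: matrix_eq)
  have "\<tau> (E *v (A *v axis 1 1)) = \<tau> (E *v axis 2 1)"
    using J1 unfolding \<tau>_def[symmetric] matrix_vector_mult_basis[of E, symmetric] JA .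
  then have "P *v (E *v (A *v axis 1 1)) = P *v (E *v axis 2 1)" by (metis \<tau>d)
  then have A1: "A *v axis 1 1 = axis 2 1" unfolding matrix_vector_mul_assoc[of P E] PE by simp
  obtain t where t: "t = 1 \<or> t = - 1" "A = twistor_matrix t" using twistor_matrix_unique[OF orth sq A1] by blast
  \<comment> \<open>The test basis: the frame with its fourth vector multiplied by t. It has the
    form (u, J u, v, J v), and its determinant in frame coordinates is t.\<close>
  define \<beta> where "\<beta> i = (if i = 4 then t *\<^sub>R axis 4 1 else axis i 1 :: real ^ 4)" for i :: 4
  define b where "b i = \<tau> (E *v \<beta> i)" for i
  have bR: "range b \<subseteq> tangent_space N p" by (auto simp: b_def T)
  have bd: "b i d = E *v \<beta> i" for i by (simp add: b_def \<tau>d)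
  have det\<beta>: "det (\<chi> i. \<beta> i) = t" unfolding \<beta>_def by (rule det_twistor_rows[OF t(1)])
  have "tangent_basis N p b" using orientation_frame(1)[OF bR bd] det\<beta> t by auto
  moreover have "b 2 = J (b 1)" "b 4 = J (b 3)"
    unfolding b_def JA by (simp_all add: \<beta>_def t(2) twistor_matrix_axis)
  ultimately have "case \<epsilon> of Plus \<Rightarrow> pos_oriented N p b | Minus \<Rightarrow> neg_oriented N p b"
    using J unfolding twistor_space_def by blast
  then have "t = twistor_sgn \<epsilon>"
    using orientation_frame(2,3)[OF bR bd] det\<beta> t(1) by (cases \<epsilon>) (auto simp: twistor_sgn_def)
  show ?thesis
  proof (rule ext)
    fix u
    show "J u = frame_twistor N p d E (twistor_sgn \<epsilon>) u"
    proof (cases "u \<in> tangent_space N p")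
      case True
      have "J u = J (\<tau> (E *v (P *v u d)))" by (simp add: EP d\<tau> True)
      also have "\<dots> = \<tau> ((E ** A ** P) *v u d)" by (simp only: JA matrix_vector_mul_assoc[symmetric])
      finally show ?thesis using True \<open>t = twistor_sgn \<epsilon>\<close> by (simp add: frame_twistor_def \<tau>_def P_def t(2))
    qed (simp add: J0 frame_twistor_def)
  qed
qed

end

text \<open>Lagrange's identity gives \<open>D\<^sup>2 = 1\<close>, so the positive D is 1.
  Orthogonality and D = 1 are then two linear equations for q2.\<close>

lemma rotation_unique:
  fixes q1 q2 :: "real ^ 2"
  assumes "q1 \<bullet> q1 = 1" "q2 \<bullet> q2 = 1" "q1 \<bullet> q2 = 0" and "q1$1 * q2$2 - q1$2 * q2$1 > 0"
  shows "q2$1 = - q1$2" "q2$2 = q1$1"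
proof -
  have h: "q1$1 * q1$1 + q1$2 * q1$2 = 1" "q2$1 * q2$1 + q2$2 * q2$2 = 1" "q1$1 * q2$1 + q1$2 * q2$2 = 0"
    using assms by (simp_all add: inner_vec_def sum_2)
  define D where "D = q1$1 * q2$2 - q1$2 * q2$1"
  have "D\<^sup>2 = (q1$1 * q1$1 + q1$2 * q1$2) * (q2$1 * q2$1 + q2$2 * q2$2) - (q1$1 * q2$1 + q1$2 * q2$2)\<^sup>2"
    unfolding D_def by (simp add: power2_eq_square algebra_simps)
  then have "D\<^sup>2 = 1" unfolding h by simp
  then have D1: "D = 1" using assms(4) unfolding D_def[symmetric] by (auto simp: power2_eq_1_iff)
  have "q2$1 = q2$1 * (q1$1 * q1$1 + q1$2 * q1$2)" unfolding h by simp
  also have "\<dots> = q1$1 * (q1$1 * q2$1 + q1$2 * q2$2) - q1$2 * D" by (simp add: D_def algebra_simps)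
  finally show "q2$1 = - q1$2" by (simp add: h D1)
  have "q2$2 = q2$2 * (q1$1 * q1$1 + q1$2 * q1$2)" unfolding h by simp
  also have "\<dots> = q1$2 * (q1$1 * q2$1 + q1$2 * q2$2) + q1$1 * D" by (simp add: D_def algebra_simps)
  finally show "q2$2 = q1$1" by (simp add: h D1)
qed

text \<open>In the coordinates of \<open>R\<close> the candidate acts on the image of the
  differential as the rotation \<rho> by a right angle. Every positive orthonormal basis has
  coordinates of the form q, \<rho> q by \<open>rotation_unique\<close>, so the condition over all
  such bases reduces to this rotation.\<close>

lemma twistor_lift_eq:
  fixes X :: "('x::topological_space, 2) manifold" and N :: "('n::topological_space, 4) manifold"
  assumes X: "oriented_smooth_atlas X" "riemannian X" and N: "oriented_smooth_atlas N" "riemannian N"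
    and f: "isometric_immersion X N f"
    and c: "c \<in> charts_at X x" and d: "d \<in> charts_at N (f x)"
    and R: "transpose R ** gram X c (cmap c x) ** R = mat 1" "det R > 0"
    and E: "transpose E ** gram N d (cmap d (f x)) ** E = mat 1" "det E > 0"
    and ER: "column 1 E = frechet_derivative (local_rep c d f) (at (cmap c x)) (column 1 R)"
      "column 2 E = frechet_derivative (local_rep c d f) (at (cmap c x)) (column 2 R)"
  shows "twistor_lift \<epsilon> X N f x = (f x, frame_twistor N (f x) d E (twistor_sgn \<epsilon>))"
proof -
  define p where "p = f x"
  define DF where "DF = frechet_derivative (local_rep c d f) (at (cmap c x))"
  define P where "P = transpose E ** gram N d (cmap d p)"
  define t where "t = twistor_sgn \<epsilon>"
  define J where "J = frame_twistor N p d E t"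
  define \<tau> where "\<tau> = tvec_of N p d"
  define \<sigma> where "\<sigma> = tvec_of X x c"
  define df where "df = differential X N f x"
  note J_def = J_def[unfolded frame_twistor_def]
  have dp: "d \<in> charts_at N p" using d by (simp add: p_def)
  have Ep: "transpose E ** gram N d (cmap d p) ** E = mat 1" using E by (simp add: p_def)
  have PE: "P ** E = mat 1" using Ep by (simp add: P_def)
  have \<sigma>T: "\<sigma> w \<in> tangent_space X x" for w unfolding \<sigma>_def by (rule tvec_of_in_tangent_space[OF X(1) c])
  have \<tau>T: "\<tau> w \<in> tangent_space N p" for w unfolding \<tau>_def by (rule tvec_of_in_tangent_space[OF N(1) dp])
  have \<sigma>c: "\<sigma> w c = w" for w unfolding \<sigma>_def by (rule tvec_of_self[OF X(1) c])
  have \<tau>d: "\<tau> w d = w" for w unfolding \<tau>_def by (rule tvec_of_self[OF N(1) dp])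
  have c\<sigma>: "\<sigma> (u c) = u" if "u \<in> tangent_space X x" for u
    unfolding \<sigma>_def by (rule tvec_of_component[OF X(1) c that])
  have df: "df u = \<tau> (DF (u c))" if "u \<in> tangent_space X x" for u
    unfolding df_def \<tau>_def p_def DF_def by (rule differential_eq[OF X N f c d that])
  have lDF: "linear DF"
    unfolding DF_def by (rule has_derivative_linear[OF local_rep_has_derivative[OF X N f c d]])
  have "R *v q = q$1 *\<^sub>R column 1 R + q$2 *\<^sub>R column 2 R" for q
    by (simp add: vec_eq_iff forall_2 matrix_vector_mult_def sum_2 column_def mult.commute)
  then have DFR: "DF (R *v q) = q$1 *\<^sub>R column 1 E + q$2 *\<^sub>R column 2 E" for q
    by (simp add: linear_add[OF lDF] linear_scale[OF lDF] ER[folded DF_def])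
  define \<rho> where "\<rho> q = (\<chi> i::2. if i = 1 then - q$2 else q$1)" for q :: "real ^ 2"
  have Jrot: "J (df u) = df (\<sigma> (R *v \<rho> q))" if "u \<in> tangent_space X x" "u c = R *v q" for u q
  proof -
    have "(E ** twistor_matrix t ** P) *v DF (u c) = q$1 *\<^sub>R column 2 E + (- q$2) *\<^sub>R column 1 E"
    proof -
      have "DF (u c) = E *v (q$1 *\<^sub>R axis 1 1 + q$2 *\<^sub>R axis 2 1)"
        by (simp add: that DFR matrix_vector_right_distrib matrix_vector_mult_scaleR matrix_vector_mult_basis)
      then have "(E ** twistor_matrix t ** P) *v DF (u c) =
          (E ** twistor_matrix t ** (P ** E)) *v (q$1 *\<^sub>R axis 1 1 + q$2 *\<^sub>R axis 2 1)"
        by (simp add: matrix_vector_mul_assoc matrix_mul_assoc)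
      also have "\<dots> = E *v (q$1 *\<^sub>R axis 2 1 + (- q$2) *\<^sub>R axis 1 1)"
        unfolding PE matrix_mul_rid matrix_vector_mul_assoc[symmetric]
        by (simp add: matrix_vector_right_distrib matrix_vector_mult_scaleR twistor_matrix_axis)
      also have "\<dots> = q$1 *\<^sub>R column 2 E + (- q$2) *\<^sub>R column 1 E"
        by (simp only: matrix_vector_right_distrib matrix_vector_mult_scaleR matrix_vector_mult_basis)
      finally show ?thesis .
    qed
    then show ?thesis
      unfolding df[OF that(1)] df[OF \<sigma>T] \<sigma>c DFR J_def using \<tau>T
      by (simp add: \<tau>d \<tau>_def[symmetric] P_def[symmetric] \<rho>_def add.commute)
  qed
  have RR: "R *v ((transpose R ** gram X c (cmap c x)) *v w) = w" for w
    by (simp only: matrix_vector_mul_assoc frame_inverse[OF R(1)] matrix_vector_mul_lid)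
  have onb: "J (df (e 1)) = df (e 2) \<and> J (df (e 2)) = - df (e 1)"
    if e: "orthonormal_basis X x e" "pos_oriented X x e" for e
  proof -
    have eT: "e i \<in> tangent_space X x" for i using e by (auto simp: orthonormal_basis_def)
    define q where "q i = (transpose R ** gram X c (cmap c x)) *v e i c" for i
    have eq: "e i c = R *v q i" for i by (simp add: q_def RR)
    have "q i \<bullet> q j = (if i = j then 1 else 0)" for i j
      using e(1) metric_eq_gram[OF X c eT eT, of i j] unfolding eq frame_inner[OF R(1)]
      by (simp add: orthonormal_basis_def)
    moreover have "det (\<chi> i. q i) > 0"
      using pos_oriented_iff[OF X(1) c, of e] eT e(2) R(2) unfolding eq det_rows_mult
      by (auto simp: zero_less_mult_iff)
    ultimately have "q 2 $ 1 = - q 1 $ 2" "q 2 $ 2 = q 1 $ 1"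
      using rotation_unique[of "q 1" "q 2"] by (simp_all add: det_2)
    then have \<rho>1: "\<rho> (q 1) = q 2" and \<rho>2: "\<rho> (q 2) = - q 1" by (simp_all add: \<rho>_def vec_eq_iff forall_2)
    have "J (df (e 1)) = df (e 2)"
      unfolding Jrot[OF eT eq] \<rho>1 eq[symmetric] c\<sigma>[OF eT] ..
    moreover have "J (df (e 2)) = - df (e 1)"
    proof -
      have "J (df (e 2)) = df (\<sigma> (R *v - q 1))" unfolding Jrot[OF eT eq] \<rho>2 ..
      also have "\<dots> = \<tau> (- DF (e 1 c))"
        by (simp add: df[OF \<sigma>T] \<sigma>c eq[of 1] linear_neg[OF matrix_vector_mul_linear] linear_neg[OF lDF])
      also have "\<dots> = - df (e 1)"
        unfolding df[OF eT] \<tau>_def by (rule linear_neg[OF linear_tvec_of[OF N(1) dp]])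
      finally show ?thesis .
    qed
    ultimately show ?thesis by blast
  qed
  have image: "J ` df ` tangent_space X x = df ` tangent_space X x"
  proof
    show "J ` df ` tangent_space X x \<subseteq> df ` tangent_space X x"
    proof clarify
      fix u assume u: "u \<in> tangent_space X x"
      show "J (df u) \<in> df ` tangent_space X x"
        unfolding Jrot[OF u RR[symmetric]] using \<sigma>T by blast
    qed
    show "df ` tangent_space X x \<subseteq> J ` df ` tangent_space X x"
    proof clarify
      fix u assume u: "u \<in> tangent_space X x"
      define q where "q = (transpose R ** gram X c (cmap c x)) *v u c"
      \<comment> \<open>\<rho> has square -1, so this is the preimage of q.\<close>
      define q' where "q' = - \<rho> q"
      have "\<rho> q' = q" by (simp add: q'_def \<rho>_def vec_eq_iff forall_2)
      then have "J (df (\<sigma> (R *v q'))) = df (\<sigma> (R *v q))" using Jrot[OF \<sigma>T \<sigma>c] by simp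
      also have "\<sigma> (R *v q) = u" by (simp add: q_def RR c\<sigma> u)
      finally show "df u \<in> J ` df ` tangent_space X x" using \<sigma>T by (metis imageI)
    qed
  qed
  have \<sigma>onb: "orthonormal_basis X x (\<lambda>i. \<sigma> (column i R))"
    unfolding \<sigma>_def by (rule tvec_of_orthonormal_basis[OF X c R(1)])
  have "(\<chi> i. \<sigma> (column i R) c) = transpose R" by (simp add: \<sigma>c vec_eq_iff column_def transpose_def)
  then have \<sigma>pos: "pos_oriented X x (\<lambda>i. \<sigma> (column i R))"
    using pos_oriented_iff[OF X(1) c, of "\<lambda>i. \<sigma> (column i R)"] \<sigma>T R(2) by (simp add: det_transpose image_subset_iff)
  have df\<sigma>: "df (\<sigma> (column 1 R)) = \<tau> (column 1 E)" "df (\<sigma> (column 2 R)) = \<tau> (column 2 E)"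
    by (simp_all add: df[OF \<sigma>T] \<sigma>c ER DF_def)
  show ?thesis
    unfolding twistor_lift_def
  proof (rule the_equality)
    show "(f x, frame_twistor N (f x) d E (twistor_sgn \<epsilon>)) \<in> twistor_space \<epsilon> N \<and>
      fst (f x, frame_twistor N (f x) d E (twistor_sgn \<epsilon>)) = f x \<and>
      snd (f x, frame_twistor N (f x) d E (twistor_sgn \<epsilon>)) ` differential X N f x ` tangent_space X x =
        differential X N f x ` tangent_space X x \<and>
      (\<forall>e. orthonormal_basis X x e \<and> pos_oriented X x e \<longrightarrow>
        snd (f x, frame_twistor N (f x) d E (twistor_sgn \<epsilon>)) (differential X N f x (e 1)) = differential X N f x (e 2) \<and>
        snd (f x, frame_twistor N (f x) d E (twistor_sgn \<epsilon>)) (differential X N f x (e 2)) = - differential X N f x (e 1))"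
      using frame_twistor_in_twistor_space[OF N d E] image onb
      unfolding J_def frame_twistor_def p_def t_def df_def by simp
  next
    fix z assume z: "z \<in> twistor_space \<epsilon> N \<and> fst z = f x \<and>
      snd z ` differential X N f x ` tangent_space X x = differential X N f x ` tangent_space X x \<and>
      (\<forall>e. orthonormal_basis X x e \<and> pos_oriented X x e \<longrightarrow>
        snd z (differential X N f x (e 1)) = differential X N f x (e 2) \<and>
        snd z (differential X N f x (e 2)) = - differential X N f x (e 1))"
    \<comment> \<open>The columns of \<open>R\<close> are themselves an admissible basis; this one
      instance is all that uniqueness requires.\<close>
    then have "snd z (df (\<sigma> (column 1 R))) = df (\<sigma> (column 2 R))"
      using \<sigma>onb \<sigma>pos unfolding df_def by blast
    then have "snd z = frame_twistor N (f x) d E (twistor_sgn \<epsilon>)"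
      using z unfolding df\<sigma> \<tau>_def p_def
      by (intro frame_twistor_unique[OF N d E]) (metis prod.collapse, simp)
    then show "z = (f x, frame_twistor N (f x) d E (twistor_sgn \<epsilon>))" using z by (metis prod.collapse)
  qed
qed

section \<open>Adapted frames\<close>

lemma has_derivative_vec_lambda:
  fixes e :: "'i::finite \<Rightarrow> 'a::real_normed_vector \<Rightarrow> 'b::euclidean_space"
  assumes "\<And>i. (e i has_derivative e' i) (at y within S)"
  shows "((\<lambda>y. \<chi> i. e i y) has_derivative (\<lambda>h. \<chi> i. e' i h)) (at y within S)"
proof -
  have lin: "bounded_linear (axis i :: 'b \<Rightarrow> 'b ^ 'i)" for i
    unfolding linear_conv_bounded_linear[symmetric] by (intro linearI) (auto simp: axis_def vec_eq_iff)
  have expand: "(\<chi> i. g i) = (\<Sum>i\<in>UNIV. axis i (g i))" for g :: "'i \<Rightarrow> 'b"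
    by (simp add: vec_eq_iff axis_def)
  show ?thesis
    unfolding expand by (intro has_derivative_sum bounded_linear.has_derivative[OF lin] assms)
qed

lemma tendsto_det:
  fixes A :: "'a \<Rightarrow> real ^ 'k ^ 'k"
  shows "(A \<longlongrightarrow> B) F \<Longrightarrow> ((\<lambda>y. det (A y)) \<longlongrightarrow> det B) F"
  unfolding det_def by (intro tendsto_sum tendsto_mult tendsto_prod tendsto_vec_nth tendsto_const)

lemma eventually_det_pos:
  fixes A :: "'a::real_normed_vector \<Rightarrow> real ^ 'k ^ 'k"
  assumes "A differentiable (at y)" "det (A y) > 0"
  shows "\<forall>\<^sub>F z in nhds y. det (A z) > 0"
proof -
  have "(A \<longlongrightarrow> A y) (nhds y)"
    using differentiable_imp_continuous_within[OF assms(1)] unfolding continuous_within tendsto_at_iff_tendsto_nhds .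
  from order_tendstoD(1)[OF tendsto_det[OF this] assms(2)] show ?thesis .
qed

section \<open>Differentials applied to moving vectors\<close>

context
  fixes F :: "'a::euclidean_space \<Rightarrow> 'b::euclidean_space" and U and y
  assumes F: "smooth_on F U" and U: "open U" "y \<in> U"
begin

lemma second_derivative_symmetric:
  "frechet_derivative (\<lambda>z. frechet_derivative F (at z) u) (at y) v =
    frechet_derivative (\<lambda>z. frechet_derivative F (at z) v) (at y) u"
  using F U by (intro second_derivative_commute) (auto simp: smooth_on_def)

lemma linear_second_derivative:
  "linear (frechet_derivative (\<lambda>z. frechet_derivative F (at z) u) (at y))"
  by (rule has_derivative_linear[OF smooth_on_imp_frechet_has_derivative[OF F U(2)]])

text \<open>\<open>Ck_on\<close> differentiates the derivative of F in a fixed direction only, so r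
  z is expanded in \<open>Basis\<close>. Reassembling the sum needs the second derivative to be
  linear in the inner direction, which follows from its symmetry.\<close>

lemma has_derivative_frechet_derivative_apply:
  assumes r: "(r has_derivative r') (at y)"
  shows "((\<lambda>z. frechet_derivative F (at z) (r z)) has_derivative
    (\<lambda>h. frechet_derivative (\<lambda>z. frechet_derivative F (at z) (r y)) (at y) h +
      frechet_derivative F (at y) (r' h))) (at y)"
proof -
  define D where "D z = frechet_derivative F (at z)" for z
  define S where "S w h = frechet_derivative (\<lambda>z. frechet_derivative F (at z) w) (at y) h" for w h
  have lD: "linear (D z)" if "z \<in> U" for z
    unfolding D_def by (rule has_derivative_linear[OF smooth_on_imp_has_derivative[OF F that]])
  have lS: "linear (\<lambda>w. S w h)" for h
    unfolding S_def using linear_second_derivative[of h] by (subst second_derivative_symmetric)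
  have expand: "L w = (\<Sum>b\<in>Basis. (w \<bullet> b) *\<^sub>R L b)" if "linear L" for L :: "'a \<Rightarrow> 'b" and w
    using linear_sum[OF that, of "\<lambda>b. (w \<bullet> b) *\<^sub>R b" Basis] by (simp add: linear_scale[OF that] euclidean_representation)
  have "((\<lambda>z. \<Sum>b\<in>Basis. (r z \<bullet> b) *\<^sub>R D z b) has_derivative
      (\<lambda>h. \<Sum>b\<in>Basis. (r y \<bullet> b) *\<^sub>R S b h + (r' h \<bullet> b) *\<^sub>R D y b)) (at y)"
    unfolding D_def S_def
    by (intro has_derivative_sum has_derivative_scaleR has_derivative_inner_left r
        smooth_on_imp_frechet_has_derivative[OF F U(2)])
  moreover have "(\<Sum>b\<in>Basis. (r y \<bullet> b) *\<^sub>R S b h + (r' h \<bullet> b) *\<^sub>R D y b) = S (r y) h + D y (r' h)" for h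
    using expand[OF lS, of "r y" h] expand[OF lD[OF U(2)], of "r' h"] by (simp add: sum.distrib)
  ultimately have "((\<lambda>z. \<Sum>b\<in>Basis. (r z \<bullet> b) *\<^sub>R D z b) has_derivative (\<lambda>h. S (r y) h + D y (r' h))) (at y)"
    by simp
  then have "((\<lambda>z. D z (r z)) has_derivative (\<lambda>h. S (r y) h + D y (r' h))) (at y)"
    by (rule has_derivative_transform_within_open[OF _ U]) (simp add: expand[OF lD, symmetric])
  then show ?thesis unfolding D_def S_def .
qed

end

lemma column_frame_iff_4:
  fixes E :: "real ^ 4 ^ 4"
  assumes "transpose G = G"
  shows "transpose E ** G ** E = mat 1 \<longleftrightarrow>
    column 1 E \<bullet> (G *v column 1 E) = 1 \<and> column 2 E \<bullet> (G *v column 2 E) = 1 \<and>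
    column 3 E \<bullet> (G *v column 3 E) = 1 \<and> column 4 E \<bullet> (G *v column 4 E) = 1 \<and>
    column 1 E \<bullet> (G *v column 2 E) = 0 \<and> column 1 E \<bullet> (G *v column 3 E) = 0 \<and>
    column 1 E \<bullet> (G *v column 4 E) = 0 \<and> column 2 E \<bullet> (G *v column 3 E) = 0 \<and>
    column 2 E \<bullet> (G *v column 4 E) = 0 \<and> column 3 E \<bullet> (G *v column 4 E) = 0"
  unfolding frame_iff forall_4 using symmetric_inner_swap[OF assms] by auto

lemma transpose_gram_on_chart:
  assumes "oriented_smooth_atlas M" "riemannian M" "c \<in> charts_at M p"
  shows "\<forall>\<^sub>F y in nhds (cmap c p). transpose (gram M c y) = gram M c y"
proof -
  have "\<forall>\<^sub>F y in nhds (cmap c p). y \<in> cmap c ` cdom c"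
    using assms(1,3) by (intro eventually_nhds_in_open open_cmap_image[OF assms(1)] open_cdom[OF assms(1)])
      (auto simp: charts_at_def)
  then show ?thesis
    by (rule eventually_mono) (use assms transpose_gram[OF assms(1,2)] in \<open>auto simp: charts_at_def\<close>)
qed

lemma gram_differentiable:
  "oriented_smooth_atlas M \<Longrightarrow> riemannian M \<Longrightarrow> c \<in> charts_at M p \<Longrightarrow> gram M c differentiable (at (cmap c p))"
  using gram_has_derivative differentiable_def by blast

context
  fixes X :: "('x::topological_space, 2) manifold" and N :: "('n::topological_space, 4) manifold"
    and f :: "'x \<Rightarrow> 'n" and x c d
  assumes X: "oriented_smooth_atlas X" "riemannian X" and N: "oriented_smooth_atlas N" "riemannian N"
    and f: "isometric_immersion X N f" and c: "c \<in> charts_at X x" and d: "d \<in> charts_at N (f x)"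
begin

lemma local_rep_at: "local_rep c d f (cmap c x) = cmap d (f x)"
  using c by (simp add: chart_inv_cmap[OF X(1)] charts_at_def)

lemma eventually_overlap:
  "\<forall>\<^sub>F y in nhds (cmap c x). c \<in> charts_at X (chart_inv c y) \<and> d \<in> charts_at N (f (chart_inv c y)) \<and>
    cmap c (chart_inv c y) = y"
proof -
  have "\<forall>\<^sub>F y in nhds (cmap c x). y \<in> cmap c ` {x \<in> cdom c. f x \<in> cdom d}"
    using c d by (intro eventually_nhds_in_open overlap_image_open[OF X N f] in_overlap_image[OF X N f])
      (auto simp: charts_at_def)
  then show ?thesis
    by (rule eventually_mono) (use c d in \<open>auto simp: charts_at_def chart_inv_cmap[OF X(1)]\<close>)
qed

text \<open>The values at the point are prescribed so that the moving frame extends the one tied to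
  \<open>onb_at\<close>. Orthonormality and positive determinants in a neighbourhood are the
  conditions under which \<open>twistor_lift_eq\<close> applies at the nearby points.\<close>

lemma adapted_frame:
  defines "y0 \<equiv> cmap c x" and "F \<equiv> local_rep c d f"
  assumes R0: "transpose R0 ** gram X c y0 ** R0 = mat 1" "det R0 > 0"
    and E0: "transpose E0 ** gram N d (F y0) ** E0 = mat 1" "det E0 > 0"
    and ER0: "column 1 E0 = frechet_derivative F (at y0) (column 1 R0)"
      "column 2 E0 = frechet_derivative F (at y0) (column 2 R0)"
  obtains R E R' E' where "R y0 = R0" "E y0 = E0"
    "(R has_derivative R') (at y0)" "(E has_derivative E') (at y0)"
    "\<forall>\<^sub>F y in nhds y0. transpose (R y) ** gram X c y ** R y = mat 1 \<and> det (R y) > 0"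
    "\<forall>\<^sub>F y in nhds y0. transpose (E y) ** gram N d (F y) ** E y = mat 1 \<and> det (E y) > 0"
    "\<And>y. column 1 (E y) = frechet_derivative F (at y) (column 1 (R y))"
    "\<And>y. column 2 (E y) = frechet_derivative F (at y) (column 2 (R y))"
proof -
  define D where "D y = frechet_derivative F (at y)" for y
  define U where "U = cmap c ` {x \<in> cdom c. f x \<in> cdom d}"
  have ca: "c \<in> atlas X" "d \<in> atlas N" using c d by (auto simp: charts_at_def)
  have U: "open U" "y0 \<in> U"
    unfolding U_def y0_def using overlap_image_open[OF X N f ca] in_overlap_image[OF X N f c d] by auto
  have Fs: "smooth_on F U" unfolding F_def U_def by (rule local_rep_smooth[OF X N f ca])
  define H where "H y = gram N d (F y)" for y
  have Fy0: "F y0 = cmap d (f x)" unfolding F_def y0_def by (rule local_rep_at)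
  have ov: "\<forall>\<^sub>F y in nhds y0. c \<in> charts_at X (chart_inv c y) \<and> d \<in> charts_at N (f (chart_inv c y)) \<and>
      cmap c (chart_inv c y) = y"
    unfolding y0_def by (rule eventually_overlap)
  have iso: "\<forall>\<^sub>F y in nhds y0. \<forall>a b. D y a \<bullet> (H y *v D y b) = a \<bullet> (gram X c y *v b)"
    using ov
  proof eventually_elim
    case (elim y)
    then have "F y = cmap d (f (chart_inv c y))" by (simp add: F_def)
    then show ?case
      using elim local_rep_isometric[OF X N f, of c "chart_inv c y" d] by (simp add: D_def H_def F_def)
  qed
  have gd: "gram X c differentiable (at y0)" unfolding y0_def by (rule gram_differentiable[OF X c])
  have gs: "\<forall>\<^sub>F y in nhds y0. transpose (gram X c y) = gram X c y"
    unfolding y0_def by (rule transpose_gram_on_chart[OF X c])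
  have Hd: "H differentiable (at y0)"
    unfolding H_def using differentiable_chain_at[of F y0 "gram N d"] smooth_on_imp_differentiable[OF Fs U(2)]
      gram_differentiable[OF N d] by (simp add: Fy0 o_def)
  have Hs: "\<forall>\<^sub>F y in nhds y0. transpose (H y) = H y"
    using ov
  proof eventually_elim
    case (elim y)
    then have "F y = cmap d (f (chart_inv c y))" by (simp add: F_def)
    then show ?case using elim transpose_gram[OF N, of d "f (chart_inv c y)"] by (simp add: H_def)
  qed
  have R0c: "column i R0 \<bullet> (gram X c y0 *v column j R0) = (if i = j then 1 else 0)" for i j
    using R0(1) by (simp add: frame_iff)
  have E0c: "column i E0 \<bullet> (H y0 *v column j E0) = (if i = j then 1 else 0)" for i j
    using E0(1) by (simp add: frame_iff H_def)
  obtain r1 where r1: "r1 differentiable (at y0)" "r1 y0 = column 1 R0"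
    "\<forall>\<^sub>F y in nhds y0. r1 y \<bullet> (gram X c y *v r1 y) = 1"
    by (rule gram_schmidt_step[of "{} :: nat set" "gram X c" y0 "\<lambda>_ _. 0" "\<lambda>_. column 1 R0"])
      (use gd gs R0c in auto)
  obtain r2 where r2: "r2 differentiable (at y0)" "r2 y0 = column 2 R0"
    "\<forall>\<^sub>F y in nhds y0. r2 y \<bullet> (gram X c y *v r2 y) = 1"
    "\<forall>\<^sub>F y in nhds y0. r1 y \<bullet> (gram X c y *v r2 y) = 0 \<and> r2 y \<bullet> (gram X c y *v r1 y) = 0"
    by (rule gram_schmidt_step[of "{1 :: nat}" "gram X c" y0 "\<lambda>_. r1" "\<lambda>_. column 2 R0"])
      (use gd gs R0c r1 in auto)
  \<comment> \<open>As images under the differential, e1 and e2 span the tangent plane at every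
    nearby point, and \<open>iso\<close> keeps them orthonormal; only e3 and e4 need Gram-Schmidt in
    the ambient metric.\<close>
  define e1 where "e1 y = D y (r1 y)" for y
  define e2 where "e2 y = D y (r2 y)" for y
  have "(\<lambda>y. D y (r y)) differentiable (at y0)" if "r differentiable (at y0)" for r
    using that has_derivative_frechet_derivative_apply[OF Fs U] unfolding differentiable_def D_def by blast
  from this[OF r1(1)] this[OF r2(1)] have e12: "e1 differentiable (at y0)" "e2 differentiable (at y0)"
    unfolding e1_def[abs_def] e2_def[abs_def] .
  have e12_0: "e1 y0 = column 1 E0" "e2 y0 = column 2 E0"
    by (simp_all add: e1_def e2_def r1 r2 ER0 D_def)
  have on12: "\<forall>\<^sub>F y in nhds y0. e1 y \<bullet> (H y *v e1 y) = 1" "\<forall>\<^sub>F y in nhds y0. e2 y \<bullet> (H y *v e2 y) = 1"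
    "\<forall>\<^sub>F y in nhds y0. e1 y \<bullet> (H y *v e2 y) = 0" "\<forall>\<^sub>F y in nhds y0. e2 y \<bullet> (H y *v e1 y) = 0"
  proof -
    have "\<forall>\<^sub>F y in nhds y0. e1 y \<bullet> (H y *v e1 y) = 1 \<and> e2 y \<bullet> (H y *v e2 y) = 1 \<and>
        e1 y \<bullet> (H y *v e2 y) = 0 \<and> e2 y \<bullet> (H y *v e1 y) = 0"
      using iso r1(3) r2(3,4) by eventually_elim (simp add: e1_def e2_def)
    then show "\<forall>\<^sub>F y in nhds y0. e1 y \<bullet> (H y *v e1 y) = 1" "\<forall>\<^sub>F y in nhds y0. e2 y \<bullet> (H y *v e2 y) = 1"
      "\<forall>\<^sub>F y in nhds y0. e1 y \<bullet> (H y *v e2 y) = 0" "\<forall>\<^sub>F y in nhds y0. e2 y \<bullet> (H y *v e1 y) = 0"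
      by (auto elim: eventually_mono)
  qed
  define k2 where "k2 i = (if i = 1 then e1 else e2)" for i :: nat
  obtain e3 where e3: "e3 differentiable (at y0)" "e3 y0 = column 3 E0"
    "\<forall>\<^sub>F y in nhds y0. e3 y \<bullet> (H y *v e3 y) = 1"
    "\<And>j. j \<in> {1, 2 :: nat} \<Longrightarrow> \<forall>\<^sub>F y in nhds y0. k2 j y \<bullet> (H y *v e3 y) = 0 \<and> e3 y \<bullet> (H y *v k2 j y) = 0"
    by (rule gram_schmidt_step[of "{1, 2 :: nat}" H y0 k2 "\<lambda>_. column 3 E0"])
      (use Hd Hs E0c e12 e12_0 on12 in \<open>auto simp: k2_def\<close>)
  have on3: "\<forall>\<^sub>F y in nhds y0. e1 y \<bullet> (H y *v e3 y) = 0 \<and> e3 y \<bullet> (H y *v e1 y) = 0"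
    "\<forall>\<^sub>F y in nhds y0. e2 y \<bullet> (H y *v e3 y) = 0 \<and> e3 y \<bullet> (H y *v e2 y) = 0"
    using e3(4)[of 1] e3(4)[of 2] by (simp_all add: k2_def)
  define k3 where "k3 i = (if i = 1 then e1 else if i = 2 then e2 else e3)" for i :: nat
  obtain e4 where e4: "e4 differentiable (at y0)" "e4 y0 = column 4 E0"
    "\<forall>\<^sub>F y in nhds y0. e4 y \<bullet> (H y *v e4 y) = 1"
    "\<And>j. j \<in> {1, 2, 3 :: nat} \<Longrightarrow> \<forall>\<^sub>F y in nhds y0. k3 j y \<bullet> (H y *v e4 y) = 0 \<and> e4 y \<bullet> (H y *v k3 j y) = 0"
    by (rule gram_schmidt_step[of "{1, 2, 3 :: nat}" H y0 k3 "\<lambda>_. column 4 E0"])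
      (use Hd Hs E0c e12 e12_0 on12 e3(1-3) on3 in \<open>auto simp: k3_def elim: eventually_mono\<close>)
  have on4: "\<forall>\<^sub>F y in nhds y0. e1 y \<bullet> (H y *v e4 y) = 0" "\<forall>\<^sub>F y in nhds y0. e2 y \<bullet> (H y *v e4 y) = 0"
    "\<forall>\<^sub>F y in nhds y0. e3 y \<bullet> (H y *v e4 y) = 0"
    using e4(4)[of 1] e4(4)[of 2] e4(4)[of 3] by (auto simp: k3_def elim: eventually_mono)
  define R where "R y = transpose (\<chi> i::2. if i = 1 then r1 y else r2 y)" for y
  define E where "E y = transpose (\<chi> i::4. if i = 1 then e1 y else if i = 2 then e2 y else if i = 3 then e3 y else e4 y)" for y
  have Rc: "column 1 (R y) = r1 y" "column 2 (R y) = r2 y" for y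
    by (simp_all add: R_def column_def transpose_def vec_eq_iff)
  have Ec: "column 1 (E y) = e1 y" "column 2 (E y) = e2 y" "column 3 (E y) = e3 y" "column 4 (E y) = e4 y" for y
    by (simp_all add: E_def column_def transpose_def vec_eq_iff)
  have RI: "A = B" if "column 1 A = column 1 B" "column 2 A = column 2 B" for A B :: "real ^ 2 ^ 2"
    using that by (simp add: column_def vec_eq_iff forall_2)
  have EI: "A = B" if "column 1 A = column 1 B" "column 2 A = column 2 B" "column 3 A = column 3 B"
    "column 4 A = column 4 B" for A B :: "real ^ 4 ^ 4"
    using that by (simp add: column_def vec_eq_iff forall_4)
  have RR0: "R y0 = R0" by (rule RI) (simp_all add: Rc r1 r2)
  have EE0: "E y0 = E0" by (rule EI) (simp_all add: Ec e12_0 e3 e4)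
  have "\<exists>E'. (E has_derivative E') (at y0)"
  proof -
    obtain e1' e2' e3' e4' where e': "(e1 has_derivative e1') (at y0)" "(e2 has_derivative e2') (at y0)"
      "(e3 has_derivative e3') (at y0)" "(e4 has_derivative e4') (at y0)"
      using e12 e3(1) e4(1) unfolding differentiable_def by blast
    have "((\<lambda>y. \<chi> i::4. if i = 1 then e1 y else if i = 2 then e2 y else if i = 3 then e3 y else e4 y) has_derivative
      (\<lambda>h. \<chi> i::4. (if i = 1 then e1' else if i = 2 then e2' else if i = 3 then e3' else e4') h)) (at y0)"
      by (rule has_derivative_vec_lambda) (simp add: e')
    from has_derivative_matrix_transpose[OF this] show ?thesis unfolding E_def by blast
  qed
  then obtain E' where E': "(E has_derivative E') (at y0)" by blast
  have "\<exists>R'. (R has_derivative R') (at y0)"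
  proof -
    obtain r1' r2' where r': "(r1 has_derivative r1') (at y0)" "(r2 has_derivative r2') (at y0)"
      using r1(1) r2(1) unfolding differentiable_def by blast
    have "((\<lambda>y. \<chi> i::2. if i = 1 then r1 y else r2 y) has_derivative
      (\<lambda>h. \<chi> i::2. (if i = 1 then r1' else r2') h)) (at y0)"
      by (rule has_derivative_vec_lambda) (simp add: r')
    from has_derivative_matrix_transpose[OF this] show ?thesis unfolding R_def by blast
  qed
  then obtain R' where R': "(R has_derivative R') (at y0)" by blast
  show thesis
  proof (rule that[OF RR0 EE0 R' E'])
    have "\<forall>\<^sub>F y in nhds y0. transpose (R y) ** gram X c y ** R y = mat 1"
      using r1(3) r2(3) r2(4) by eventually_elim (simp add: frame_iff forall_2 Rc)
    moreover have "\<forall>\<^sub>F y in nhds y0. det (R y) > 0"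
      by (rule eventually_det_pos) (use R' RR0 R0 in \<open>auto simp: differentiable_def\<close>)
    ultimately show "\<forall>\<^sub>F y in nhds y0. transpose (R y) ** gram X c y ** R y = mat 1 \<and> det (R y) > 0"
      by (rule eventually_conj)
    have "\<forall>\<^sub>F y in nhds y0. transpose (E y) ** gram N d (F y) ** E y = mat 1"
      using Hs on12 e3(3) on3 e4(3) on4 unfolding H_def
      by eventually_elim (simp add: column_frame_iff_4 Ec)
    moreover have "\<forall>\<^sub>F y in nhds y0. det (E y) > 0"
      by (rule eventually_det_pos) (use E' EE0 E0 in \<open>auto simp: differentiable_def\<close>)
    ultimately show "\<forall>\<^sub>F y in nhds y0. transpose (E y) ** gram N d (F y) ** E y = mat 1 \<and> det (E y) > 0"
      by (rule eventually_conj)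
  qed (simp_all add: Rc Ec e1_def e2_def D_def)
qed

end

section \<open>The second fundamental form and the vertical derivative\<close>

text \<open>
  The normal component of the following expression is the second fundamental form; its tangential
  component is the coordinate expression of the Levi-Civita connection of the source.
\<close>

definition hessian ::
  "('n, 'k::finite) manifold \<Rightarrow> ('n, 'k) chart \<Rightarrow> ('a::real_normed_vector \<Rightarrow> real ^ 'k) \<Rightarrow> 'a \<Rightarrow> 'a \<Rightarrow> 'a \<Rightarrow> real ^ 'k"
  where "hessian N d F y u w = frechet_derivative (\<lambda>z. frechet_derivative F (at z) u) (at y) w +
    christoffel (gram N d) (F y) (frechet_derivative F (at y) u) (frechet_derivative F (at y) w)"

lemma column_expansion:
  fixes E :: "real ^ 'k ^ 'k"
  assumes "transpose E ** G ** E = mat 1"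
  shows "w = (\<Sum>i\<in>UNIV. (column i E \<bullet> (G *v w)) *\<^sub>R column i E)"
proof -
  have "w = E *v (transpose E *v (G *v w))"
    by (simp only: matrix_vector_mul_assoc[of "transpose E"] matrix_vector_mul_assoc[of E]
        frame_inverse[OF assms] matrix_vector_mul_lid)
  also have "\<dots> = (\<Sum>i\<in>UNIV. (column i E \<bullet> (G *v w)) *\<^sub>R column i E)"
    by (simp add: vec_eq_iff matrix_vector_mult_def transpose_def column_def inner_vec_def mult.commute
        del: transpose_matrix_vector)
  finally show ?thesis .
qed

text \<open>The frame coordinates of the unspecified basis \<open>onb_at\<close> form an orthogonal
  matrix Q, under which the Frobenius norm of M is invariant.\<close>

lemma vertical_norm_frame:
  fixes N :: "('n::topological_space, 4) manifold" and E M :: "real ^ 4 ^ 4"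
  assumes N: "oriented_smooth_atlas N" "riemannian N" and d: "d \<in> charts_at N p"
    and E: "transpose E ** gram N d (cmap d p) ** E = mat 1"
    and B: "\<And>u. u \<in> tangent_space N p \<Longrightarrow>
      B u = tvec_of N p d ((E ** M ** (transpose E ** gram N d (cmap d p))) *v u d)"
  shows "(vertical_norm N p B)\<^sup>2 = 1 / 16 * (\<Sum>i\<in>UNIV. \<Sum>j\<in>UNIV. (M $ i $ j)\<^sup>2)"
proof -
  define b where "b = onb_at N p"
  have onb: "orthonormal_basis N p b"
    unfolding b_def by (rule onb_at_orthonormal[OF N charts_at_imp_carrier[OF N(1) d]])
  then have bT: "b i \<in> tangent_space N p" for i by (auto simp: orthonormal_basis_def)
  define P where "P = transpose E ** gram N d (cmap d p)"
  have EP: "E *v (P *v w) = w" for w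
    unfolding P_def by (simp only: matrix_vector_mul_assoc frame_inverse[OF E] matrix_vector_mul_lid)
  define Q where "Q = transpose (\<chi> i. P *v b i d)"
  have Q: "column i Q = P *v b i d" for i by (simp add: Q_def column_def transpose_def vec_eq_iff)
  have "column i Q \<bullet> column j Q = (if i = j then 1 else 0)" for i j
  proof -
    have "column i Q \<bullet> column j Q = (E *v (P *v b i d)) \<bullet> (gram N d (cmap d p) *v (E *v (P *v b j d)))"
      unfolding Q by (rule frame_inner[OF E, symmetric])
    also have "\<dots> = metric N p (b i) (b j)" unfolding EP by (rule metric_eq_gram[OF N d bT bT, symmetric])
    finally show ?thesis using onb by (simp add: orthonormal_basis_def)
  qed
  then have QQ: "transpose Q ** Q = mat 1" using frame_iff[of Q "mat 1"] by simp
  have "metric N p (B (b i)) (B (b i)) = (M *v column i Q) \<bullet> (M *v column i Q)" for i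
  proof -
    have "B (b i) = tvec_of N p d (E *v (M *v column i Q))"
      unfolding B[OF bT] Q P_def by (simp only: matrix_vector_mul_assoc[symmetric])
    then show ?thesis by (simp add: metric_tvec_of[OF N d] frame_inner[OF E])
  qed
  then have "(\<Sum>i\<in>UNIV. metric N p (B (b i)) (B (b i))) = (\<Sum>i\<in>UNIV. \<Sum>j\<in>UNIV. (M $ i $ j)\<^sup>2)"
    using frobenius_orthogonal_invariant[OF QQ, of M] by simp
  moreover have "0 \<le> (\<Sum>i\<in>UNIV. \<Sum>j\<in>UNIV. (M $ i $ j)\<^sup>2)" by (intro sum_nonneg) simp
  ultimately show ?thesis by (simp add: vertical_norm_def b_def[symmetric])
qed

text \<open>The data at one point: the charts chosen by the definitions and positively oriented
  frames \<open>R\<close> of the surface and \<open>E\<close> of the ambient space. The lifts depend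
  on the orientation, which \<open>onb_at\<close> need not respect; \<sigma> is the sign by which
  its second vector differs from that of \<open>R\<close>.\<close>

locale adapted_frame_at =
  fixes X :: "('x::topological_space, 2) manifold" and N :: "('n::topological_space, 4) manifold"
    and f :: "'x \<Rightarrow> 'n" and x c d F G DF and R E and \<sigma> :: real
  assumes X: "oriented_smooth_atlas X" "riemannian X" and N: "oriented_smooth_atlas N" "riemannian N"
    and f: "isometric_immersion X N f" and x: "x \<in> carrier X"
    and c_def: "c = chart_at X x" and d_def: "d = chart_at N (f x)"
    and F_def: "F = local_rep c d f" and G_def: "G = gram N d (cmap d (f x))"
    and DF_def: "DF = frechet_derivative F (at (cmap c x))"
    and R: "transpose R ** gram X c (cmap c x) ** R = mat 1" "det R > 0"
    and E: "transpose E ** G ** E = mat 1" "det E > 0"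
    and ER: "column 1 E = DF (column 1 R)" "column 2 E = DF (column 2 R)"
    and \<sigma>: "\<sigma> = 1 \<or> \<sigma> = - 1"
    and R_onb: "column 1 R = onb_at X x 1 c" "column 2 R = \<sigma> *\<^sub>R onb_at X x 2 c"
begin

lemma c: "c \<in> charts_at X x" unfolding c_def by (rule chart_at_in[OF X(1) x])

lemma d: "d \<in> charts_at N (f x)"
  unfolding d_def using f x by (intro chart_at_in[OF N(1)]) (auto simp: isometric_immersion_def smooth_map_def)

lemma F_at: "F (cmap c x) = cmap d (f x)"
  unfolding F_def by (rule local_rep_at[OF X N f c d])

lemma F_smooth: "\<exists>U. smooth_on F U \<and> open U \<and> cmap c x \<in> U"
  unfolding F_def using c d
  by (intro exI[of _ "cmap c ` {x \<in> cdom c. f x \<in> cdom d}"] conjI local_rep_smooth[OF X N f]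
      overlap_image_open[OF X N f] in_overlap_image[OF X N f]) (auto simp: charts_at_def)

lemma linear_DF: "linear DF"
  unfolding DF_def F_def by (rule has_derivative_linear[OF local_rep_has_derivative[OF X N f c d]])

lemma christoffel_gram_commute:
  "christoffel (gram N d) (cmap d (f x)) a b = christoffel (gram N d) (cmap d (f x)) b a"
  by (rule christoffel_commute[OF gram_differentiable[OF N d] transpose_gram_on_chart[OF N d]])
    (rule gram_pos[OF N d])

lemma linear_christoffel_gram: "linear (christoffel (gram N d) (cmap d (f x)) a)"
  by (rule linear_christoffel[OF gram_differentiable[OF N d] transpose_gram_on_chart[OF N d]])
    (rule gram_pos[OF N d])

abbreviation "hess \<equiv> hessian N d F (cmap c x)"

text \<open>Equality of mixed derivatives for the first term, vanishing torsion for the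
  second.\<close>

lemma hess_commute: "hess u w = hess w u"
proof -
  obtain U where U: "smooth_on F U" "open U" "cmap c x \<in> U" using F_smooth by blast
  show ?thesis
    unfolding hessian_def F_at by (simp only: second_derivative_symmetric[OF U, of u w] christoffel_gram_commute[of "frechet_derivative F (at (cmap c x)) u"])
qed

lemma linear_hess: "linear (hess u)"
proof -
  obtain U where U: "smooth_on F U" "open U" "cmap c x \<in> U" using F_smooth by blast
  have "linear (\<lambda>w. christoffel (gram N d) (cmap d (f x)) (DF u) (DF w))"
    using linear_compose[OF linear_DF linear_christoffel_gram] by (simp add: o_def)
  from linear_compose_add[OF linear_second_derivative[OF U, of u] this] show ?thesis
    unfolding hessian_def F_at DF_def by simp
qed

lemma differential_DF:
  "v \<in> tangent_space X x \<Longrightarrow> differential X N f x v = tvec_of N (f x) d (DF (v c))"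
  unfolding DF_def F_def by (rule differential_eq[OF X N f c d])

text \<open>A field with constant components w in c is mapped to one with components DF w in d,
  taken at the moving point; differentiating along u and adding the Christoffel term gives the
  Hessian.\<close>

lemma cov_deriv_differential:
  assumes u: "u \<in> tangent_space X x"
  shows "cov_deriv X N f x u (\<lambda>x'. differential X N f x' (tvec_of X x' c w)) = tvec_of N (f x) d (hess (u c) w)"
proof -
  obtain U where U: "smooth_on F U" "open U" "cmap c x \<in> U" using F_smooth by blast
  define s where "s x' = differential X N f x' (tvec_of X x' c w)" for x'
  have "\<forall>\<^sub>F y in nhds (cmap c x). frechet_derivative F (at y) w = ((\<lambda>x'. s x' d) \<circ> chart_inv c) y"
    using eventually_overlap[OF X N f c d]
  proof eventually_elim
    case (elim y)
    then show ?case
      using differential_component[OF X N f, of c "chart_inv c y" d] tvec_of_in_tangent_space[OF X(1)] tvec_of_self[OF X(1)]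
      by (simp add: s_def F_def)
  qed
  then have "((\<lambda>x'. s x' d) \<circ> chart_inv c has_derivative
      frechet_derivative (\<lambda>z. frechet_derivative F (at z) w) (at (cmap c x))) (at (cmap c x))"
    using eventually_nhds_x_imp_x
    by (intro has_derivative_transform_eventually[OF smooth_on_imp_frechet_has_derivative[OF U(1,3), of w]])
      (auto simp: eventually_nhds_conv_at)
  then have "dir_deriv X x u (\<lambda>x'. s x' d) = frechet_derivative (\<lambda>z. frechet_derivative F (at z) w) (at (cmap c x)) (u c)"
    by (rule dir_deriv_eq[OF X(1) c u])
  moreover have "s x d = DF w" "differential X N f x u d = DF (u c)"
    using differential_component[OF X N f c d] tvec_of_in_tangent_space[OF X(1) c] u
    by (simp_all add: s_def tvec_of_self[OF X(1) c] DF_def F_def)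
  ultimately have "cov_deriv X N f x u s = tvec_of N (f x) d (hess w (u c))"
    unfolding cov_deriv_def Let_def d_def[symmetric] hessian_def F_at DF_def[symmetric]
    by (simp add: christoffel_gram_commute[of "DF (u c)"])
  then show ?thesis unfolding s_def hess_commute[of w] .
qed

lemma G_sym: "transpose G = G" unfolding G_def by (rule transpose_gram[OF N d])

lemma E_orthonormal: "column i E \<bullet> (G *v column j E) = (if i = j then 1 else 0)"
  using E(1) by (simp add: frame_iff)

lemma DF_R: "DF (R *v q) = q$1 *\<^sub>R column 1 E + q$2 *\<^sub>R column 2 E"
proof -
  have "R *v q = q$1 *\<^sub>R column 1 R + q$2 *\<^sub>R column 2 R"
    by (simp add: vec_eq_iff forall_2 matrix_vector_mult_def sum_2 column_def mult.commute)
  then show ?thesis by (simp add: linear_add[OF linear_DF] linear_scale[OF linear_DF] ER)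
qed

lemma R_expand: "R *v ((transpose R ** gram X c (cmap c x)) *v w) = w"
  by (simp only: matrix_vector_mul_assoc frame_inverse[OF R(1)] matrix_vector_mul_lid)

lemma DF_normal:
  assumes "j = 3 \<or> j = 4"
  shows "column j E \<bullet> (G *v DF w) = 0"
proof -
  have "DF w = DF (R *v ((transpose R ** gram X c (cmap c x)) *v w))" by (simp only: R_expand)
  then show ?thesis
    unfolding DF_R using assms
    by (auto simp: matrix_vector_right_distrib matrix_vector_mult_scaleR inner_add_right E_orthonormal)
qed

lemma normal_fibre_iff:
  "n \<in> normal_fibre X N f x \<longleftrightarrow> n \<in> tangent_space N (f x) \<and>
    (\<exists>a b. n d = a *\<^sub>R column 3 E + b *\<^sub>R column 4 E)"
proof (intro iffI conjI)
  assume n: "n \<in> normal_fibre X N f x"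
  then show nT: "n \<in> tangent_space N (f x)" by (simp add: normal_fibre_def)
  have "column i E \<bullet> (G *v n d) = 0" if "i = 1 \<or> i = 2" for i :: 4
  proof -
    obtain w where w: "column i E = DF w" using \<open>i = 1 \<or> i = 2\<close> ER by metis
    let ?v = "tvec_of X x c w"
    have vT: "?v \<in> tangent_space X x" by (rule tvec_of_in_tangent_space[OF X(1) c])
    then have "metric N (f x) (differential X N f x ?v) n = 0" using n by (simp add: normal_fibre_def)
    moreover have "differential X N f x ?v d = column i E"
      unfolding differential_DF[OF vT] tvec_of_self[OF N(1) d] tvec_of_self[OF X(1) c] w ..
    ultimately show ?thesis
      using metric_eq_gram[OF N d differential_in_tangent_space[OF X N f c d vT] nT] by (simp add: G_def)
  qed
  then show "\<exists>a b. n d = a *\<^sub>R column 3 E + b *\<^sub>R column 4 E"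
    using column_expansion[OF E(1), of "n d"] unfolding sum_4 by auto
next
  assume n: "n \<in> tangent_space N (f x) \<and> (\<exists>a b. n d = a *\<^sub>R column 3 E + b *\<^sub>R column 4 E)"
  then obtain a b where ab: "n d = a *\<^sub>R column 3 E + b *\<^sub>R column 4 E" by blast
  have "metric N (f x) (differential X N f x v) n = 0" if v: "v \<in> tangent_space X x" for v
  proof -
    have nT: "n \<in> tangent_space N (f x)" using n by blast
    have "metric N (f x) (differential X N f x v) n = DF (v c) \<bullet> (G *v n d)"
      unfolding metric_eq_gram[OF N d differential_in_tangent_space[OF X N f c d v] nT]
      by (simp add: differential_DF[OF v] tvec_of_self[OF N(1) d] G_def)
    also have "\<dots> = n d \<bullet> (G *v DF (v c))" by (rule symmetric_inner_swap[OF G_sym])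
    also have "\<dots> = 0" by (simp add: ab inner_add_left DF_normal)
    finally show ?thesis .
  qed
  then show "n \<in> normal_fibre X N f x" using n by (simp add: normal_fibre_def)
qed

text \<open>Existence is the orthonormal expansion of w, whose first two terms lie in the image of
  \<open>DF\<close>. Uniqueness holds because columns 3 and 4 of \<open>E\<close> are orthogonal to
  that image.\<close>

lemma normal_part_tvec_of:
  "normal_part X N f x (tvec_of N (f x) d w) =
    tvec_of N (f x) d ((column 3 E \<bullet> (G *v w)) *\<^sub>R column 3 E + (column 4 E \<bullet> (G *v w)) *\<^sub>R column 4 E)"
  (is "_ = tvec_of N (f x) d ?n")
  unfolding normal_part_def
proof (rule the_equality)
  note lt = linear_tvec_of[OF N(1) d] and T = tvec_of_in_tangent_space[OF N(1) d]
  define q where "q = (\<chi> i::2. column (if i = 1 then 1 else 2) E \<bullet> (G *v w))"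
  have "w - ?n = DF (R *v q)"
    using column_expansion[OF E(1), of w] unfolding DF_R sum_4 q_def by (simp add: algebra_simps)
  then have "tvec_of N (f x) d w - tvec_of N (f x) d ?n = tvec_of N (f x) d (DF (R *v q))"
    by (simp only: linear_diff[OF lt, symmetric])
  also have "\<dots> = differential X N f x (tvec_of X x c (R *v q))"
    by (simp add: differential_DF[OF tvec_of_in_tangent_space[OF X(1) c]] tvec_of_self[OF X(1) c])
  finally show "tvec_of N (f x) d ?n \<in> normal_fibre X N f x \<and>
      tvec_of N (f x) d w - tvec_of N (f x) d ?n \<in> differential X N f x ` tangent_space X x"
    using tvec_of_in_tangent_space[OF X(1) c] T unfolding normal_fibre_iff tvec_of_self[OF N(1) d] by blast
next
  fix n assume n: "n \<in> normal_fibre X N f x \<and>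
    tvec_of N (f x) d w - n \<in> differential X N f x ` tangent_space X x"
  then obtain a b v where ab: "n d = a *\<^sub>R column 3 E + b *\<^sub>R column 4 E"
    and v: "v \<in> tangent_space X x" "tvec_of N (f x) d w - n = differential X N f x v"
    unfolding normal_fibre_iff by blast
  have nT: "n \<in> tangent_space N (f x)" using n unfolding normal_fibre_iff by blast
  have "w - n d = DF (v c)"
    using fun_cong[OF v(2), of d] unfolding differential_DF[OF v(1)] by (simp add: tvec_of_self[OF N(1) d])
  then have w: "w = n d + DF (v c)" by (simp add: algebra_simps)
  have "column j E \<bullet> (G *v w) = column j E \<bullet> (G *v n d)" if "j = 3 \<or> j = 4" for j
    unfolding w by (simp add: matrix_vector_right_distrib inner_add_right DF_normal[OF that])
  then have "n d = ?n"
    unfolding ab by (simp add: matrix_vector_right_distrib matrix_vector_mult_scaleR inner_add_right E_orthonormal)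
  then show "n = tvec_of N (f x) d ?n" using tvec_of_component[OF N(1) d nT] by simp
qed

abbreviation "h j u v \<equiv> column j E \<bullet> (G *v hess u v)"

lemma second_fundamental_form_eq:
  assumes "u \<in> tangent_space X x" "v \<in> tangent_space X x"
  shows "second_fundamental_form X N f x u v =
    tvec_of N (f x) d (h 3 (u c) (v c) *\<^sub>R column 3 E + h 4 (u c) (v c) *\<^sub>R column 4 E)"
  unfolding second_fundamental_form_def Let_def c_def[symmetric] cov_deriv_differential[OF assms(1)]
  by (rule normal_part_tvec_of)

text \<open>The formula of \<open>frame_connection\<close> for an adapted frame around the point. Of
  \<Omega> only the normal rows of the tangential columns are computed: the diagonal blocks depend
  on the frame and commute with the twistor matrices.\<close>

lemma lift_deriv_vert_eq:
  assumes v: "v \<in> tangent_space X x"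
  shows "\<exists>\<Omega>. transpose \<Omega> = - \<Omega> \<and>
    (\<forall>j. j = 3 \<or> j = 4 \<longrightarrow> \<Omega> $ j $ 1 = h j (v c) (column 1 R) \<and> \<Omega> $ j $ 2 = h j (v c) (column 2 R)) \<and>
    (\<forall>u\<in>tangent_space N (f x). lift_deriv_vert \<epsilon> X N f x v u = tvec_of N (f x) d
      ((E ** (\<Omega> ** twistor_matrix (twistor_sgn \<epsilon>) - twistor_matrix (twistor_sgn \<epsilon>) ** \<Omega>) ** (transpose E ** G)) *v u d))"
proof -
  define y0 where "y0 = cmap c x"
  define K where "K = twistor_matrix (twistor_sgn \<epsilon>)"
  obtain U where U: "smooth_on F U" "open U" "y0 \<in> U" using F_smooth unfolding y0_def by blast
  have Fy0: "F y0 = cmap d (f x)" unfolding y0_def by (rule F_at)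
  have E1: "transpose E ** gram N d (F y0) ** E = mat 1" using E(1) by (simp add: Fy0 G_def)
  note frame_at = adapted_frame[OF X N f c d, folded F_def y0_def]
  obtain Rf Ef R' E' where Rf0: "Rf y0 = R" and Ef0: "Ef y0 = E"
    and dRf: "(Rf has_derivative R') (at y0)" and dEf: "(Ef has_derivative E') (at y0)"
    and onRf: "\<forall>\<^sub>F y in nhds y0. transpose (Rf y) ** gram X c y ** Rf y = mat 1 \<and> det (Rf y) > 0"
    and onEf: "\<forall>\<^sub>F y in nhds y0. transpose (Ef y) ** gram N d (F y) ** Ef y = mat 1 \<and> det (Ef y) > 0"
    and ERf: "\<And>y. column 1 (Ef y) = frechet_derivative F (at y) (column 1 (Rf y))"
      "\<And>y. column 2 (Ef y) = frechet_derivative F (at y) (column 2 (Rf y))"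
    by (rule frame_at[OF R(1)[folded y0_def] R(2) E1 E(2) ER[unfolded DF_def, folded y0_def]]) (rule that)
  note Rf = Rf0 dRf onRf and Ef = Ef0 dEf onEf
  define H where "H y = gram N d (F y)" for y
  have Hy0: "H y0 = G" by (simp add: H_def Fy0 G_def)
  have dF: "(F has_derivative DF) (at y0)"
    unfolding DF_def y0_def[symmetric] by (rule smooth_on_imp_has_derivative[OF U(1,3)])
  have dH: "(H has_derivative (\<lambda>h. frechet_derivative (gram N d) (at (cmap d (f x))) (DF h))) (at y0)"
    unfolding H_def using has_derivative_compose[OF dF, of "gram N d"] gram_has_derivative[OF N d] by (simp add: Fy0)
  define \<Gamma> where "\<Gamma> = matrix (christoffel (gram N d) (cmap d (f x)) (DF (v c)))"
  have \<Gamma>: "\<Gamma> *v a = christoffel (gram N d) (cmap d (f x)) (DF (v c)) a" for a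
    unfolding \<Gamma>_def using matrix_vector_mul(2)[OF linear_christoffel_gram] by metis
  have compat: "frechet_derivative (gram N d) (at (cmap d (f x))) (DF (v c)) = H y0 ** \<Gamma> + transpose \<Gamma> ** H y0"
    unfolding \<Gamma>_def Hy0 G_def
    by (rule christoffel_metric_compatible[OF gram_differentiable[OF N d] transpose_gram_on_chart[OF N d]])
      (rule gram_pos[OF N d])
  have frame: "\<forall>\<^sub>F z in nhds y0. transpose (Ef z) ** H z ** Ef z = mat 1"
    using Ef(3) unfolding H_def by (rule eventually_mono) simp
  have symH: "transpose (H y0) = H y0" unfolding Hy0 by (rule G_sym)
  define \<Omega> where "\<Omega> = transpose E ** G ** (E' (v c) + \<Gamma> ** E)"
  note conn = frame_connection[OF Ef(2) dH frame symH compat, unfolded Ef(1) Hy0, folded \<Omega>_def]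
  define J where "J z = Ef z ** K ** (transpose (Ef z) ** H z)" for z
  obtain J' where J': "(J has_derivative J') (at y0)"
    "J' (v c) - (J y0 ** \<Gamma> - \<Gamma> ** J y0) = E ** (\<Omega> ** K - K ** \<Omega>) ** (transpose E ** G)"
    using conn(2)[of K] unfolding J_def Ef(1) Hy0 by blast
  define z where "z x' = twistor_coords N d (twistor_lift \<epsilon> X N f x')" for x'
  \<comment> \<open>The lift is given by \<open>THE\<close> at each point; near y0 its coordinates
    agree with an explicit pair, which can be differentiated.\<close>
  have ez: "\<forall>\<^sub>F y in nhds y0. (F y, J y) = (z \<circ> chart_inv c) y"
    using eventually_overlap[OF X N f c d, folded y0_def] Rf(3) Ef(3)
  proof eventually_elim
    case (elim y)
    define x' where "x' = chart_inv c y"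
    have c': "c \<in> charts_at X x'" and d': "d \<in> charts_at N (f x')" and y: "cmap c x' = y"
      using elim by (simp_all add: x'_def)
    have Fy: "F y = cmap d (f x')" by (simp add: F_def x'_def)
    have "twistor_lift \<epsilon> X N f x' = (f x', frame_twistor N (f x') d (Ef y) (twistor_sgn \<epsilon>))"
      by (rule twistor_lift_eq[OF X N f c' d', of "Rf y"])
        (use elim ERf in \<open>simp_all add: y Fy[symmetric], simp_all add: F_def\<close>)
    moreover have "matrix (\<lambda>w. frame_twistor N (f x') d (Ef y) (twistor_sgn \<epsilon>) (tvec_of N (f x') d w) d) = J y"
      unfolding frame_twistor_def
      by (simp add: tvec_of_in_tangent_space[OF N(1) d'] tvec_of_self[OF N(1) d'] J_def H_def Fy K_def)
    ultimately show ?case by (simp add: z_def twistor_coords_def Fy x'_def[symmetric])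
  qed
  have "(z \<circ> chart_inv c has_derivative (\<lambda>h. (DF h, J' h))) (at y0)"
    using ez eventually_nhds_x_imp_x[OF ez]
    by (intro has_derivative_transform_eventually[OF has_derivative_Pair[OF dF J'(1)]])
      (auto simp: eventually_nhds_conv_at)
  then have dz: "dir_deriv X x v z = (DF (v c), J' (v c))"
    unfolding y0_def by (rule dir_deriv_eq[OF X(1) c v])
  have zx: "z x = (cmap d (f x), J y0)"
    using eventually_nhds_x_imp_x[OF ez] c by (simp add: F_at y0_def chart_inv_cmap[OF X(1)] charts_at_def)
  \<comment> \<open>\<open>horizontal_lift\<close> contributes exactly the bracket of
    \<open>J y0\<close> and \<Gamma> that turns \<open>J'\<close> into the covariant
    derivative.\<close>
  have lift: "lift_deriv_vert \<epsilon> X N f x v u = tvec_of N (f x) d ((E ** (\<Omega> ** K - K ** \<Omega>) ** (transpose E ** G)) *v u d)"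
    if "u \<in> tangent_space N (f x)" for u
    unfolding lift_deriv_vert_def Let_def d_def[symmetric] z_def[symmetric] dz zx vertical_part_def horizontal_lift_def
    using that by (simp add: \<Gamma>_def[symmetric] J'(2))
  \<comment> \<open>Two expressions for the derivative of one column: directly, and through the
    moving frame of the surface by the product rule.\<close>
  have colE: "column i (E' (v c)) = frechet_derivative (\<lambda>z. frechet_derivative F (at z) (column i' R)) (at y0) (v c) +
      DF (column i' (R' (v c)))"
    if "\<And>y. column i (Ef y) = frechet_derivative F (at y) (column i' (Rf y))" for i i'
  proof -
    have lin: "bounded_linear (\<lambda>A. column k A :: real ^ 'a)" for k :: "'b::finite"
      unfolding linear_conv_bounded_linear[symmetric] by (intro linearI) (auto simp: column_def vec_eq_iff)
    have 1: "((\<lambda>y. column i (Ef y)) has_derivative (\<lambda>h. column i (E' h))) (at y0)"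
      by (rule bounded_linear.has_derivative[OF lin Ef(2)])
    have "((\<lambda>y. column i' (Rf y)) has_derivative (\<lambda>h. column i' (R' h))) (at y0)"
      by (rule bounded_linear.has_derivative[OF lin Rf(2)])
    from has_derivative_frechet_derivative_apply[OF U this]
    have 2: "((\<lambda>y. column i (Ef y)) has_derivative
        (\<lambda>h. frechet_derivative (\<lambda>z. frechet_derivative F (at z) (column i' R)) (at y0) h + DF (column i' (R' h)))) (at y0)"
      unfolding that Rf(1) DF_def y0_def[symmetric] .
    show ?thesis using fun_cong[OF has_derivative_unique[OF 1 2], of "v c"] .
  qed
  have entry: "\<Omega> $ j $ i = h j (v c) (column i' R)"
    if j: "j = 3 \<or> j = 4" and i: "column i E = DF (column i' R)"
      "\<And>y. column i (Ef y) = frechet_derivative F (at y) (column i' (Rf y))" for i i' j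
  proof -
    have "column i (E' (v c) + \<Gamma> ** E) = column i (E' (v c)) + \<Gamma> *v column i E"
      by (simp add: column_def vec_eq_iff matrix_matrix_mult_def matrix_vector_mult_def)
    also have "\<dots> = hess (v c) (column i' R) + DF (column i' (R' (v c)))"
      unfolding colE[OF i(2)] \<Gamma> i(1) hess_commute[of "v c"] 
      by (simp add: hessian_def y0_def F_at DF_def christoffel_gram_commute[of "frechet_derivative F (at (cmap c x)) (v c)"])
    finally have col: "column i (E' (v c) + \<Gamma> ** E) = hess (v c) (column i' R) + DF (column i' (R' (v c)))" .
    have "\<Omega> $ j $ i = column j E \<bullet> (G *v column i (E' (v c) + \<Gamma> ** E))"
      unfolding \<Omega>_def matrix_mul_assoc[symmetric]
      by (simp add: matrix_matrix_mult_def matrix_vector_mult_def transpose_def column_def inner_vec_def)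
    \<comment> \<open>The unknown derivative of the surface frame enters through a vector in the
      image of \<open>DF\<close>, which has no normal component.\<close>
    then show ?thesis unfolding col by (simp add: matrix_vector_right_distrib inner_add_right DF_normal[OF j])
  qed
  show ?thesis
    using conn(1) entry[OF _ ER(1) ERf(1)] entry[OF _ ER(2) ERf(2)] lift unfolding K_def
    by (intro exI[of _ \<Omega>]) blast
qed

text \<open>The 4 of \<open>commutator_frobenius\<close> and the 1/16 of
  \<open>vertical_norm\<close> leave 1/4: these are the squares of \<omega>_14 + t \<omega>_23 and
  \<omega>_13 - t \<omega>_24, each divided by 2, as in the normalisation.\<close>

lemma vertical_norm_lift_deriv_vert:
  assumes v: "v \<in> tangent_space X x" and t: "t = twistor_sgn \<epsilon>"
  shows "(vertical_norm N (f x) (lift_deriv_vert \<epsilon> X N f x v))\<^sup>2 =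
    1 / 4 * ((h 4 (v c) (column 1 R) + t * h 3 (v c) (column 2 R))\<^sup>2 +
      (h 3 (v c) (column 1 R) - t * h 4 (v c) (column 2 R))\<^sup>2)"
proof -
  obtain \<Omega> where \<Omega>: "transpose \<Omega> = - \<Omega>"
    "\<And>j. j = 3 \<or> j = 4 \<Longrightarrow> \<Omega> $ j $ 1 = h j (v c) (column 1 R) \<and> \<Omega> $ j $ 2 = h j (v c) (column 2 R)"
    "\<And>u. u \<in> tangent_space N (f x) \<Longrightarrow> lift_deriv_vert \<epsilon> X N f x v u = tvec_of N (f x) d
      ((E ** (\<Omega> ** twistor_matrix t - twistor_matrix t ** \<Omega>) ** (transpose E ** G)) *v u d)"
    using lift_deriv_vert_eq[OF v, of \<epsilon>] unfolding t by blast
  have "t = 1 \<or> t = - 1" unfolding t by (rule twistor_sgn_cases)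
  moreover have "(vertical_norm N (f x) (lift_deriv_vert \<epsilon> X N f x v))\<^sup>2 = 1 / 16 *
      (\<Sum>i\<in>UNIV. \<Sum>j\<in>UNIV. ((\<Omega> ** twistor_matrix t - twistor_matrix t ** \<Omega>) $ i $ j)\<^sup>2)"
    by (rule vertical_norm_frame[OF N d E(1)[unfolded G_def]]) (rule \<Omega>(3)[unfolded G_def])
  ultimately show ?thesis
    using commutator_frobenius[OF _ \<Omega>(1), of t] \<Omega>(2)[of 3] \<Omega>(2)[of 4] by simp
qed

section \<open>Norms in terms of the components of the second fundamental form\<close>

abbreviation "A i j \<equiv> h 3 (onb_at X x i c) (onb_at X x j c)"
abbreviation "B i j \<equiv> h 4 (onb_at X x i c) (onb_at X x j c)"

lemma onb_tangent: "onb_at X x i \<in> tangent_space X x"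
  using onb_at_orthonormal[OF X x] by (auto simp: orthonormal_basis_def)

lemma linear_h: "linear (h j u)"
  by (intro linearI) (simp_all add: linear_add[OF linear_hess] linear_scale[OF linear_hess]
      matrix_vector_right_distrib matrix_vector_mult_scaleR inner_add_right)

lemma h_commute: "h j u v = h j v u"
  by (simp only: hess_commute[of u])

lemma norm_tvec_of_normal:
  "metric N (f x) (tvec_of N (f x) d (a *\<^sub>R column 3 E + b *\<^sub>R column 4 E))
    (tvec_of N (f x) d (a *\<^sub>R column 3 E + b *\<^sub>R column 4 E)) = a\<^sup>2 + b\<^sup>2"
  unfolding metric_tvec_of[OF N d] G_def[symmetric]
  by (simp add: matrix_vector_right_distrib matrix_vector_mult_scaleR inner_add_left inner_add_right
      E_orthonormal power2_eq_square)

text \<open>\<open>A\<close> and \<open>B\<close> use the basis \<open>onb_at\<close>, whereas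
  \<open>vertical_norm_lift_deriv_vert\<close> uses \<open>R\<close>. Passing from one to the other
  introduces \<sigma>, always next to t: a wrongly oriented basis merely exchanges the two lifts in
  the formula.\<close>

lemma lift_deriv_vert_norm_square:
  assumes t: "t = twistor_sgn \<epsilon>"
  shows "(lift_deriv_vert_norm \<epsilon> X N f x)\<^sup>2 =
    1 / 4 * ((B 1 1 + t * \<sigma> * A 1 2)\<^sup>2 + (A 1 1 - t * \<sigma> * B 1 2)\<^sup>2 +
      (B 1 2 + t * \<sigma> * A 2 2)\<^sup>2 + (A 1 2 - t * \<sigma> * B 2 2)\<^sup>2)"
proof -
  have vertical: "(vertical_norm N (f x) (lift_deriv_vert \<epsilon> X N f x (onb_at X x k)))\<^sup>2 =
      1 / 4 * ((B k 1 + t * \<sigma> * A k 2)\<^sup>2 + (A k 1 - t * \<sigma> * B k 2)\<^sup>2)" for k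
    unfolding vertical_norm_lift_deriv_vert[OF onb_tangent t] R_onb linear_scale[OF linear_h]
    by (simp add: mult.assoc)
  have "(lift_deriv_vert_norm \<epsilon> X N f x)\<^sup>2 =
      (\<Sum>k\<in>UNIV. (vertical_norm N (f x) (lift_deriv_vert \<epsilon> X N f x (onb_at X x k)))\<^sup>2)"
    unfolding lift_deriv_vert_norm_def by (intro real_sqrt_pow2 sum_nonneg) simp
  then show ?thesis
    unfolding vertical sum_2 h_commute[of _ "onb_at X x 2 c" "onb_at X x 1 c"] by (simp add: algebra_simps)
qed

lemma II_norm_square:
  "(II_norm X N f x)\<^sup>2 = (A 1 1)\<^sup>2 + (B 1 1)\<^sup>2 + 2 * ((A 1 2)\<^sup>2 + (B 1 2)\<^sup>2) + (A 2 2)\<^sup>2 + (B 2 2)\<^sup>2"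
proof -
  have "(II_norm X N f x)\<^sup>2 = (\<Sum>i\<in>UNIV. \<Sum>k\<in>UNIV. (A k i)\<^sup>2 + (B k i)\<^sup>2)"
    unfolding II_norm_def Let_def second_fundamental_form_eq[OF onb_tangent onb_tangent] norm_tvec_of_normal
    by (simp add: sum_nonneg)
  then show ?thesis
    unfolding sum_2 h_commute[of _ "onb_at X x 2 c" "onb_at X x 1 c"] by simp
qed

text \<open>The cross terms carry the factor t and cancel. Each remaining square occurs for both
  lifts with weight 1/4, and those of \<open>A 1 2\<close> and \<open>B 1 2\<close> occur twice, as
  they do in \<open>II_norm_square\<close>.\<close>

lemma lift_norms_sum:
  "(lift_deriv_vert_norm Minus X N f x)\<^sup>2 + (lift_deriv_vert_norm Plus X N f x)\<^sup>2 = 1 / 2 * (II_norm X N f x)\<^sup>2"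
proof -
  show ?thesis
    using \<sigma> unfolding II_norm_square lift_deriv_vert_norm_square[OF refl]
    by (elim disjE) (simp_all add: twistor_sgn_def power2_eq_square algebra_simps)
qed

lemma normal_components:
  assumes "tvec_of N (f x) d (a *\<^sub>R column 3 E + b *\<^sub>R column 4 E) = k *\<^sub>R l"
  shows "a = k * (column 3 E \<bullet> (G *v l d))" "b = k * (column 4 E \<bullet> (G *v l d))"
proof -
  have eq: "a *\<^sub>R column 3 E + b *\<^sub>R column 4 E = k *\<^sub>R l d"
    using fun_cong[OF assms, of d] by (simp add: tvec_of_self[OF N(1) d])
  have "column j E \<bullet> (G *v (a *\<^sub>R column 3 E + b *\<^sub>R column 4 E)) = k * (column j E \<bullet> (G *v l d))" for j
    unfolding eq by (simp add: matrix_vector_mult_scaleR)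
  from this[of 3] this[of 4] show "a = k * (column 3 E \<bullet> (G *v l d))" "b = k * (column 4 E \<bullet> (G *v l d))"
    by (simp_all add: matrix_vector_right_distrib matrix_vector_mult_scaleR inner_add_right E_orthonormal)
qed

section \<open>The minimal case\<close>

lemma mean_curvature_zero:
  assumes "mean_curvature X N f x = 0"
  shows "A 2 2 = - A 1 1" "B 2 2 = - B 1 1"
proof -
  have "second_fundamental_form X N f x (onb_at X x 1) (onb_at X x 1) +
      second_fundamental_form X N f x (onb_at X x 2) (onb_at X x 2) = 0"
    using assms by (simp add: mean_curvature_def sum_2)
  \<comment> \<open>Zero is written as a multiple of a vector to fit
    \<open>normal_components\<close>.\<close>
  then have "tvec_of N (f x) d ((A 1 1 + A 2 2) *\<^sub>R column 3 E + (B 1 1 + B 2 2) *\<^sub>R column 4 E) = 0 *\<^sub>R 0"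
    unfolding second_fundamental_form_eq[OF onb_tangent onb_tangent] linear_add[OF linear_tvec_of[OF N(1) d], symmetric]
    by (simp add: algebra_simps)
  from normal_components[OF this] show "A 2 2 = - A 1 1" "B 2 2 = - B 1 1" by linarith+
qed

text \<open>Nonnegativity allows comparing squares, where only cross terms survive. They come from
  the two basis vectors in equal parts once \<open>A 2 2\<close> and \<open>B 2 2\<close> are
  eliminated, whence the factor 2.\<close>

lemma lift_norms_equal_iff:
  assumes "mean_curvature X N f x = 0"
  shows "lift_deriv_vert_norm Minus X N f x = lift_deriv_vert_norm Plus X N f x \<longleftrightarrow> A 1 1 * B 1 2 = B 1 1 * A 1 2"
proof -
  have nonneg: "0 \<le> lift_deriv_vert_norm \<epsilon> X N f x" for \<epsilon>
    unfolding lift_deriv_vert_norm_def by (intro real_sqrt_ge_zero sum_nonneg) simp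
  have "lift_deriv_vert_norm Minus X N f x = lift_deriv_vert_norm Plus X N f x \<longleftrightarrow>
      (lift_deriv_vert_norm Plus X N f x)\<^sup>2 - (lift_deriv_vert_norm Minus X N f x)\<^sup>2 = 0"
    using power2_eq_iff_nonneg[OF nonneg nonneg, of Minus Plus] by auto
  also have "(lift_deriv_vert_norm Plus X N f x)\<^sup>2 - (lift_deriv_vert_norm Minus X N f x)\<^sup>2 =
      2 * \<sigma> * (B 1 1 * A 1 2 - A 1 1 * B 1 2)"
    unfolding lift_deriv_vert_norm_square[OF refl] mean_curvature_zero[OF assms]
    by (simp add: twistor_sgn_def power2_eq_square algebra_simps)
  finally show ?thesis using \<sigma> by auto
qed

text \<open>A trace-free symmetric form on a plane is determined by its values at (1, 1) and (1, 2);
  the equation says that these two normal vectors are linearly dependent.\<close>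

lemma II_in_line_iff:
  assumes H: "mean_curvature X N f x = 0"
  shows "(\<exists>L. subspace L \<and> dim L = 1 \<and> L \<subseteq> normal_fibre X N f x \<and>
      (\<forall>u\<in>tangent_space X x. \<forall>v\<in>tangent_space X x. second_fundamental_form X N f x u v \<in> L)) \<longleftrightarrow>
    A 1 1 * B 1 2 = B 1 1 * A 1 2"
proof
  assume "\<exists>L. subspace L \<and> dim L = 1 \<and> L \<subseteq> normal_fibre X N f x \<and>
      (\<forall>u\<in>tangent_space X x. \<forall>v\<in>tangent_space X x. second_fundamental_form X N f x u v \<in> L)"
  then obtain L where L: "dim L = 1"
    "\<And>i j. second_fundamental_form X N f x (onb_at X x i) (onb_at X x j) \<in> L" using onb_tangent by blast
  obtain b where b: "L \<subseteq> span b" "card b = dim L" using basis_exists[of L] by metis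
  then obtain l where "b = {l}" using L(1) card_1_singletonE by metis
  then have "\<exists>k. second_fundamental_form X N f x (onb_at X x i) (onb_at X x j) = k *\<^sub>R l" for i j
    using L(2)[of i j] b(1) by (auto simp: span_singleton)
  then obtain k where k: "\<And>i j. second_fundamental_form X N f x (onb_at X x i) (onb_at X x j) = k i j *\<^sub>R l" by metis
  have "A i j = k i j * (column 3 E \<bullet> (G *v l d))" "B i j = k i j * (column 4 E \<bullet> (G *v l d))" for i j
    using normal_components[OF k[of i j, unfolded second_fundamental_form_eq[OF onb_tangent onb_tangent]]] by blast+
  then show "A 1 1 * B 1 2 = B 1 1 * A 1 2" by simp
next
  assume cross: "A 1 1 * B 1 2 = B 1 1 * A 1 2"
  \<comment> \<open>(p, q) spans a line containing both vectors, and r, s are their coefficients on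
    it.\<close>
  obtain p q r s where pq: "p \<noteq> 0 \<or> q \<noteq> 0" and rs: "A 1 1 = r * p" "B 1 1 = r * q" "A 1 2 = s * p" "B 1 2 = s * q"
  proof (cases "A 1 1 \<noteq> 0 \<or> B 1 1 \<noteq> 0")
    case True
    show thesis
    proof (cases "A 1 1 = 0")
      case False
      show thesis by (rule that[of "A 1 1" "B 1 1" 1 "A 1 2 / A 1 1"]) (use False cross in \<open>auto simp: field_simps\<close>)
    next
      case A: True
      show thesis by (rule that[of "A 1 1" "B 1 1" 1 "B 1 2 / B 1 1"]) (use True A cross in \<open>auto simp: field_simps\<close>)
    qed
  next
    case zero: False
    show thesis
    proof (cases "A 1 2 \<noteq> 0 \<or> B 1 2 \<noteq> 0")
      case True
      show thesis by (rule that[of "A 1 2" "B 1 2" 0 1]) (use True zero in auto)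
    next
      case False
      \<comment> \<open>The form vanishes here, but a line is still required; any normal direction
        will do.\<close>
      show thesis by (rule that[of 1 0 0 0]) (use False zero in auto)
    qed
  qed
  define l where "l = tvec_of N (f x) d (p *\<^sub>R column 3 E + q *\<^sub>R column 4 E)"
  note lt = linear_tvec_of[OF N(1) d]
  have "l \<noteq> 0"
  proof
    assume "l = 0"
    then have "tvec_of N (f x) d (p *\<^sub>R column 3 E + q *\<^sub>R column 4 E) = 0 *\<^sub>R 0" by (simp add: l_def)
    from normal_components[OF this] pq show False by simp
  qed
  have kl: "k *\<^sub>R l = tvec_of N (f x) d ((k * p) *\<^sub>R column 3 E + (k * q) *\<^sub>R column 4 E)" for k
    unfolding l_def linear_scale[OF lt, symmetric] by (simp add: scaleR_add_right)
  have "dim (span {l}) = 1"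
    using \<open>l \<noteq> 0\<close> by (simp add: dim_span dim_eq_card_independent[of "{l}"])
  moreover have "span {l} \<subseteq> normal_fibre X N f x"
  proof
    fix n assume "n \<in> span {l}"
    then obtain k where k: "n = k *\<^sub>R l" by (auto simp: span_singleton)
    show "n \<in> normal_fibre X N f x"
      unfolding k kl normal_fibre_iff tvec_of_self[OF N(1) d] using tvec_of_in_tangent_space[OF N(1) d] by blast
  qed
  moreover have "second_fundamental_form X N f x u v \<in> span {l}"
    if uv: "u \<in> tangent_space X x" "v \<in> tangent_space X x" for u v
  proof -
    have "\<exists>a b. w = a *\<^sub>R onb_at X x 1 c + b *\<^sub>R onb_at X x 2 c" for w
    proof -
      define q where "q = (transpose R ** gram X c (cmap c x)) *v w"
      have "w = R *v q" by (simp only: q_def R_expand)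
      also have "\<dots> = q$1 *\<^sub>R column 1 R + q$2 *\<^sub>R column 2 R"
        by (simp add: vec_eq_iff forall_2 matrix_vector_mult_def sum_2 column_def mult.commute)
      finally show ?thesis unfolding R_onb scaleR_scaleR by blast
    qed
    then obtain a1 a2 b1 b2 where ab: "u c = a1 *\<^sub>R onb_at X x 1 c + a2 *\<^sub>R onb_at X x 2 c"
      "v c = b1 *\<^sub>R onb_at X x 1 c + b2 *\<^sub>R onb_at X x 2 c" by meson
    have expand: "h j (u c) (v c) = a1 * b1 * h j (onb_at X x 1 c) (onb_at X x 1 c) +
        (a1 * b2 + a2 * b1) * h j (onb_at X x 1 c) (onb_at X x 2 c) +
        a2 * b2 * h j (onb_at X x 2 c) (onb_at X x 2 c)" for j
    proof -
      have "h j (u c) w = a1 * h j (onb_at X x 1 c) w + a2 * h j (onb_at X x 2 c) w" for w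
        unfolding h_commute[of j _ w] ab(1) linear_add[OF linear_h] linear_scale[OF linear_h] by simp
      then show ?thesis
        unfolding ab(2) linear_add[OF linear_h] linear_scale[OF linear_h]
        using h_commute[of j "onb_at X x 2 c" "onb_at X x 1 c"] by (simp add: algebra_simps)
    qed
    \<comment> \<open>The bilinear expansion with the value at (2, 2) replaced by minus the value at
      (1, 1).\<close>
    define k where "k = (a1 * b1 - a2 * b2) * r + (a1 * b2 + a2 * b1) * s"
    have "h 3 (u c) (v c) = k * p" "h 4 (u c) (v c) = k * q"
      unfolding expand mean_curvature_zero[OF H] rs k_def by (simp_all add: algebra_simps)
    then have "second_fundamental_form X N f x u v = k *\<^sub>R l"
      unfolding second_fundamental_form_eq[OF uv] kl by simp
    then show ?thesis by (auto simp: span_singleton)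
  qed
  ultimately show "\<exists>L. subspace L \<and> dim L = 1 \<and> L \<subseteq> normal_fibre X N f x \<and>
      (\<forall>u\<in>tangent_space X x. \<forall>v\<in>tangent_space X x. second_fundamental_form X N f x u v \<in> L)"
    by (intro exI[of _ "span {l}"] conjI subspace_span) blast+
qed

end

text \<open>Both orientations are corrected by a sign on a last vector: on the second of
  \<open>onb_at\<close> for the surface, recorded as \<sigma>, and on the fourth of the ambient
  frame, which leaves the two tangent columns untouched.\<close>

lemma adapted_frame_exists:
  fixes X :: "('x::topological_space, 2) manifold" and N :: "('n::topological_space, 4) manifold"
  assumes X: "oriented_smooth_atlas X" "riemannian X" and N: "oriented_smooth_atlas N" "riemannian N"
    and f: "isometric_immersion X N f" and x: "x \<in> carrier X"
  shows "\<exists>c d F G DF R E \<sigma>. adapted_frame_at X N f x c d F G DF R E \<sigma>"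
proof -
  define c where "c = chart_at X x"
  define d where "d = chart_at N (f x)"
  define F where "F = local_rep c d f"
  define G where "G = gram N d (cmap d (f x))"
  define DF where "DF = frechet_derivative F (at (cmap c x))"
  have c: "c \<in> charts_at X x" unfolding c_def by (rule chart_at_in[OF X(1) x])
  have d: "d \<in> charts_at N (f x)"
    unfolding d_def using f x by (intro chart_at_in[OF N(1)]) (auto simp: isometric_immersion_def smooth_map_def)
  define u where "u = onb_at X x"
  have onb: "orthonormal_basis X x u" unfolding u_def by (rule onb_at_orthonormal[OF X x])
  have u: "u i c \<bullet> (gram X c (cmap c x) *v u j c) = (if i = j then 1 else 0)" for i j
    using onb metric_eq_gram[OF X c, of "u i" "u j"] by (auto simp: orthonormal_basis_def image_subset_iff)
  define \<delta> where "\<delta> = u 1 c $ 1 * u 2 c $ 2 - u 1 c $ 2 * u 2 c $ 1"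
  have \<delta>: "\<delta> \<noteq> 0"
  proof -
    have "transpose (transpose (\<chi> i. u i c)) ** gram X c (cmap c x) ** transpose (\<chi> i. u i c) = mat 1"
      by (rule orthonormal_basis_frame[OF X c onb])
    from arg_cong[OF this, of det]
    have "det (\<chi> i. u i c) * det (gram X c (cmap c x)) * det (\<chi> i. u i c) = 1"
      by (simp only: det_I det_mul det_transpose)
    then show ?thesis by (auto simp: det_2 \<delta>_def)
  qed
  define \<sigma> where "\<sigma> = sgn \<delta>"
  have \<sigma>: "\<sigma> = 1 \<or> \<sigma> = - 1" using \<delta> by (auto simp: \<sigma>_def sgn_if)
  define R where "R = transpose (\<chi> i::2. if i = 1 then u 1 c else \<sigma> *\<^sub>R u 2 c)"
  have Rc: "column 1 R = u 1 c" "column 2 R = \<sigma> *\<^sub>R u 2 c"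
    by (simp_all add: R_def column_def transpose_def vec_eq_iff)
  have R: "transpose R ** gram X c (cmap c x) ** R = mat 1"
    unfolding frame_iff forall_2 Rc using \<sigma> by (auto simp: u matrix_vector_mult_scaleR)
  have "det R = \<sigma> * \<delta>" by (simp add: R_def det_2 transpose_def \<delta>_def algebra_simps)
  then have detR: "det R > 0" using \<delta> by (simp add: \<sigma>_def sgn_if)
  \<comment> \<open>Only the values at 1 and 2 are prescribed; the extension supplies the other
    two.\<close>
  define e0 where "e0 i = (if i = 1 then DF (column 1 R) else DF (column 2 R))" for i :: 4
  have iso: "DF a \<bullet> (G *v DF b) = a \<bullet> (gram X c (cmap c x) *v b)" for a b
    unfolding DF_def F_def G_def by (rule local_rep_isometric[OF X N f c d])
  have RR: "column i R \<bullet> (gram X c (cmap c x) *v column j R) = (if i = j then 1 else 0)" for i j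
    using R by (simp add: frame_iff)
  have e0: "e0 i \<bullet> (G *v e0 j) = (if i = j then 1 else 0)" if "i \<in> {1, 2}" "j \<in> {1, 2}" for i j
    using that by (auto simp: e0_def iso RR)
  obtain e where e: "\<And>i. i \<in> {1, 2} \<Longrightarrow> e i = e0 i" "\<And>i j. e i \<bullet> (G *v e j) = (if i = j then 1 else 0)"
    using orthonormal_family_extend[OF transpose_gram[OF N d] gram_pos[OF N d], folded G_def, of "{1, 2}" e0] e0
    by metis
  define \<eta> where "\<eta> = det (transpose (\<chi> i. e i))"
  have \<eta>: "\<eta> \<noteq> 0"
  proof -
    have "column i (transpose (\<chi> i. e i)) = e i" for i by (simp add: column_def transpose_def vec_eq_iff)
    then have "transpose (transpose (\<chi> i. e i)) ** G ** transpose (\<chi> i. e i) = mat 1"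
      unfolding frame_iff by (simp add: e(2))
    from arg_cong[OF this, of det] have "\<eta> * det G * \<eta> = 1"
      unfolding \<eta>_def by (simp only: det_I det_mul det_transpose)
    then show ?thesis by auto
  qed
  define E where "E = transpose (\<chi> i. (if i = 4 then sgn \<eta> else 1) *\<^sub>R e i)"
  have Ec: "column i E = (if i = 4 then sgn \<eta> else 1) *\<^sub>R e i" for i
    by (simp add: E_def column_def transpose_def vec_eq_iff)
  have E: "transpose E ** G ** E = mat 1"
    unfolding frame_iff Ec using \<eta> by (auto simp: e(2) matrix_vector_mult_scaleR sgn_if)
  have "det E = sgn \<eta> * \<eta>"
    unfolding E_def \<eta>_def det_4 by (simp add: transpose_def algebra_simps)
  then have detE: "det E > 0" using \<eta> by (simp add: sgn_if)
  have ER: "column 1 E = DF (column 1 R)" "column 2 E = DF (column 2 R)"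
    using e(1)[of 1] e(1)[of 2] by (simp_all add: Ec e0_def)
  have "adapted_frame_at X N f x c d F G DF R E \<sigma>"
    by (rule adapted_frame_at.intro)
      (fact X N f x c_def d_def F_def G_def DF_def R detR E detE ER \<sigma> Rc[unfolded u_def])+
  then show ?thesis by blast
qed

theorem proposition3p1:
  fixes X :: "('x::{t2_space, second_countable_topology}, 2) manifold"
    and N :: "('n::{t2_space, second_countable_topology}, 4) manifold"
    and f :: "'x \<Rightarrow> 'n"
  assumes "oriented_riemannian_manifold X"
    and "oriented_riemannian_manifold N"
    and "isometric_immersion X N f"
  shows "(\<forall>x\<in>carrier X.
            (lift_deriv_vert_norm Minus X N f x)\<^sup>2 + (lift_deriv_vert_norm Plus X N f x)\<^sup>2
              = 1 / 2 * (II_norm X N f x)\<^sup>2) \<and>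
         (minimal X N f \<longrightarrow>
            ((\<forall>x\<in>carrier X. lift_deriv_vert_norm Minus X N f x = lift_deriv_vert_norm Plus X N f x)
             \<longleftrightarrow>
             (\<forall>x\<in>carrier X. \<exists>L. subspace L \<and> dim L = 1 \<and> L \<subseteq> normal_fibre X N f x \<and>
                (\<forall>u\<in>tangent_space X x. \<forall>v\<in>tangent_space X x.
                   second_fundamental_form X N f x u v \<in> L))))"
proof (intro conjI ballI impI)
  have XN: "oriented_smooth_atlas X" "riemannian X" "oriented_smooth_atlas N" "riemannian N"
    using assms by (simp_all add: oriented_riemannian_manifold_def)
  note frame = adapted_frame_exists[OF XN assms(3)]
  show "(lift_deriv_vert_norm Minus X N f x)\<^sup>2 + (lift_deriv_vert_norm Plus X N f x)\<^sup>2
      = 1 / 2 * (II_norm X N f x)\<^sup>2" if "x \<in> carrier X" for x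
    using frame[OF that] adapted_frame_at.lift_norms_sum by blast
  assume "minimal X N f"
  \<comment> \<open>The equivalence already holds at each point separately, from the vanishing of
    the mean curvature there.\<close>
  have "lift_deriv_vert_norm Minus X N f x = lift_deriv_vert_norm Plus X N f x \<longleftrightarrow>
      (\<exists>L. subspace L \<and> dim L = 1 \<and> L \<subseteq> normal_fibre X N f x \<and>
        (\<forall>u\<in>tangent_space X x. \<forall>v\<in>tangent_space X x. second_fundamental_form X N f x u v \<in> L))"
    if x: "x \<in> carrier X" for x
  proof -
    obtain c d F G DF R E \<sigma> where "adapted_frame_at X N f x c d F G DF R E \<sigma>" using frame[OF x] by blast
    then interpret adapted_frame_at X N f x c d F G DF R E \<sigma> .
    have "mean_curvature X N f x = 0" using \<open>minimal X N f\<close> x by (simp add: minimal_def)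
    then show ?thesis using lift_norms_equal_iff II_in_line_iff by blast
  qed
  then show "(\<forall>x\<in>carrier X. lift_deriv_vert_norm Minus X N f x = lift_deriv_vert_norm Plus X N f x) \<longleftrightarrow>
      (\<forall>x\<in>carrier X. \<exists>L. subspace L \<and> dim L = 1 \<and> L \<subseteq> normal_fibre X N f x \<and>
        (\<forall>u\<in>tangent_space X x. \<forall>v\<in>tangent_space X x. second_fundamental_form X N f x u v \<in> L))"
    by blast
qed

end
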